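(* Let $R$ be a commutative ring with a homomorphism $\mathbb{Z}[\delta]\to R$, and let $n$ be a positive integer. The Jones–Wenzl projector in $TL_n\otimes_{\mathbb{Z}[\delta]}R$ exists if and only if the quantum binomial coefficient ${n\brack k}$ is invertible in $R$ for all $0\le k<n$.
   Context: $\mathcal{TL}$ is the Temperley–Lieb category over $\mathbb{Z}[\delta]$: objects are nonnegative integers, $\mathrm{Hom}(m,k)$ is the free $\mathbb{Z}[\delta]$-module on crossingless matchings in the planar strip with $m$ bottom points and $k$ top points, composition is stacking, each closed loop being replaced by the scalar $-\delta$. $TL_n=\mathrm{End}_{\mathcal{TL}}(n)$. $I_{<n}\subset TL_n$ is the ideal spanned by morphisms factoring through an object $k$ with $k<n$ (also denoting its base change to $R$). A Jones–Wenzl projector over $R$ is an idempotent $J_n\in TL_n\otimes_{\mathbb{Z}[\delta]}R$ with $J_nI_{<n}=I_{<n}J_n=0$ and $1-J_n\in I_{<n}$. The quantum binomial coefficient ${n\brack k}$ is the unique integer polynomial in $\delta$ which under $\delta\mapsto q+q^{-1}$ becomes $\frac{[n][n-1]\cdots[n-k+1]}{[1][2]\cdots[k]}$ with $[m]=\frac{q^m-q^{-m}}{q-q^{-1}}$; it is viewed in $R$ via $\mathbb{Z}[\delta]\to R$. *)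

theory Defs
  imports
    "HOL-Library.Disjoint_Sets"
    "HOL-Library.Poly_Mapping"
    "HOL-Computational_Algebra.Polynomial"
    "HOL-Computational_Algebra.Fraction_Field"
begin

text \<open>
  Boundary points of the strip are numbered from the left, starting with 0, on both the bottom
  and the top edge.
\<close>

datatype point = Bot nat | Top nat

definition boundary :: "nat \<Rightarrow> nat \<Rightarrow> point set" where
  "boundary m k = Bot ` {..<m} \<union> Top ` {..<k}"

text \<open>
  The position of a boundary point when the boundary of the strip is traversed
  counterclockwise: along the bottom from left to right, then along the top from right to left.
  A perfect matching can be drawn in the strip without crossings iff no two of its pairs
  interleave with respect to this order.
\<close>

primrec position :: "nat \<Rightarrow> nat \<Rightarrow> point \<Rightarrow> nat" where
  "position m k (Bot i) = i"
| "position m k (Top i) = m + (k - 1 - i)"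

definition crossingless :: "nat \<Rightarrow> nat \<Rightarrow> point set set \<Rightarrow> bool" where
  "crossingless m k D \<longleftrightarrow>
    \<not> (\<exists>a b c d. {a, c} \<in> D \<and> {b, d} \<in> D \<and>
        position m k a < position m k b \<and> position m k b < position m k c \<and>
        position m k c < position m k d)"

definition matchings :: "nat \<Rightarrow> nat \<Rightarrow> point set set set" where
  "matchings m k =
    {D. partition_on (boundary m k) D \<and> (\<forall>e\<in>D. card e = 2) \<and> crossingless m k D}"

definition id_matching :: "nat \<Rightarrow> point set set" where
  "id_matching n = {{Bot i, Top i} | i. i < n}"

text \<open>
  Stacking \<open>E\<close> on top of \<open>D\<close> identifies the top points of \<open>D\<close> with the bottom points of \<open>E\<close>.
  The connected components of the resulting graph are arcs, each meeting the outer boundary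
  in exactly two points, and closed loops, which do not meet it at all.
\<close>

datatype glued_point = Low nat | Mid nat | Up nat

primrec from_lower :: "point \<Rightarrow> glued_point" where
  "from_lower (Bot i) = Low i"
| "from_lower (Top i) = Mid i"

primrec from_upper :: "point \<Rightarrow> glued_point" where
  "from_upper (Bot i) = Mid i"
| "from_upper (Top i) = Up i"

primrec outer :: "point \<Rightarrow> glued_point" where
  "outer (Bot i) = Low i"
| "outer (Top i) = Up i"

definition glued_edges :: "point set set \<Rightarrow> point set set \<Rightarrow> glued_point set set" where
  "glued_edges D E = (`) from_lower ` D \<union> (`) from_upper ` E"

definition components :: "point set set \<Rightarrow> point set set \<Rightarrow> glued_point set set" where
  "components D E = \<Union>(glued_edges D E) // (\<Union>e\<in>glued_edges D E. e \<times> e)\<^sup>+"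

definition stack :: "point set set \<Rightarrow> point set set \<Rightarrow> point set set" where
  "stack D E = {outer -` C | C. C \<in> components D E \<and> outer -` C \<noteq> {}}"

definition loops :: "point set set \<Rightarrow> point set set \<Rightarrow> nat" where
  "loops D E = card {C \<in> components D E. outer -` C = {}}"

text \<open>
  The sort \<open>{comm_ring, comm_monoid_mult}\<close> is that of commutative rings with 1; unlike
  \<open>comm_ring_1\<close> it does not exclude the zero ring.

  For a ring homomorphism from \<open>\<int>[\<delta>]\<close> to \<open>R\<close>, the base change to \<open>R\<close> of the free
  \<open>\<int>[\<delta>]\<close>-module on the crossingless matchings is the free \<open>R\<close>-module on them. Its elements
  are represented by their finitely supported coefficient functions. The argument \<open>d\<close> below is
  the image of \<open>\<delta>\<close> in \<open>R\<close>.
\<close>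

type_synonym 'a tl = "point set set \<Rightarrow>\<^sub>0 'a"

definition tl_hom :: "nat \<Rightarrow> nat \<Rightarrow> ('a::{comm_ring, comm_monoid_mult}) tl set" where
  "tl_hom m k = {f. Poly_Mapping.keys f \<subseteq> matchings m k}"

definition tl_comp ::
    "'a::{comm_ring, comm_monoid_mult} \<Rightarrow> 'a tl \<Rightarrow> 'a tl \<Rightarrow> 'a tl" where
  "tl_comp d g f =
    (\<Sum>E\<in>Poly_Mapping.keys g. \<Sum>D\<in>Poly_Mapping.keys f.
      Poly_Mapping.single (stack D E)
        (Poly_Mapping.lookup g E * Poly_Mapping.lookup f D * (- d) ^ loops D E))"

definition tl_id :: "nat \<Rightarrow> ('a::{comm_ring, comm_monoid_mult}) tl" where
  "tl_id n = Poly_Mapping.single (id_matching n) 1"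

inductive_set tl_ideal :: "'a::{comm_ring, comm_monoid_mult} \<Rightarrow> nat \<Rightarrow> 'a tl set"
  for d :: 'a and n :: nat
where
  zero: "0 \<in> tl_ideal d n"
| add: "x \<in> tl_ideal d n \<Longrightarrow> k < n \<Longrightarrow> f \<in> tl_hom n k \<Longrightarrow> g \<in> tl_hom k n \<Longrightarrow>
    x + Poly_Mapping.map ((*) c) (tl_comp d g f) \<in> tl_ideal d n"

definition jones_wenzl_projector ::
    "'a::{comm_ring, comm_monoid_mult} \<Rightarrow> nat \<Rightarrow> 'a tl \<Rightarrow> bool" where
  "jones_wenzl_projector d n J \<longleftrightarrow>
    J \<in> tl_hom n n \<and> tl_comp d J J = J \<and>
    (\<forall>x\<in>tl_ideal d n. tl_comp d J x = 0 \<and> tl_comp d x J = 0) \<and>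
    tl_id n - J \<in> tl_ideal d n"

definition qvar :: "int poly fract" where
  "qvar = Fract [:0, 1:] 1"

definition qint :: "nat \<Rightarrow> int poly fract" where
  "qint m = (qvar ^ m - inverse qvar ^ m) / (qvar - inverse qvar)"

text \<open>
  The polynomial below exists for \<open>k \<le> n\<close>, and it is unique because \<open>q + q\<^sup>-\<^sup>1\<close> is
  transcendental over the rationals.
\<close>

definition qbinom :: "nat \<Rightarrow> nat \<Rightarrow> int poly" where
  "qbinom n k = (THE p. poly (map_poly of_int p) (qvar + inverse qvar) =
    (\<Prod>i<k. qint (n - i)) / (\<Prod>i=1..k. qint i))"

end

(*
  Diagrams act on tensor powers of the two-dimensional representation V of quantum sl2, an arc
  contributing a monomial in q to each assignment of signs to its ends. A diagram bent into a
  matching of 2n points becomes a vector, and J is a Jones-Wenzl projector exactly if the identity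
  has coefficient 1 and the contractions of J at all adjacent bottom points and at all adjacent top
  points vanish.

  Such a J is q-symmetric in the bottom and in the top signs, so one value determines its block of
  bottom weight k. Pairing the block with the q-symmetric vector of weight k kills all diagrams
  except the identity, and the sum over the signs produces the quantum binomial coefficient: its
  product with that value is plus or minus a power of q. This is done over R[q]/(q^2 - delta q + 1),
  realised on pairs of elements of R.

  Conversely, over the field of fractions of Z[q] the q-symmetric vector with block values
  proportional to the inverse binomial coefficients is killed by the raising operator. Diagrams are
  unitriangular, up to powers of q, on the ballot sequences, which determine a vector of weight 0
  killed by the raising operator. Hence this vector is a combination of diagrams, and after
  multiplication by the product of the binomial coefficients its coefficients lie in
  Z[delta] + q Z[delta]. Their components in Z[delta] satisfy the same linear equations and can be
  mapped to R.
*)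

theory Submission
  imports Defs "HOL-Library.Product_Plus"
begin

section \<open>Components of stacked diagrams\<close>

text \<open>\<open>R\<close> may have torsion or be zero and need not contain \<open>q\<close>, so
  neither semisimplicity nor a count of dimensions over \<open>R\<close> is at hand. For necessity
  it suffices that \<open>q\<close> acts invertibly on pairs, with inverse
  \<open>\<delta> - q\<close>: an equation between pairs can be divided by powers of
  \<open>q\<close>, and its first component is the wanted equation in \<open>R\<close>. For the
  converse a solution over the field alone would not do, because its denominators must be
  controlled. The triangular system has powers of \<open>-q\<close> on its diagonal, so solving it
  never leaves \<open>\<int>[\<delta>] + q \<int>[\<delta>]\<close>, which is stable under division
  by \<open>q\<close>. That the ballot values determine a kernel vector is proved by splitting off
  one tensor factor at a time, with the injectivity of powers of the raising operator in negative
  weights as the auxiliary statement. The components of \<open>1\<close> and \<open>q\<close> can be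
  separated because exchanging \<open>q\<close> and \<open>1/q\<close> fixes
  \<open>\<delta>\<close>. The product of all binomial coefficients serves as common denominator,
  since each factor becomes a unit in \<open>R\<close>.\<close>

definition closed_in :: "'a set set \<Rightarrow> 'a set \<Rightarrow> bool" where
  "closed_in G C \<longleftrightarrow> (\<forall>e\<in>G. e \<inter> C \<noteq> {} \<longrightarrow> e \<subseteq> C)"

text \<open>Components as the atoms of the Boolean algebra of closed sets. This replaces paths in
  the glued graph: when the graph is changed, closed sets are compared instead.\<close>

definition comps :: "'a set set \<Rightarrow> 'a set set" where
  "comps G = {C. C \<noteq> {} \<and> C \<subseteq> \<Union>G \<and> closed_in G C \<and>
     (\<forall>C'. C' \<noteq> {} \<longrightarrow> C' \<subseteq> C \<longrightarrow> closed_in G C' \<longrightarrow> C' = C)}"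

lemma closed_inD: "closed_in G C \<Longrightarrow> e \<in> G \<Longrightarrow> a \<in> e \<Longrightarrow> a \<in> C \<Longrightarrow> b \<in> e \<Longrightarrow> b \<in> C"
  unfolding closed_in_def by blast

text \<open>The class of \<open>x\<close> is the least closed set containing \<open>x\<close>, and
  by symmetry \<open>x\<close> is reached again from every point of a smaller nonempty closed set.
  The transitive closure is already reflexive on the vertices, since \<open>e \<times> e\<close>
  contains the diagonal.\<close>

lemma quotient_trancl_eq_comps: "\<Union>G // (\<Union>e\<in>G. e \<times> e)\<^sup>+ = comps G"
proof -
  let ?r = "(\<Union>e\<in>G. e \<times> e)"
  have sym: "sym (?r\<^sup>+)" by (rule sym_trancl) (auto simp: sym_def)
  have refl: "(x, x) \<in> ?r\<^sup>+" if "x \<in> \<Union>G" for x using that by blast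
  have cl: "closed_in G (?r\<^sup>+ `` {x})" if x: "x \<in> \<Union>G" for x
    unfolding closed_in_def
  proof (intro ballI impI subsetI)
    fix e z assume e: "e \<in> G" "e \<inter> ?r\<^sup>+ `` {x} \<noteq> {}" "z \<in> e"
    then obtain y where y: "y \<in> e" "(x, y) \<in> ?r\<^sup>+" by blast
    have "(y, z) \<in> ?r" using e y by blast
    with y(2) show "z \<in> ?r\<^sup>+ `` {x}" by (auto intro: trancl_into_trancl)
  qed
  have least: "?r\<^sup>+ `` {x} \<subseteq> C" if "x \<in> C" "closed_in G C" for x C
  proof
    fix y assume "y \<in> ?r\<^sup>+ `` {x}"
    then have "(x, y) \<in> ?r\<^sup>+" by simp
    then show "y \<in> C"
      by (induction rule: trancl_induct) (use that in \<open>auto simp: closed_in_def\<close>)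
  qed
  have sub: "?r\<^sup>+ `` {x} \<subseteq> \<Union>G" for x
  proof
    fix y assume "y \<in> ?r\<^sup>+ `` {x}"
    then have "(x, y) \<in> ?r\<^sup>+" by simp
    then show "y \<in> \<Union>G" by (induction rule: trancl_induct) auto
  qed
  show ?thesis
  proof
    show "\<Union>G // ?r\<^sup>+ \<subseteq> comps G"
    proof
      fix C assume "C \<in> \<Union>G // ?r\<^sup>+"
      then obtain x where x: "x \<in> \<Union>G" and C: "C = ?r\<^sup>+ `` {x}" by (auto simp: quotient_def)
      have "C' = C" if C': "C' \<noteq> {}" "C' \<subseteq> C" "closed_in G C'" for C'
      proof -
        obtain y where y: "y \<in> C'" using C' by blast
        then have "(x, y) \<in> ?r\<^sup>+" using C' C by blast
        then have "(y, x) \<in> ?r\<^sup>+" using sym by (auto simp: sym_def)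
        then have "x \<in> C'" using least[OF y C'(3)] by blast
        then show ?thesis using least C'(2,3) C by blast
      qed
      moreover have "x \<in> C" using C refl[OF x] by simp
      ultimately show "C \<in> comps G"
        unfolding comps_def using cl[OF x] sub[of x] C by auto
    qed
    show "comps G \<subseteq> \<Union>G // ?r\<^sup>+"
    proof
      fix C assume C: "C \<in> comps G"
      then obtain x where x: "x \<in> C" by (auto simp: comps_def)
      then have xG: "x \<in> \<Union>G" using C by (auto simp: comps_def)
      have "?r\<^sup>+ `` {x} \<subseteq> C" using least x C by (auto simp: comps_def)
      moreover have "?r\<^sup>+ `` {x} \<noteq> {}" using refl[OF xG] by blast
      ultimately have "?r\<^sup>+ `` {x} = C" using C cl[OF xG] by (simp add: comps_def)
      then show "C \<in> \<Union>G // ?r\<^sup>+" using xG by (auto simp: quotient_def)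
    qed
  qed
qed

lemma components_eq_comps: "components D E = comps (glued_edges D E)"
  by (simp add: components_def quotient_trancl_eq_comps)

lemma closed_in_Int: "closed_in G A \<Longrightarrow> closed_in G B \<Longrightarrow> closed_in G (A \<inter> B)"
  unfolding closed_in_def by blast

lemma comps_disjoint: "C \<in> comps G \<Longrightarrow> C' \<in> comps G \<Longrightarrow> C \<inter> C' \<noteq> {} \<Longrightarrow> C = C'"
  using closed_in_Int[of G C C'] unfolding comps_def
  by (smt (verit) inf_le1 inf_le2 mem_Collect_eq)

lemma Union_comps: "\<Union>(comps G) = \<Union>G"
proof -
  have "\<Union>(\<Union>G // (\<Union>e\<in>G. e \<times> e)\<^sup>+) = \<Union>G"
  proof (rule Union_quotient)
    show "equiv (\<Union>G) ((\<Union>e\<in>G. e \<times> e)\<^sup>+)"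
    proof (rule equivI)
      show "sym ((\<Union>e\<in>G. e \<times> e)\<^sup>+)" by (rule sym_trancl) (auto simp: sym_def)
      show "(\<Union>e\<in>G. e \<times> e)\<^sup>+ \<subseteq> \<Union>G \<times> \<Union>G" by (rule trancl_subset_Sigma) blast
    qed (auto simp: refl_on_def)
  qed
  then show ?thesis by (simp add: quotient_trancl_eq_comps)
qed

text \<open>Components are pairwise disjoint, so a family of components that covers all vertices
  leaves no room for another one.\<close>

lemma comps_eqI:
  assumes "\<And>C. C \<in> P \<Longrightarrow> C \<in> comps G" and "\<Union>G \<subseteq> \<Union>P"
  shows "comps G = P"
proof
  show "comps G \<subseteq> P"
  proof
    fix C assume C: "C \<in> comps G"
    then have "C \<noteq> {}" "C \<subseteq> \<Union>G" by (auto simp: comps_def)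
    then obtain x where x: "x \<in> C" "x \<in> \<Union>G" by blast
    then obtain C' where C': "C' \<in> P" "x \<in> C'" using assms(2) by blast
    then show "C \<in> P" using comps_disjoint[OF C assms(1)[OF C'(1)]] x by auto
  qed
qed (use assms in blast)

lemma isolated_edge_in_comps:
  assumes "e \<in> G" "e \<noteq> {}" "\<And>f. f \<in> G \<Longrightarrow> f \<inter> e \<noteq> {} \<Longrightarrow> f = e"
  shows "e \<in> comps G"
  unfolding comps_def closed_in_def using assms by fastforce

lemma comps_insert_isolated:
  assumes "e \<noteq> {}" "e \<inter> \<Union>G = {}"
  shows "comps (insert e G) = insert e (comps G)"
proof (rule comps_eqI)
  fix C assume C: "C \<in> insert e (comps G)"
  show "C \<in> comps (insert e G)"
  proof (cases "C = e")
    case True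
    then show ?thesis using assms by (intro isolated_edge_in_comps) auto
  next
    case False
    then have C: "C \<in> comps G" using C by simp
    then have "C \<subseteq> \<Union>G" by (auto simp: comps_def)
    then have "e \<inter> X = {}" if "X \<subseteq> C" for X using that assms by blast
    then show ?thesis using C by (auto simp: comps_def closed_in_def)
  qed
next
  show "\<Union>(insert e G) \<subseteq> \<Union>(insert e (comps G))" using Union_comps[of G] by auto
qed

text \<open>Passing to \<open>C - {x, y}\<close> is an isomorphism between the Boolean algebras of closed sets.\<close>

lemma comps_contract:
  fixes H :: "'a set set" and x y u w :: 'a
  defines "G \<equiv> H \<union> {{x, y}, {x, u}, {y, w}}" and "G' \<equiv> insert {u, w} H"
  assumes ne: "u \<noteq> x" "u \<noteq> y" "w \<noteq> x" "w \<noteq> y"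
    and H: "x \<notin> \<Union>H" "y \<notin> \<Union>H"
  shows "comps G' = (\<lambda>C. C - {x, y}) ` comps G" and "inj_on (\<lambda>C. C - {x, y}) (comps G)"
proof -
  \<comment> \<open>The inverse of deleting \<open>x\<close> and \<open>y\<close>. Closed sets of
    \<open>G'\<close> contain \<open>u\<close> and \<open>w\<close> together, so testing
    \<open>u\<close> alone decides whether the deleted vertices belong to the set.\<close>
  define up where "up C = C \<union> (if u \<in> C then {x, y} else {})" for C
  have down: "closed_in G' (C - {x, y})" if "closed_in G C" for C
    using that ne H unfolding closed_in_def G_def G'_def by fastforce
  have upc: "closed_in G (up C)" if "closed_in G' C" "x \<notin> C" "y \<notin> C" for C
    using that ne H unfolding closed_in_def G_def G'_def up_def by (auto split: if_splits)
  have up_down: "up (C - {x, y}) = C" if "closed_in G C" for C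
  proof -
    have "x \<in> C \<longleftrightarrow> u \<in> C" "x \<in> C \<longleftrightarrow> y \<in> C"
    proof -
      have "{x, y} \<in> G" "{x, u} \<in> G" by (simp_all add: G_def)
      then show "x \<in> C \<longleftrightarrow> u \<in> C" "x \<in> C \<longleftrightarrow> y \<in> C"
        using closed_inD[OF that, of "{x, y}"] closed_inD[OF that, of "{x, u}"] by auto
    qed
    then show ?thesis using ne unfolding up_def by (auto split: if_splits)
  qed
  have down_up: "up C - {x, y} = C" if "x \<notin> C" "y \<notin> C" for C
    using that by (auto simp: up_def)
  have mono: "up C \<subseteq> up C'" if "C \<subseteq> C'" for C C' using that by (auto simp: up_def)
  have xG': "x \<notin> \<Union>G'" "y \<notin> \<Union>G'" using ne H by (auto simp: G'_def)
  show "inj_on (\<lambda>C. C - {x, y}) (comps G)"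
    by (rule inj_on_inverseI[where g = up]) (simp add: up_down comps_def)
  show "comps G' = (\<lambda>C. C - {x, y}) ` comps G"
  proof (rule comps_eqI)
    fix C' assume "C' \<in> (\<lambda>C. C - {x, y}) ` comps G"
    then obtain C where C: "C \<in> comps G" "C' = C - {x, y}" by blast
    then have cl: "closed_in G C" "C \<noteq> {}" "C \<subseteq> \<Union>G" by (auto simp: comps_def)
    show "C' \<in> comps G'" unfolding comps_def
    proof (intro CollectI conjI allI impI)
      show "closed_in G' C'" using down cl C by simp
      show "C' \<noteq> {}"
      proof
        assume "C' = {}"
        then have "up C' = {}" by (simp add: up_def)
        then show False using up_down[OF cl(1)] cl C by simp
      qed
      show "C' \<subseteq> \<Union>G'" using cl C by (auto simp: G_def G'_def)
      fix X assume X: "X \<noteq> {}" "X \<subseteq> C'" "closed_in G' X"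
      then have n: "x \<notin> X" "y \<notin> X" using C by auto
      have "up X \<subseteq> C" using mono[OF X(2)] up_down[OF cl(1)] C by simp
      moreover have "up X \<noteq> {}" using X by (auto simp: up_def)
      ultimately have "up X = C" using C(1) upc[OF X(3) n] unfolding comps_def by blast
      then show "X = C'" using down_up[OF n] C by auto
    qed
  next
    have "\<Union>G' \<subseteq> \<Union>G - {x, y}" using xG' by (auto simp: G_def G'_def)
    also have "\<dots> = (\<Union>C\<in>comps G. C - {x, y})" using Union_comps[of G] by auto
    finally show "\<Union>G' \<subseteq> \<Union>((\<lambda>C. C - {x, y}) ` comps G)" .
  qed
qed

lemma comps_image:
  assumes "inj f" shows "comps ((`) f ` G) = (`) f ` comps G"
proof (rule comps_eqI)
  have cl: "closed_in ((`) f ` G) (f ` C) \<longleftrightarrow> closed_in G C" for C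
    using assms unfolding closed_in_def
    by (simp add: image_Int[symmetric] inj_image_subset_iff)
  fix C' assume "C' \<in> (`) f ` comps G"
  then obtain C where C: "C \<in> comps G" "C' = f ` C" by blast
  show "C' \<in> comps ((`) f ` G)" unfolding comps_def
  proof (intro CollectI conjI allI impI)
    show "C' \<noteq> {}" "C' \<subseteq> \<Union>((`) f ` G)" using C by (auto simp: comps_def)
    show "closed_in ((`) f ` G) C'" using C cl by (auto simp: comps_def)
    fix X assume X: "X \<noteq> {}" "X \<subseteq> C'" "closed_in ((`) f ` G) X"
    then obtain Y where Y: "X = f ` Y" "Y \<subseteq> C" using C by (metis subset_imageE)
    then show "X = C'" using X C cl[of Y] unfolding comps_def by blast
  qed
next
  show "\<Union>((`) f ` G) \<subseteq> \<Union>((`) f ` comps G)" using Union_comps[of G] by auto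
qed

section \<open>Reflection of the strip\<close>

primrec flip :: "point \<Rightarrow> point" where
  "flip (Bot i) = Top i"
| "flip (Top i) = Bot i"

abbreviation flips :: "point set set \<Rightarrow> point set set" where
  "flips D \<equiv> (`) flip ` D"

primrec gflip :: "glued_point \<Rightarrow> glued_point" where
  "gflip (Low i) = Up i"
| "gflip (Mid i) = Mid i"
| "gflip (Up i) = Low i"

lemma flip_flip [simp]: "flip (flip p) = p" by (cases p) auto
lemma gflip_gflip [simp]: "gflip (gflip p) = p" by (cases p) auto
lemma inj_flip: "inj flip" by (metis flip_flip injI)
lemma inj_gflip: "inj gflip" by (metis gflip_gflip injI)

lemma image_flip_flip [simp]: "flip ` flip ` e = e" by (force simp: image_image)
lemma flips_flips [simp]: "flips (flips D) = D" by (force simp: image_image)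

lemma glued_edges_flips: "glued_edges (flips E) (flips D) = (`) gflip ` glued_edges D E"
proof -
  have "from_lower (flip p) = gflip (from_upper p)" "from_upper (flip p) = gflip (from_lower p)" for p
    by (cases p; simp)+
  then show ?thesis by (auto simp: glued_edges_def image_Un image_image)
qed

lemma components_flips: "components (flips E) (flips D) = (`) gflip ` components D E"
  by (simp add: components_eq_comps glued_edges_flips comps_image inj_gflip)

lemma outer_vimage_gflip: "outer -` gflip ` C = flip ` (outer -` C)"
proof -
  have o: "outer (flip p) = gflip (outer p)" for p by (cases p) auto
  show ?thesis
  proof
    show "outer -` gflip ` C \<subseteq> flip ` (outer -` C)"
    proof
      fix p assume "p \<in> outer -` gflip ` C"
      then have "outer (flip p) \<in> C" by (auto simp: o)
      then show "p \<in> flip ` (outer -` C)" by (metis flip_flip imageI vimageI)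
    qed
    show "flip ` (outer -` C) \<subseteq> outer -` gflip ` C" by (auto simp: o)
  qed
qed

lemma stack_eq: "stack D E = (\<lambda>C. outer -` C) ` components D E - {{}}"
  by (auto simp: stack_def)

text \<open>Reflection reverses the order of stacking. Together with \<open>loops_flips\<close> it
  turns statements about bottom points into statements about top points.\<close>

lemma stack_flips: "stack (flips E) (flips D) = flips (stack D E)"
proof -
  have *: "flips (A - {{}}) = flips A - {{}}" for A by auto
  then show ?thesis
    by (simp add: stack_eq components_flips image_image outer_vimage_gflip *)
qed

lemma image_filter_empty:
  assumes "\<And>C. outer -` f C = {} \<longleftrightarrow> outer -` C = {}"
  shows "{C \<in> f ` A. outer -` C = {}} = f ` {C \<in> A. outer -` C = {}}"
  using assms by auto

lemma loops_flips: "loops (flips E) (flips D) = loops D E"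
proof -
  have empty: "outer -` gflip ` C = {} \<longleftrightarrow> outer -` C = {}" for C
    by (simp only: outer_vimage_gflip image_is_empty)
  have "{C \<in> components (flips E) (flips D). outer -` C = {}}
      = (`) gflip ` {C \<in> components D E. outer -` C = {}}"
    unfolding components_flips by (rule image_filter_empty) (rule empty)
  moreover have "inj_on ((`) gflip) X" for X
    using inj_gflip by (simp add: inj_on_def inj_image_eq_iff)
  ultimately show ?thesis by (simp add: loops_def card_image)
qed

section \<open>Joining two points of a matching by an arc\<close>

text \<open>The arcs ending at \<open>x\<close> and \<open>y\<close> are fused into one; an arc
  \<open>{x, y}\<close> closes up to a loop and disappears, its factor being accounted for
  separately. The type is arbitrary because both points of the strip and their positions are
  joined.\<close>

definition merge :: "'p \<Rightarrow> 'p \<Rightarrow> 'p set set \<Rightarrow> 'p set set" where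
  "merge x y D = (if {x, y} \<in> D then D - {{x, y}}
     else insert (\<Union>{e \<in> D. x \<in> e \<or> y \<in> e} - {x, y}) {e \<in> D. x \<notin> e \<and> y \<notin> e})"

lemma merge_arcs:
  assumes D: "disjoint D" "{x, a} \<in> D" "{y, b} \<in> D" and ne: "a \<noteq> y" "x \<noteq> y" "a \<noteq> x" "b \<noteq> y" "b \<noteq> x"
  shows "merge x y D = insert {a, b} (D - {{x, a}, {y, b}})" "{x, y} \<notin> D" "a \<noteq> b"
proof -
  have u: "e = f" if "e \<in> D" "f \<in> D" "p \<in> e" "p \<in> f" for e f p
    using D(1) that by (auto simp: disjoint_def)
  show xy: "{x, y} \<notin> D" using u[of "{x,y}" "{x,a}" x] D ne by (auto simp: doubleton_eq_iff)
  show "a \<noteq> b" using u[of "{x,a}" "{y,b}" a] D ne by (auto simp: doubleton_eq_iff)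
  have 1: "{e \<in> D. x \<in> e \<or> y \<in> e} = {{x, a}, {y, b}}"
  proof (intro equalityI subsetI)
    fix e assume e: "e \<in> {e \<in> D. x \<in> e \<or> y \<in> e}"
    then have "x \<in> e \<Longrightarrow> e = {x, a}" "y \<in> e \<Longrightarrow> e = {y, b}"
      using u[of e "{x,a}" x] u[of e "{y,b}" y] D by auto
    then show "e \<in> {{x, a}, {y, b}}" using e by blast
  qed (use D in auto)
  have "{e \<in> D. x \<notin> e \<and> y \<notin> e} = D - {e \<in> D. x \<in> e \<or> y \<in> e}" by auto
  then show "merge x y D = insert {a, b} (D - {{x, a}, {y, b}})"
    using xy 1 ne by (auto simp: merge_def)
qed

lemma card2_arc:
  assumes "card e = 2" "x \<in> e" obtains a where "e = {x, a}" "a \<noteq> x"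
  using assms by (auto simp: card_2_iff)

lemma inj_from_upper: "inj from_upper"
proof (rule injI)
  fix x y assume "from_upper x = from_upper y"
  then show "x = y" by (cases x; cases y) auto
qed

lemma inj_from_lower: "inj from_lower"
proof (rule injI)
  fix x y assume "from_lower x = from_lower y"
  then show "x = y" by (cases x; cases y) auto
qed

lemma finite_components: "finite D \<Longrightarrow> finite E \<Longrightarrow> finite (components D E)"
proof -
  assume "finite D" "finite E"
  have "components D E \<subseteq> (\<lambda>X. \<Union>X) ` Pow (glued_edges D E)"
  proof
    fix C assume "C \<in> components D E"
    then have C: "closed_in (glued_edges D E) C" "C \<subseteq> \<Union>(glued_edges D E)"
      by (auto simp: components_eq_comps comps_def)
    then have "C = \<Union>{e \<in> glued_edges D E. e \<inter> C \<noteq> {}}"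
      unfolding closed_in_def by blast
    then show "C \<in> (\<lambda>X. \<Union>X) ` Pow (glued_edges D E)" by blast
  qed
  moreover have "finite (glued_edges D E)" using \<open>finite D\<close> \<open>finite E\<close> by (simp add: glued_edges_def)
  ultimately show ?thesis using finite_subset by blast
qed

text \<open>In the glued graph the arc of \<open>F\<close> joins two middle points. Either they form
  a closed loop by themselves, or they lie on a path of three edges that can be shortened to one.
  The families need not be matchings of a full boundary, because the labels \<open>i\<close> and
  \<open>j\<close> are missing after the contraction.\<close>

lemma stack_contract:
  assumes F: "disjoint F" "{Top i, Top j} \<in> F" and ij: "i \<noteq> j"
    and D: "disjoint D" "\<And>e. e \<in> D \<Longrightarrow> card e = 2" "Bot i \<in> \<Union>D" "Bot j \<in> \<Union>D" 
    and fin: "finite D" "finite F"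
  shows "stack F D = stack (F - {{Top i, Top j}}) (merge (Bot i) (Bot j) D)" (is ?A)
    and "loops F D = loops (F - {{Top i, Top j}}) (merge (Bot i) (Bot j) D)
           + (if {Bot i, Bot j} \<in> D then 1 else 0)" (is ?B)
proof -
  define F' where "F' = F - {{Top i, Top j}}"
  let ?x = "Mid i" and ?y = "Mid j"
  have uF: "Top i \<notin> \<Union>F'" "Top j \<notin> \<Union>F'"
    using disjointD[OF F] unfolding F'_def by fastforce+
  have Feq: "F = insert {Top i, Top j} F'" using F by (auto simp: F'_def)
  have memU: "from_upper p = Mid k \<longleftrightarrow> p = Bot k" for p k by (cases p) auto
  have memL: "from_lower p = Mid k \<longleftrightarrow> p = Top k" for p k by (cases p) auto
  have xyF: "?x \<notin> \<Union>((`) from_lower ` F')" "?y \<notin> \<Union>((`) from_lower ` F')"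
    using uF memL by (auto simp: image_iff) metis+
  have "?A \<and> ?B"
  proof (cases "{Bot i, Bot j} \<in> D")
    case True
    define D' where "D' = D - {{Bot i, Bot j}}"
    have m: "merge (Bot i) (Bot j) D = D'" using True by (simp add: merge_def D'_def)
    have Deq: "D = insert {Bot i, Bot j} D'" using True by (auto simp: D'_def)
    have uD: "Bot i \<notin> \<Union>D'" "Bot j \<notin> \<Union>D'"
      using disjointD[OF D(1) True] unfolding D'_def by fastforce+
    have xyD: "?x \<notin> \<Union>((`) from_upper ` D')" "?y \<notin> \<Union>((`) from_upper ` D')"
      using uD memU by (auto simp: image_iff) metis+
    have G: "glued_edges F D = insert {?x, ?y} (glued_edges F' D')"
      by (auto simp: glued_edges_def Feq Deq)
    have iso: "{?x, ?y} \<inter> \<Union>(glued_edges F' D') = {}"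
      using xyF xyD by (auto simp: glued_edges_def)
    have C: "components F D = insert {?x, ?y} (components F' D')"
      unfolding components_eq_comps G by (rule comps_insert_isolated) (use iso in simp_all)
    have new: "{?x, ?y} \<notin> components F' D'"
      using iso unfolding components_eq_comps comps_def by blast
    have o: "outer -` {?x, ?y} = {}"
    proof -
      have "outer p \<noteq> Mid k" for p k by (cases p) auto
      then show ?thesis by auto
    qed
    have "{C \<in> components F D. outer -` C = {}} = insert {?x,?y} {C \<in> components F' D'. outer -` C = {}}"
      using C o by auto
    moreover have "finite {C \<in> components F' D'. outer -` C = {}}"
      using finite_components fin by (simp add: F'_def D'_def)
    ultimately have "loops F D = Suc (loops F' D')" using new by (simp add: loops_def)
    moreover have "stack F D = stack F' D'" unfolding stack_eq C by (simp add: o)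
    ultimately show ?thesis using True m by (simp add: F'_def)
  next
    case False
    obtain e f where e: "e \<in> D" "Bot i \<in> e" "f \<in> D" "Bot j \<in> f" using D by blast
    obtain a where a: "e = {Bot i, a}" "a \<noteq> Bot i" using card2_arc[OF D(2)[OF e(1)] e(2)] by blast
    obtain b where b: "f = {Bot j, b}" "b \<noteq> Bot j" using card2_arc[OF D(2)[OF e(3)] e(4)] by blast
    have aj: "a \<noteq> Bot j" "b \<noteq> Bot i" using False a b e by (auto simp: insert_commute)
    define D' where "D' = D - {{Bot i, a}, {Bot j, b}}"
    have m: "merge (Bot i) (Bot j) D = insert {a, b} D'"
      unfolding D'_def by (rule merge_arcs) (use D e a b aj ij in auto)
    have Deq: "D = D' \<union> {{Bot i, a}, {Bot j, b}}" using a b e by (auto simp: D'_def)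
    have uD: "Bot i \<notin> \<Union>D'" "Bot j \<notin> \<Union>D'"
      using disjointD[OF D(1) e(1)] disjointD[OF D(1) e(3)] a b unfolding D'_def by fastforce+
    have xyD: "?x \<notin> \<Union>((`) from_upper ` D')" "?y \<notin> \<Union>((`) from_upper ` D')"
      using uD memU by (auto simp: image_iff) metis+
    let ?H = "(`) from_lower ` F' \<union> (`) from_upper ` D'"
    let ?f = "\<lambda>C. C - {?x, ?y}"
    \<comment> \<open>The path from \<open>a\<close> through \<open>Mid i\<close> and
      \<open>Mid j\<close> to \<open>b\<close>, which \<open>comps_contract\<close> shortens to the
      edge of the merged diagram.\<close>
    have G: "glued_edges F D = ?H \<union> {{?x, ?y}, {?x, from_upper a}, {?y, from_upper b}}"
      by (auto simp: glued_edges_def Feq Deq)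
    have G': "glued_edges F' (insert {a, b} D') = insert {from_upper a, from_upper b} ?H"
      by (auto simp: glued_edges_def)
    have c: "components F' (insert {a, b} D') = ?f ` components F D" "inj_on ?f (components F D)"
      unfolding components_eq_comps G G'
      by (rule comps_contract; use memU a b aj xyF xyD in auto)+
    have o: "outer -` (C - {?x, ?y}) = outer -` C" for C
    proof -
      have "outer p \<noteq> Mid k" for p k by (cases p) auto
      then show ?thesis by auto
    qed
    have "stack F D = stack F' (insert {a, b} D')"
      unfolding stack_eq c image_image o ..
    moreover have "{C \<in> components F' (insert {a, b} D'). outer -` C = {}}
        = ?f ` {C \<in> components F D. outer -` C = {}}"
      unfolding c by (rule image_filter_empty) (simp only: o)
    then have "loops F D = loops F' (insert {a, b} D')"
      unfolding loops_def by (simp add: card_image inj_on_subset[OF c(2)])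
    ultimately show ?thesis using False m by (simp add: F'_def)
  qed
  then show ?A ?B by auto
qed

section \<open>Noncrossing matchings of natural numbers\<close>

text \<open>For \<open>p\<close> different from \<open>a\<close> and \<open>b\<close>:
  \<open>p\<close> lies strictly between them. The form is symmetric in \<open>a\<close> and
  \<open>b\<close>, so arcs need no orientation.\<close>

definition separates :: "nat \<Rightarrow> nat \<Rightarrow> nat \<Rightarrow> bool" where
  "separates a b p \<longleftrightarrow> (a < p) \<noteq> (b < p)"

definition noncross :: "nat set set \<Rightarrow> bool" where
  "noncross D \<longleftrightarrow> (\<forall>e\<in>D. \<forall>f\<in>D. e \<noteq> f \<longrightarrow>
     (\<forall>a\<in>e. \<forall>b\<in>e. \<forall>c\<in>f. \<forall>d\<in>f. separates a b c = separates a b d))"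

text \<open>The ground set is an arbitrary set of numbers, so that arcs can be removed without
  renumbering the remaining points.\<close>

definition NC :: "nat set \<Rightarrow> nat set set set" where
  "NC A = {D. partition_on A D \<and> (\<forall>e\<in>D. card e = 2) \<and> noncross D}"

text \<open>Crossing is a symmetric relation between arcs without common ends; hence only one
  direction has to be checked when an arc is added.\<close>

lemma separates_sym:
  assumes "a \<noteq> c" "a \<noteq> d" "b \<noteq> c" "b \<noteq> d"
  shows "(separates a b c = separates a b d) \<longleftrightarrow> (separates c d a = separates c d b)"
proof -
  have "c < a \<longleftrightarrow> \<not> a < c" "d < a \<longleftrightarrow> \<not> a < d" "c < b \<longleftrightarrow> \<not> b < c" "d < b \<longleftrightarrow> \<not> b < d"
    using assms by auto
  then show ?thesis unfolding separates_def
    by (cases "a < c"; cases "a < d"; cases "b < c"; cases "b < d") simp_all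
qed

lemma noncross_separates:
  assumes "noncross D" "e \<in> D" "f \<in> D" "e \<noteq> f" "a \<in> e" "b \<in> e" "c \<in> f" "d \<in> f"
  shows "separates a b c = separates a b d"
  by (rule assms(1)[unfolded noncross_def, rule_format, OF assms(2-8)])

lemma noncrossD:
  "noncross D \<Longrightarrow> {a, b} \<in> D \<Longrightarrow> {c, d} \<in> D \<Longrightarrow> {a, b} \<noteq> {c, d} \<Longrightarrow> separates a b c = separates a b d"
  by (rule noncross_separates[of D "{a, b}" "{c, d}"]) (assumption | simp)+

lemma noncross_subset:
  assumes "noncross D" "D' \<subseteq> D" shows "noncross D'"
  unfolding noncross_def
proof (intro ballI impI)
  fix e f a b c d
  assume *: "e \<in> D'" "f \<in> D'" "e \<noteq> f" "a \<in> e" "b \<in> e" "c \<in> f" "d \<in> f"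
  show "separates a b c = separates a b d"
    by (rule noncross_separates[OF assms(1) subsetD[OF assms(2) *(1)] subsetD[OF assms(2) *(2)] *(3-7)])
qed

lemma noncross_insert:
  assumes "noncross D" "\<And>f. f \<in> D \<Longrightarrow> f \<inter> {a, b} = {}"
    and "\<And>c d. {c, d} \<in> D \<Longrightarrow> separates c d a = separates c d b"
    and D2: "\<And>f. f \<in> D \<Longrightarrow> card f = 2"
  shows "noncross (insert {a, b} D)"
proof -
  have inner: "separates c d a' = separates c d b'"
    if "f \<in> D" "c \<in> f" "d \<in> f" "a' \<in> {a, b}" "b' \<in> {a, b}" for f c d a' b'
  proof (cases "c = d")
    case False
    then have "f = {c, d}" using D2[OF that(1)] that by (auto simp: card_2_iff)
    then show ?thesis using assms(3)[of c d] that by auto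
  qed (simp add: separates_def)
  have outer: "separates a' b' c = separates a' b' d"
    if "f \<in> D" "c \<in> f" "d \<in> f" "a' \<in> {a, b}" "b' \<in> {a, b}" for f c d a' b'
  proof -
    have "a' \<noteq> c" "a' \<noteq> d" "b' \<noteq> c" "b' \<noteq> d" using assms(2)[OF that(1)] that by auto
    then show ?thesis using inner[OF that] separates_sym by blast
  qed
  show ?thesis unfolding noncross_def
  proof (intro ballI impI)
    fix e f p q r s
    assume *: "e \<in> insert {a, b} D" "f \<in> insert {a, b} D" "e \<noteq> f" "p \<in> e" "q \<in> e" "r \<in> f" "s \<in> f"
    show "separates p q r = separates p q s"
    proof (cases "e \<in> D \<and> f \<in> D")
      case True
      then show ?thesis by (intro noncross_separates[OF assms(1) _ _ *(3-7)]) simp_all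
    next
      case False
      then consider "e = {a, b}" "f \<in> D" | "f = {a, b}" "e \<in> D" using * by blast
      then show ?thesis
      proof cases
        case 1
        show ?thesis by (rule outer[OF 1(2)]) (use * 1(1) in simp_all)
      next
        case 2
        show ?thesis by (rule inner[OF 2(2)]) (use * 2(1) in simp_all)
      qed
    qed
  qed
qed

lemma NC_unique: "D \<in> NC A \<Longrightarrow> e \<in> D \<Longrightarrow> f \<in> D \<Longrightarrow> x \<in> e \<Longrightarrow> x \<in> f \<Longrightarrow> e = f"
  unfolding NC_def partition_on_def disjoint_def by blast

lemma NC_disjoint: "D \<in> NC A \<Longrightarrow> disjoint D"
  by (simp add: NC_def partition_on_def)

lemma NC_card2: "D \<in> NC A \<Longrightarrow> e \<in> D \<Longrightarrow> card e = 2"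
  by (simp add: NC_def)

lemma NC_Union: "D \<in> NC A \<Longrightarrow> \<Union>D = A"
  by (simp add: NC_def partition_on_def)

lemma NC_noncross: "D \<in> NC A \<Longrightarrow> noncross D"
  by (simp add: NC_def)

lemma NC_I:
  "disjoint D \<Longrightarrow> (\<And>e. e \<in> D \<Longrightarrow> card e = 2) \<Longrightarrow> \<Union>D = A \<Longrightarrow> noncross D \<Longrightarrow> D \<in> NC A"
  unfolding NC_def partition_on_def by force

lemma NC_subset: "D \<in> NC A \<Longrightarrow> e \<in> D \<Longrightarrow> e \<subseteq> A"
  using NC_Union by blast

lemma finite_NC: "finite A \<Longrightarrow> finite (NC A)"
  by (rule finite_subset[of _ "Pow (Pow A)"]) (use NC_subset in blast, simp)

lemma NC_finite: "finite A \<Longrightarrow> D \<in> NC A \<Longrightarrow> finite D"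
  by (metis NC_Union finite_UnionD)

lemma NC_partner:
  assumes "D \<in> NC A" "x \<in> A" obtains y where "{x, y} \<in> D" "y \<noteq> x" "y \<in> A"
proof -
  obtain e where e: "e \<in> D" "x \<in> e" using assms NC_Union by blast
  obtain y where "e = {x, y}" "y \<noteq> x" using card2_arc[OF NC_card2[OF assms(1) e(1)] e(2)] .
  then show ?thesis using that NC_subset[OF assms(1) e(1)] e by simp
qed

lemma NC_arc:
  assumes "D \<in> NC A" "e \<in> D" obtains x y where "e = {x, y}" "x < y"
proof -
  obtain a b where "e = {a, b}" "a \<noteq> b" using NC_card2[OF assms] by (auto simp: card_2_iff)
  then show ?thesis using that[of a b] that[of b a] by (auto simp: insert_commute neq_iff)
qed

lemma NC_remove:
  assumes "D \<in> NC A" "e \<in> D" shows "D - {e} \<in> NC (A - e)"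
proof (rule NC_I)
  show "disjoint (D - {e})" using NC_disjoint[OF assms(1)] by (auto simp: disjoint_def)
  show "noncross (D - {e})" by (rule noncross_subset[OF NC_noncross[OF assms(1)]]) blast
  show "\<Union>(D - {e}) = A - e" using NC_Union[OF assms(1)] NC_unique[OF assms(1) assms(2)] by blast
qed (use NC_card2[OF assms(1)] in blast)

lemma NC_insert_adjacent:
  assumes D: "D \<in> NC A" and xy: "x < y" "x \<notin> A" "y \<notin> A" and adj: "\<And>p. p \<in> A \<Longrightarrow> x < p \<Longrightarrow> y < p"
  shows "insert {x, y} D \<in> NC (insert x (insert y A))"
proof (rule NC_I)
  have i: "f \<inter> {x, y} = {}" if "f \<in> D" for f using NC_subset[OF D that] xy by blast
  show "disjoint (insert {x, y} D)"
    using NC_disjoint[OF D] i unfolding disjoint_def by blast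
  show "\<Union>(insert {x, y} D) = insert x (insert y A)" using NC_Union[OF D] by blast
  have s: "separates c d x = separates c d y" if "{c, d} \<in> D" for c d
  proof -
    have "c \<in> A" "d \<in> A" using NC_subset[OF D that] by auto
    moreover have "c \<noteq> x" "d \<noteq> x" "c \<noteq> y" "d \<noteq> y" using calculation xy by auto
    ultimately have "c < x \<longleftrightarrow> c < y" "d < x \<longleftrightarrow> d < y" using adj[of c] adj[of d] xy by linarith+
    then show ?thesis unfolding separates_def by simp
  qed
  show "noncross (insert {x, y} D)"
    by (rule noncross_insert) (use NC_noncross[OF D] i s NC_card2[OF D] in auto)
  show "card e = 2" if "e \<in> insert {x, y} D" for e
    using that NC_card2[OF D] xy by auto
qed

lemma merge_matching:
  assumes D: "disjoint D" "\<And>e. e \<in> D \<Longrightarrow> card e = 2" and xy: "x \<in> \<Union>D" "y \<in> \<Union>D" "x \<noteq> y"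
  shows "disjoint (merge x y D)" "\<And>e. e \<in> merge x y D \<Longrightarrow> card e = 2" "\<Union>(merge x y D) = \<Union>D - {x, y}"
proof -
  have "disjoint (merge x y D) \<and> (\<forall>e\<in>merge x y D. card e = 2) \<and> \<Union>(merge x y D) = \<Union>D - {x, y}"
  proof (cases "{x, y} \<in> D")
    case True
    have m: "merge x y D = D - {{x, y}}" using True by (simp add: merge_def)
    have "e \<inter> {x, y} = {}" if "e \<in> D - {{x, y}}" for e
      using disjointD[OF D(1) _ True] that by blast
    then have "\<Union>(D - {{x, y}}) = \<Union>D - {x, y}" by blast
    moreover have "disjoint (D - {{x, y}})" by (rule pairwise_subset[OF D(1)]) blast
    ultimately show ?thesis using D(2) unfolding m by simp
  next
    case False
    obtain e f where e: "e \<in> D" "x \<in> e" and f: "f \<in> D" "y \<in> f" using xy by blast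
    obtain a where a: "e = {x, a}" "a \<noteq> x" using card2_arc[OF D(2)[OF e(1)] e(2)] by blast
    obtain b where b: "f = {y, b}" "b \<noteq> y" using card2_arc[OF D(2)[OF f(1)] f(2)] by blast
    have n: "a \<noteq> y" "b \<noteq> x" using False a b e f by (auto simp: insert_commute)
    define D' where "D' = D - {{x, a}, {y, b}}"
    have m: "merge x y D = insert {a, b} D'" "a \<noteq> b"
      using merge_arcs[of D x a y b] D(1) e f a b n xy(3) by (auto simp: D'_def)
    have i: "g \<inter> {x, y, a, b} = {}" if "g \<in> D'" for g
    proof -
      have "g \<inter> {x, a} = {}" "g \<inter> {y, b} = {}"
        using disjointD[OF D(1), of g e] disjointD[OF D(1), of g f] that e f a b by (auto simp: D'_def)
      then show ?thesis by blast
    qed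
    have "disjoint D'" unfolding D'_def by (rule pairwise_subset[OF D(1)]) blast
    moreover have "g \<inter> {a, b} = {}" if "g \<in> D'" for g using i[OF that] by blast
    ultimately have "disjoint (insert {a, b} D')" unfolding disjoint_def by blast
    moreover have "\<forall>e\<in>insert {a, b} D'. card e = 2" using D(2) m(2) by (auto simp: D'_def)
    moreover have "\<Union>(insert {a, b} D') = \<Union>D - {x, y}"
    proof -
      have "\<Union>D = \<Union>D' \<union> {x, y, a, b}" using e f a b by (auto simp: D'_def)
      moreover have "\<Union>D' \<inter> {x, y, a, b} = {}" using i by blast
      ultimately show ?thesis using n a(2) b(2) by auto
    qed
    ultimately show ?thesis unfolding m(1) by blast
  qed
  then show "disjoint (merge x y D)" "\<And>e. e \<in> merge x y D \<Longrightarrow> card e = 2" "\<Union>(merge x y D) = \<Union>D - {x, y}"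
    by auto
qed

text \<open>An arc avoiding the neighbours \<open>x\<close> and \<open>y\<close> has both on the
  same side, and it does not separate either of them from its partner. So it does not separate the
  two partners, which become the ends of the new arc.\<close>

lemma NC_merge:
  assumes D: "D \<in> NC A" and xy: "x \<in> A" "y \<in> A" "x < y" and adj: "\<And>p. p \<in> A \<Longrightarrow> x < p \<Longrightarrow> y \<le> p"
  shows "merge x y D \<in> NC (A - {x, y})"
proof -
  have "x \<in> \<Union>D" "y \<in> \<Union>D" "x \<noteq> y" using xy NC_Union[OF D] by auto
  note m = merge_matching[OF NC_disjoint[OF D] NC_card2[OF D] this]
  have "noncross (merge x y D)"
  proof (cases "{x, y} \<in> D")
    case True
    have "merge x y D \<subseteq> D" using True by (auto simp: merge_def)
    then show ?thesis by (rule noncross_subset[OF NC_noncross[OF D]])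
  next
    case False
    obtain a where a: "{x, a} \<in> D" "a \<noteq> x" "a \<in> A" using NC_partner[OF D xy(1)] .
    obtain b where b: "{y, b} \<in> D" "b \<noteq> y" "b \<in> A" using NC_partner[OF D xy(2)] .
    have n: "a \<noteq> y" "b \<noteq> x" using False a b by (auto simp: insert_commute)
    define D' where "D' = D - {{x, a}, {y, b}}"
    have M: "merge x y D = insert {a, b} D'"
      unfolding D'_def by (rule merge_arcs(1)[OF NC_disjoint[OF D] a(1) b(1)]) (use n a b xy in auto)
    have i: "f \<inter> {x, a} = {}" "f \<inter> {y, b} = {}" if "f \<in> D'" for f
      using that disjointD[OF NC_disjoint[OF D] _ a(1)] disjointD[OF NC_disjoint[OF D] _ b(1)]
      unfolding D'_def by simp_all
    show ?thesis unfolding M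
    proof (rule noncross_insert)
      show "noncross D'" unfolding D'_def by (rule noncross_subset[OF NC_noncross[OF D]]) blast
      show "f \<inter> {a, b} = {}" if "f \<in> D'" for f using i[OF that] by blast
      show "card f = 2" if "f \<in> D'" for f using that NC_card2[OF D] by (simp add: D'_def)
      fix c d assume "{c, d} \<in> D'"
      then have cd: "{c, d} \<in> D" "{c, d} \<noteq> {x, a}" "{c, d} \<noteq> {y, b}" by (auto simp: D'_def)
      have "c \<in> A" "d \<in> A" "c \<noteq> x" "d \<noteq> x" "c \<noteq> y" "d \<noteq> y"
        using i[OF \<open>{c, d} \<in> D'\<close>] NC_subset[OF D cd(1)] by auto
      then have "c < x \<longleftrightarrow> c < y" "d < x \<longleftrightarrow> d < y" using adj[of c] adj[of d] xy by linarith+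
      then have "separates c d x = separates c d y" unfolding separates_def by simp
      moreover have "separates c d x = separates c d a" "separates c d y = separates c d b"
        using noncrossD[OF NC_noncross[OF D] cd(1)] a b cd by auto
      ultimately show "separates c d a = separates c d b" by simp
    qed
  qed
  then show ?thesis using m NC_Union[OF D] by (intro NC_I) simp_all
qed

text \<open>The arc at the point after \<open>x\<close> cannot leave the region under the given arc.
  It is shorter, so the induction ends at an arc between consecutive numbers.\<close>

lemma NC_adjacent_arc_between:
  assumes D: "D \<in> NC A"
  shows "{x, y} \<in> D \<Longrightarrow> x < y \<Longrightarrow> {x..y} \<subseteq> A \<Longrightarrow> \<exists>i. x \<le> i \<and> i < y \<and> {i, Suc i} \<in> D"
proof (induction "y - x" arbitrary: x y rule: less_induct)
  case less
  show ?case
  proof (cases "y = Suc x")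
    case True then show ?thesis using less by auto
  next
    case False
    then have x1: "Suc x < y" "Suc x \<in> A" using less by auto
    obtain z where z: "{Suc x, z} \<in> D" "z \<noteq> Suc x" using NC_partner[OF D x1(2)] by metis
    have ne: "{x, y} \<noteq> {Suc x, z}" using False by (auto simp: doubleton_eq_iff)
    have "separates x y (Suc x)" using x1 by (simp add: separates_def)
    then have "separates x y z" using noncrossD[OF NC_noncross[OF D] less(2) z(1) ne] by simp
    moreover have "z \<noteq> y" using NC_unique[OF D less(2) z(1), of y] ne by auto
    ultimately have "Suc x < z" "z < y" using z less(3) by (auto simp: separates_def)
    moreover have "{Suc x..z} \<subseteq> A" using \<open>z < y\<close> less(4) by (auto simp: subset_iff)
    moreover have "z - Suc x < y - x" using \<open>z < y\<close> \<open>Suc x < z\<close> by linarith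
    ultimately obtain i where "Suc x \<le> i" "i < z" "{i, Suc i} \<in> D" using less(1)[OF _ z(1)] by blast
    then show ?thesis using \<open>z < y\<close> by (intro exI[of _ i]) auto
  qed
qed

section \<open>Left ends of arcs and ballot sequences\<close>

abbreviation openers :: "nat set set \<Rightarrow> nat set" where
  "openers D \<equiv> Min ` D"

lemma Min_arc: "D \<in> NC A \<Longrightarrow> e \<in> D \<Longrightarrow> Min e \<in> e"
  using NC_arc by (metis Min_in finite.emptyI finite.insertI insert_not_empty)

lemma inj_on_Min: "D \<in> NC A \<Longrightarrow> inj_on Min D"
proof (rule inj_onI)
  fix e f assume D: "D \<in> NC A" and *: "e \<in> D" "f \<in> D" "Min e = Min f"
  then have "Min e \<in> e" "Min e \<in> f" using Min_arc[OF D] by metis+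
  then show "e = f" using NC_unique[OF D *(1,2)] by blast
qed

lemma openers_subset: "D \<in> NC A \<Longrightarrow> openers D \<subseteq> A"
  using Min_arc NC_subset by blast

text \<open>Everything strictly inside the arc of the last opener would have to be a closer.\<close>

lemma last_opener_arc:
  assumes D: "D \<in> NC A" "finite A" and ne: "D \<noteq> {}"
  shows "\<exists>y. {Max (openers D), y} \<in> D \<and> Max (openers D) < y \<and> (\<forall>z\<in>A. Max (openers D) < z \<longrightarrow> y \<le> z)"
proof -
  let ?x = "Max (openers D)"
  have fin: "finite (openers D)" using NC_finite D by blast
  have "?x \<in> openers D" using fin ne by simp
  then obtain e where e: "e \<in> D" "Min e = ?x" by auto
  obtain a y where ay: "e = {a, y}" "a < y" using NC_arc[OF D(1) e(1)] .
  have xy: "e = {?x, y}" "?x < y" using ay e by auto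
  have "y \<le> z" if z: "z \<in> A" "?x < z" for z
  proof (rule ccontr)
    assume "\<not> y \<le> z"
    then have zy: "z < y" by simp
    obtain w where w: "{z, w} \<in> D" "w \<noteq> z" using NC_partner[OF D(1) z(1)] by metis
    have ne: "{?x, y} \<noteq> {z, w}" using zy z by (auto simp: doubleton_eq_iff)
    have "separates ?x y z" using z zy by (simp add: separates_def)
    then have "separates ?x y w"
      using noncrossD[OF NC_noncross[OF D(1)] _ w(1) ne] e xy by simp
    then have "?x < w" using xy by (auto simp: separates_def)
    then have "?x < Min {z, w}" using z by simp
    moreover have "Min {z, w} \<le> ?x" using Max_ge[OF fin] w by blast
    ultimately show False by linarith
  qed
  then show ?thesis using xy e by metis
qed

lemma openers_remove:
  assumes "D \<in> NC A" "e \<in> D" shows "openers (D - {e}) = openers D - {Min e}"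
  using inj_on_image_set_diff[OF inj_on_Min[OF assms(1)], of D "{e}"] assms(2) by simp

text \<open>In both matchings the last opener is joined to the point of \<open>A\<close> following
  it. Removing this common arc reduces to a smaller ground set.\<close>

lemma openers_inject:
  assumes "finite A" "D \<in> NC A" "D' \<in> NC A" "openers D = openers D'"
  shows "D = D'"
  using assms
proof (induction "card A" arbitrary: A D D' rule: less_induct)
  case less
  show ?case
  proof (cases "D = {}")
    case True then show ?thesis using less by auto
  next
    case False
    then have F': "D' \<noteq> {}" using less by auto
    let ?x = "Max (openers D)"
    obtain y where y: "{?x, y} \<in> D" "?x < y" "\<forall>z\<in>A. ?x < z \<longrightarrow> y \<le> z"
      using last_opener_arc[OF less(3,2) False] by blast
    obtain y' where y': "{?x, y'} \<in> D'" "?x < y'" "\<forall>z\<in>A. ?x < z \<longrightarrow> y' \<le> z"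
      using last_opener_arc[OF less(4,2) F'] less(5) by auto
    have "y \<in> A" "y' \<in> A" using NC_subset y(1) y'(1) less(3,4) by blast+
    then have yy: "y' = y" using y y' by (meson le_antisym)
    let ?e = "{?x, y}"
    have e: "?e \<in> D" "?e \<in> D'" using y y' yy by auto
    have "?e \<subseteq> A" using NC_subset[OF less(3) e(1)] .
    then have "card (A - ?e) < card A" using less(2) by (intro psubset_card_mono) auto
    then have "D - {?e} = D' - {?e}"
      using less(1)[of "A - ?e" "D - {?e}" "D' - {?e}"] less(2) NC_remove[OF less(3) e(1)]
        NC_remove[OF less(4) e(2)] openers_remove[OF less(3) e(1)] openers_remove[OF less(4) e(2)] less(5)
      by simp
    then show ?thesis using e by blast
  qed
qed

text \<open>For \<open>s \<subseteq> A\<close>, read from the left, no initial segment contains more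
  closers (elements of \<open>A - s\<close>) than openers.\<close>

definition ballot :: "nat set \<Rightarrow> nat set \<Rightarrow> bool" where
  "ballot A s \<longleftrightarrow> (\<forall>l. card (A \<inter> {..<l}) \<le> 2 * card (s \<inter> {..<l}))"

text \<open>The recursion behind \<open>openers_inject\<close> run backwards: the last element of
  \<open>s\<close> is joined to its successor in \<open>A\<close>, and the rest still satisfies the
  ballot condition.\<close>

lemma openers_surj:
  assumes "finite A" "s \<subseteq> A" "card A = 2 * card s" "ballot A s"
  shows "\<exists>D\<in>NC A. openers D = s"
  using assms
proof (induction "card A" arbitrary: A s rule: less_induct)
  case less
  show ?case
  proof (cases "s = {}")
    case True
    then have "A = {}" using less by simp
    then have "{} \<in> NC A" by (intro NC_I) (auto simp: noncross_def disjoint_def)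
    then show ?thesis using True by auto
  next
    case False
    have fs: "finite s" using less finite_subset by blast
    define x where "x = Max s"
    have x: "x \<in> s" "\<And>z. z \<in> s \<Longrightarrow> z \<le> x" using fs False by (auto simp: x_def)
    have sx: "s \<inter> {..<x} = s - {x}" using x by fastforce
    \<comment> \<open>If the last opener were the last point of \<open>A\<close>, the ballot
      condition just before it would give \<open>card A - 1 \<le> 2 * (card s - 1)\<close>, against
      \<open>card A = 2 * card s\<close>.\<close>
    have "\<exists>z\<in>A. x < z"
    proof (rule ccontr)
      assume "\<not> (\<exists>z\<in>A. x < z)"
      then have "A - {x} \<subseteq> A \<inter> {..<x}" by fastforce
      then have "card (A - {x}) \<le> card (A \<inter> {..<x})" using less(2) by (intro card_mono) auto
      also have "\<dots> \<le> 2 * card (s - {x})" using less(5) sx unfolding ballot_def by metis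
      finally have "card A - 1 \<le> 2 * (card s - 1)" using x less(2,3) fs by (simp add: subset_iff)
      moreover have "card s > 0" using False fs by (simp add: card_gt_0_iff)
      ultimately show False using less(4) by linarith
    qed
    define y where "y = Min {z \<in> A. x < z}"
    have "y \<in> {z \<in> A. x < z}" unfolding y_def using \<open>\<exists>z\<in>A. x < z\<close> less(2) by (intro Min_in) auto
    then have y: "y \<in> A" "x < y" by auto
    have ymin: "y \<le> z" if "z \<in> A" "x < z" for z unfolding y_def using that less(2) by (intro Min_le) auto
    have ys: "y \<notin> s" using x y by fastforce
    let ?A = "A - {x, y}" and ?s = "s - {x}"
    have xA: "x \<in> A" using x less(3) by blast
    have cA: "Suc (Suc (card ?A)) = card A"
      using y xA less(2) by (metis Diff_insert2 card_Suc_Diff1 finite_Diff insert_Diff insert_iff nat_neq_iff)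
    have cs: "Suc (card ?s) = card s" using card.remove[OF fs x(1)] by simp
    have "ballot ?A ?s" unfolding ballot_def
    proof
      fix l
      have b: "card (A \<inter> {..<l}) \<le> 2 * card (s \<inter> {..<l})" for l using less(5) by (simp add: ballot_def)
      consider "l \<le> x" | "x < l" "l \<le> y" | "y < l" by linarith
      then show "card (?A \<inter> {..<l}) \<le> 2 * card (?s \<inter> {..<l})"
      proof cases
        case 1
        then have "?A \<inter> {..<l} = A \<inter> {..<l}" "?s \<inter> {..<l} = s \<inter> {..<l}" using y by auto
        then show ?thesis using b by simp
      next
        \<comment> \<open>Here the opener \<open>x\<close> is lost but its closer is not yet
          reached. No other point of \<open>A\<close> lies between them, so the ballot condition at
          \<open>x\<close> itself gives the bound.\<close>
        case 2
        have "?A \<inter> {..<l} \<subseteq> A \<inter> {..<x}" using ymin 2 by fastforce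
        then have "card (?A \<inter> {..<l}) \<le> card (A \<inter> {..<x})" using less(2) by (intro card_mono) auto
        also have "\<dots> \<le> 2 * card (s \<inter> {..<x})" by (rule b)
        also have "s \<inter> {..<x} = ?s \<inter> {..<l}"
        proof -
          have "z < l" if "z \<in> s" for z using x(2)[OF that] 2 by simp
          then show ?thesis unfolding sx by blast
        qed
        finally show ?thesis .
      next
        case 3
        have "A \<inter> {..<l} = insert x (insert y (?A \<inter> {..<l}))" using 3 y xA by auto
        then have "card (A \<inter> {..<l}) = Suc (Suc (card (?A \<inter> {..<l})))" using less(2) y by simp
        moreover have "s \<inter> {..<l} = insert x (?s \<inter> {..<l})" using 3 y x by auto
        then have "card (s \<inter> {..<l}) = Suc (card (?s \<inter> {..<l}))" using fs by simp
        ultimately show ?thesis using b[of l] by simp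
      qed
    qed
    moreover have "card ?A = 2 * card ?s" using cA cs less(4) by linarith
    moreover have "?s \<subseteq> ?A" using less(3) ys by auto
    ultimately obtain D where D: "D \<in> NC ?A" "openers D = ?s"
      using less(1)[of ?A ?s] cA less(2) by auto
    have "insert {x, y} D \<in> NC (insert x (insert y ?A))"
    proof (rule NC_insert_adjacent[OF D(1) y(2)])
      show "y < p" if "p \<in> ?A" "x < p" for p
        using ymin[of p] that by (simp add: le_neq_implies_less)
    qed simp_all
    moreover have "insert x (insert y ?A) = A" using xA y by blast
    moreover have "openers (insert {x, y} D) = s" using D y x by auto
    ultimately show ?thesis by metis
  qed
qed

text \<open>With \<open>s\<close> read as the set of points carrying the sign up, this says that the
  two ends of every arc carry opposite signs.\<close>

definition balanced :: "nat set \<Rightarrow> nat set set \<Rightarrow> bool" where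
  "balanced s D \<longleftrightarrow> (\<forall>e\<in>D. card (e \<inter> s) = 1)"

text \<open>\<open>openers D\<close> selects one end of every arc of \<open>D'\<close>, and a
  selected end is never smaller than the left end. Equality of the sums forces every selected end to
  be a left end. This is the triangularity of diagrams, ordered by the sum of their openers.\<close>

lemma openers_dominate:
  assumes D: "D \<in> NC A" and D': "D' \<in> NC A" and fin: "finite A" and b: "balanced (openers D) D'"
  shows "\<Sum>(openers D') \<le> \<Sum>(openers D)" and "\<Sum>(openers D') = \<Sum>(openers D) \<Longrightarrow> D' = D"
proof -
  let ?o = "openers D"
  have fD': "finite D'" using NC_finite fin D' by blast
  have fe: "finite e" if "e \<in> D'" for e using NC_card2[OF D' that] by (simp add: card_2_iff) (metis finite.emptyI finite.insertI)
  have "?o = (\<Union>e\<in>D'. e \<inter> ?o)" using openers_subset[OF D] NC_Union[OF D'] by blast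
  then have "\<Sum>?o = \<Sum>(\<Union>e\<in>D'. e \<inter> ?o)" by simp
  also have "\<dots> = (\<Sum>e\<in>D'. \<Sum>(e \<inter> ?o))"
  proof (rule sum.UNION_disjoint)
    show "\<forall>e\<in>D'. \<forall>f\<in>D'. e \<noteq> f \<longrightarrow> (e \<inter> ?o) \<inter> (f \<inter> ?o) = {}"
      using disjointD[OF NC_disjoint[OF D']] by blast
  qed (use fD' fe in auto)
  finally have so: "\<Sum>?o = (\<Sum>e\<in>D'. \<Sum>(e \<inter> ?o))" .
  have s': "\<Sum>(openers D') = (\<Sum>e\<in>D'. Min e)" by (simp add: sum.reindex inj_on_Min[OF D'])
  have one: "\<exists>p\<in>e. e \<inter> ?o = {p}" if "e \<in> D'" for e
    using b that unfolding balanced_def by (metis card_1_singletonE insertI1 Int_iff)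
  have le: "Min e \<le> \<Sum>(e \<inter> ?o)" if "e \<in> D'" for e using one[OF that] fe[OF that] by auto
  show "\<Sum>(openers D') \<le> \<Sum>?o" unfolding so s' by (rule sum_mono) (rule le)
  assume eq: "\<Sum>(openers D') = \<Sum>?o"
  have m: "Min e = \<Sum>(e \<inter> ?o)" if "e \<in> D'" for e
    by (rule sum_mono_inv[OF eq[unfolded so s']]) (use le that fD' in auto)
  have "e \<inter> ?o = {Min e}" if e: "e \<in> D'" for e
  proof -
    obtain p where p: "e \<inter> ?o = {p}" using one[OF e] by blast
    have "Min e = p" using m[OF e] unfolding p by simp
    then show ?thesis using p by simp
  qed
  then have "(\<Union>e\<in>D'. e \<inter> ?o) = (\<Union>e\<in>D'. {Min e})" by (intro SUP_cong) auto
  then have "?o = openers D'" using \<open>?o = (\<Union>e\<in>D'. e \<inter> ?o)\<close> by (metis UNION_singleton_eq_range)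
  then show "D' = D" using openers_inject[OF fin D D'] by simp
qed

section \<open>Matchings as vectors\<close>

text \<open>The exponent of \<open>-q\<close> in the weight of a diagram: a balanced arc contributes
  \<open>-q\<close> if its left end is up and \<open>1\<close> if its right end is up.\<close>

definition ups :: "nat set \<Rightarrow> nat set set \<Rightarrow> nat" where
  "ups s D = card {e \<in> D. Min e \<in> s}"

lemma card_pair_Int_eq_1: "a \<noteq> b \<Longrightarrow> card ({a, b} \<inter> s) = Suc 0 \<longleftrightarrow> (a \<in> s) \<noteq> (b \<in> s)"
  by (cases "a \<in> s"; cases "b \<in> s"; simp add: Int_insert_left)

lemma balanced_insert: "balanced s (insert e D) \<longleftrightarrow> card (e \<inter> s) = 1 \<and> balanced s D"
  by (auto simp: balanced_def)

lemma ups_insert: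
  assumes "finite D" "e \<notin> D"
  shows "ups s (insert e D) = (if Min e \<in> s then Suc (ups s D) else ups s D)"
proof -
  have "{f \<in> insert e D. Min f \<in> s} = (if Min e \<in> s then insert e {f \<in> D. Min f \<in> s} else {f \<in> D. Min f \<in> s})"
    by auto
  then show ?thesis using assms by (simp add: ups_def)
qed

lemma balanced_cong:
  assumes "D \<in> NC A" "s \<inter> A = s' \<inter> A" shows "balanced s D = balanced s' D"
proof -
  have "e \<inter> s = e \<inter> s'" if "e \<in> D" for e using NC_subset[OF assms(1) that] assms(2) by blast
  then show ?thesis by (simp add: balanced_def)
qed

lemma ups_cong:
  assumes "D \<in> NC A" "s \<inter> A = s' \<inter> A" shows "ups s D = ups s' D"
proof -
  have "Min e \<in> s \<longleftrightarrow> Min e \<in> s'" if "e \<in> D" for e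
    using NC_subset[OF assms(1) that] Min_arc[OF assms(1) that] assms(2) by blast
  then show ?thesis unfolding ups_def by (metis (mono_tags, lifting) Collect_cong)
qed

lemma balanced_card:
  assumes D: "D \<in> NC A" "finite A" and b: "balanced s D"
  shows "card A = 2 * card (A \<inter> s)"
proof -
  have fD: "finite D" using NC_finite D by blast
  have fe: "finite e" if "e \<in> D" for e using NC_card2[OF D(1) that] by (metis card.infinite zero_neq_numeral)
  have U: "A = \<Union>D" using NC_Union[OF D(1)] by simp
  have "card A = (\<Sum>e\<in>D. card e)" unfolding U
    by (rule card_Union_disjoint)
      (use fe disjointD[OF NC_disjoint[OF D(1)]] in \<open>auto simp: pairwise_def disjnt_def\<close>)
  also have "\<dots> = 2 * card D" using NC_card2[OF D(1)] by simp
  finally have 1: "card A = 2 * card D" .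
  have "A \<inter> s = (\<Union>e\<in>D. e \<inter> s)" using U by blast
  then have "card (A \<inter> s) = card (\<Union>e\<in>D. e \<inter> s)" by simp
  also have "\<dots> = (\<Sum>e\<in>D. card (e \<inter> s))"
  proof (rule card_UN_disjoint)
    show "\<forall>e\<in>D. \<forall>f\<in>D. e \<noteq> f \<longrightarrow> (e \<inter> s) \<inter> (f \<inter> s) = {}"
      using disjointD[OF NC_disjoint[OF D(1)]] by blast
  qed (use fD fe in auto)
  also have "\<dots> = card D" using b by (simp add: balanced_def)
  finally show ?thesis using 1 by simp
qed

text \<open>\<open>T\<close> plays the role of multiplication by \<open>-q\<close> and \<open>lam\<close> that of the value \<open>-(q + 1/q)\<close> of a loop.
  The relation between them is multiplied by \<open>T\<close> so that no inverse of \<open>q\<close> is needed.\<close>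

locale loop_module =
  fixes T lam :: "'m::ab_group_add \<Rightarrow> 'm"
  assumes T_add: "T (x + y) = T x + T y"
    and T_T: "T (T x) + x = T (lam x)"
begin

definition wt :: "nat set set \<Rightarrow> nat set \<Rightarrow> 'm \<Rightarrow> 'm" where
  "wt D s c = (if balanced s D then (T ^^ ups s D) c else 0)"

lemma T_0: "T 0 = 0" using T_add[of 0 0] by simp

lemma Tpow_add: "(T ^^ k) (x + y) = (T ^^ k) x + (T ^^ k) y"
  by (induction k) (simp_all add: T_add)

lemma Tpow_0: "(T ^^ k) 0 = 0"
  by (induction k) (simp_all add: T_0)

lemma wt_0: "wt D s 0 = 0" by (simp add: wt_def Tpow_0)

lemma wt_add: "wt D s (x + y) = wt D s x + wt D s y" by (simp add: wt_def Tpow_add)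

lemma wt_sum: "wt D s (sum f X) = (\<Sum>x\<in>X. wt D s (f x))"
  by (induction X rule: infinite_finite_induct) (simp_all add: wt_0 wt_add)

lemma T_sum: "T (sum f X) = (\<Sum>x\<in>X. T (f x))"
  by (induction X rule: infinite_finite_induct) (simp_all add: T_0 T_add)

lemma T_wt: "T (wt D s x) = wt D s (T x)"
  by (simp add: wt_def T_0 funpow_swap1)

lemma wt_insert:
  assumes "finite D" "{a, b} \<notin> D" "a \<noteq> b"
  shows "wt (insert {a, b} D) s c =
    (if (a \<in> s) = (b \<in> s) then 0 else if min a b \<in> s then T (wt D s c) else wt D s c)"
  using assms by (simp add: wt_def balanced_insert ups_insert card_pair_Int_eq_1 T_0)

lemma wt_cong: "D \<in> NC A \<Longrightarrow> s \<inter> A = s' \<inter> A \<Longrightarrow> wt D s c = wt D s' c"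
  unfolding wt_def using balanced_cong[of D A s s'] ups_cong[of D A s s'] by simp

text \<open>The left side is the pairing with a cap at \<open>x\<close> and \<open>y\<close>, scaled
  by \<open>T\<close>. If \<open>{x, y}\<close> is an arc, this is the loop relation
  \<open>T_T\<close>. Otherwise it is a zigzag relation, and the powers of \<open>T\<close> agree
  for each relative position of the two arcs.\<close>

lemma wt_contract:
  assumes D: "D \<in> NC A" "finite A" and xy: "x \<in> A" "y \<in> A" "x < y"
    and adj: "\<And>p. p \<in> A \<Longrightarrow> x < p \<Longrightarrow> y \<le> p" and s: "x \<notin> s" "y \<notin> s"
  shows "wt D (insert y s) c + T (wt D (insert x s) c)
    = T (wt (merge x y D) s (if {x, y} \<in> D then lam c else c))"
proof (cases "{x, y} \<in> D")
  case True
  define D' where "D' = D - {{x, y}}"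
  have D': "D' \<in> NC (A - {x, y})" unfolding D'_def using NC_remove D(1) True by blast
  have f: "finite D'" using NC_finite[OF _ D'] D(2) by simp
  have n: "{x, y} \<notin> D'" by (simp add: D'_def)
  have Deq: "D = insert {x, y} D'" using True by (auto simp: D'_def)
  have m: "merge x y D = D'" using True by (simp add: merge_def D'_def)
  have c: "wt D' (insert y s) c = wt D' s c" "wt D' (insert x s) c = wt D' s c"
    by (rule wt_cong[OF D'], blast)+
  have "wt D (insert y s) c = wt D' s c" "wt D (insert x s) c = T (wt D' s c)"
    unfolding Deq wt_insert[OF f n less_imp_neq[OF xy(3)]] using s xy c by (auto simp: min_def)
  then have "wt D (insert y s) c + T (wt D (insert x s) c) = T (T (wt D' s c)) + wt D' s c"
    by (simp add: add.commute)
  also have "\<dots> = wt D' s (T (T c) + c)" by (simp add: T_wt wt_add)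
  also have "\<dots> = T (wt D' s (lam c))" by (simp add: T_T T_wt)
  finally show ?thesis using True m by simp
next
  case False
  obtain a where a: "{x, a} \<in> D" "a \<noteq> x" "a \<in> A" using NC_partner[OF D(1) xy(1)] .
  obtain b where b: "{y, b} \<in> D" "b \<noteq> y" "b \<in> A" using NC_partner[OF D(1) xy(2)] .
  have n: "a \<noteq> y" "b \<noteq> x" using False a b by (auto simp: insert_commute)
  have ne: "{x, a} \<noteq> {y, b}" using n xy by (auto simp: doubleton_eq_iff)
  define D' where "D' = D - {{x, a}} - {{y, b}}"
  have "D - {{x, a}} \<in> NC (A - {x, a})" using NC_remove D(1) a by blast
  moreover have "{y, b} \<in> D - {{x, a}}" using b ne by simp
  ultimately have D': "D' \<in> NC (A - {x, a} - {y, b})" unfolding D'_def by (rule NC_remove)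
  have f: "finite D'" using NC_finite[OF _ D'] D(2) by simp
  have m: "merge x y D = insert {a, b} D'" and ab: "a \<noteq> b"
    using merge_arcs[OF NC_disjoint[OF D(1)] a(1) b(1)] n a b xy by (auto simp: D'_def)
  have Deq: "D = insert {x, a} (insert {y, b} D')" using a b by (auto simp: D'_def)
  have n1: "{y, b} \<notin> D'" by (simp add: D'_def)
  have n2: "{x, a} \<notin> insert {y, b} D'" using ne by (simp add: D'_def)
  have n3: "{a, b} \<notin> D'"
  proof
    assume "{a, b} \<in> D'"
    then show False using NC_subset[OF D'] by blast
  qed
  define X where "X = wt D' s c"
  have c: "wt D' (insert y s) c = X" "wt D' (insert x s) c = X" unfolding X_def
    by (rule wt_cong[OF D'], blast)+
  have "separates x a y = separates x a b" using noncrossD[OF NC_noncross[OF D(1)] a(1) b(1) ne] .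
  \<comment> \<open>Noncrossing leaves three positions: the partners lie on opposite sides of the
    pair, or both on the left, or both on the right. In the last two cases one arc is nested in the
    other, which means \<open>b < a\<close>.\<close>
  then have ord: "a < x \<and> y < b \<or> b < a \<and> (a < x \<or> y < b)"
    using adj[OF a(3)] adj[OF b(3)] n a(2) b(2) ab xy(3) unfolding separates_def by linarith
  have W: "wt D (insert y s) c = (if a \<in> s then if b \<in> s then 0 else
       if min y b = y then if min x a = a then T (T X) else T X
       else if min x a = a then T X else X else 0)"
    unfolding Deq
    by (subst wt_insert) (use f n1 n2 n s xy a(2) b(2) c in \<open>auto simp: wt_insert T_0 min_def\<close>)
  have W': "wt D (insert x s) c = (if b \<in> s then if a \<in> s then 0 else
       if min y b = b then if min x a = x then T (T X) else T X
       else if min x a = x then T X else X else 0)"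
    unfolding Deq
    by (subst wt_insert) (use f n1 n2 n s xy a(2) b(2) c in \<open>auto simp: wt_insert T_0 min_def\<close>)
  have R: "wt (merge x y D) s c = (if (a \<in> s) = (b \<in> s) then 0 else if min a b \<in> s then T X else X)"
    unfolding m X_def by (rule wt_insert[OF f n3 ab])
  from ord consider "a < x" "y < b" | "b < a" "a < x" | "b < a" "y < b" by blast
  then have "wt D (insert y s) c + T (wt D (insert x s) c) = T (wt (merge x y D) s c)"
    unfolding W W' R using xy(3) by cases (auto simp: T_0 min_def)
  then show ?thesis using False by simp
qed

definition vec :: "nat set \<Rightarrow> (nat set set \<Rightarrow> 'm) \<Rightarrow> nat set \<Rightarrow> 'm" where
  "vec A c s = (\<Sum>D\<in>NC A. wt D s (c D))"

definition contraction :: "nat set \<Rightarrow> nat \<Rightarrow> nat \<Rightarrow> (nat set set \<Rightarrow> 'm) \<Rightarrow> nat set set \<Rightarrow> 'm" where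
  "contraction A x y c G = (\<Sum>D\<in>{D \<in> NC A. merge x y D = G}. if {x, y} \<in> D then lam (c D) else c D)"

text \<open>By linearity, passing from combinations of diagrams to vectors intertwines the
  contraction of diagrams with the cap. The diagrams are grouped by the result of merging.\<close>

lemma vec_contract:
  assumes A: "finite A" and xy: "x \<in> A" "y \<in> A" "x < y"
    and adj: "\<And>p. p \<in> A \<Longrightarrow> x < p \<Longrightarrow> y \<le> p" and s: "x \<notin> s" "y \<notin> s"
  shows "vec A c (insert y s) + T (vec A c (insert x s)) = T (vec (A - {x, y}) (contraction A x y c) s)"
proof -
  let ?f = "\<lambda>D. if {x, y} \<in> D then lam (c D) else c D"
  have "vec A c (insert y s) + T (vec A c (insert x s)) = T (\<Sum>D\<in>NC A. wt (merge x y D) s (?f D))"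
    unfolding vec_def T_sum sum.distrib[symmetric]
    by (rule sum.cong) (simp_all add: wt_contract[OF _ A xy adj s])
  also have "(\<Sum>D\<in>NC A. wt (merge x y D) s (?f D))
      = (\<Sum>G\<in>NC (A - {x, y}). \<Sum>D\<in>{D \<in> NC A. merge x y D = G}. wt (merge x y D) s (?f D))"
    by (rule sum.group[symmetric]) (use A finite_NC NC_merge[OF _ xy adj] in auto)
  also have "\<dots> = vec (A - {x, y}) (contraction A x y c) s"
    unfolding vec_def contraction_def wt_sum by (intro sum.cong refl) simp
  finally show ?thesis .
qed

end

text \<open>A rescaled raising operator of the quantum group acting on a tensor power of its vector
  representation; \<open>s\<close> is the set of tensor factors in the highest weight state.\<close>

definition raise :: "'k::field \<Rightarrow> (nat set \<Rightarrow> 'k) \<Rightarrow> nat set \<Rightarrow> 'k" where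
  "raise q \<phi> s = (\<Sum>i\<in>s. q ^ (2 * card {j \<in> s. i < j} + i) * \<phi> (s - {i}))"

text \<open>The weight \<open>wt\<close> of \<open>loop_module\<close> for multiplication by
  \<open>-q\<close> on a field, with the coefficient split off as a factor.\<close>

definition kwt :: "'k::field \<Rightarrow> nat set set \<Rightarrow> nat set \<Rightarrow> 'k" where
  "kwt q D s = (if balanced s D then (- q) ^ ups s D else 0)"

lemma kwt_insert:
  assumes "finite D" "{a, b} \<notin> D" "a \<noteq> b"
  shows "kwt q (insert {a, b} D) s =
    (if (a \<in> s) = (b \<in> s) then 0 else if min a b \<in> s then - q * kwt q D s else kwt q D s)"
  using assms by (simp add: kwt_def balanced_insert ups_insert card_pair_Int_eq_1)

lemma kwt_cong: "D \<in> NC A \<Longrightarrow> s \<inter> A = s' \<inter> A \<Longrightarrow> kwt q D s = kwt q D s'"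
  unfolding kwt_def using balanced_cong[of D A s s'] ups_cong[of D A s s'] by simp

lemma NC_inside:
  assumes D: "D \<in> NC A" and xy: "{x, y} \<in> D" "x < y" and sub: "{x<..<y} \<subseteq> A"
  shows "{f \<in> D - {{x, y}}. f \<subseteq> {x<..<y}} \<in> NC {x<..<y}"
proof (rule NC_I)
  let ?D = "{f \<in> D - {{x, y}}. f \<subseteq> {x<..<y}}"
  show "disjoint ?D" by (rule pairwise_subset[OF NC_disjoint[OF D]]) blast
  show "noncross ?D" by (rule noncross_subset[OF NC_noncross[OF D]]) blast
  show "card e = 2" if "e \<in> ?D" for e using that NC_card2[OF D] by blast
  show "\<Union>?D = {x<..<y}"
  proof
    show "{x<..<y} \<subseteq> \<Union>?D"
    proof
      fix p assume p: "p \<in> {x<..<y}"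
      obtain r where r: "{p, r} \<in> D" using NC_partner[OF D] p sub by blast
      have ne: "{x, y} \<noteq> {p, r}" using p by (auto simp: doubleton_eq_iff)
      have "separates x y p = separates x y r" using noncrossD[OF NC_noncross[OF D] xy(1) r ne] .
      moreover have "r \<noteq> y" using NC_unique[OF D xy(1) r, of y] ne by auto
      ultimately have "r \<in> {x<..<y}" using p xy by (auto simp: separates_def)
      then have "{p, r} \<in> ?D" using r p ne by auto
      then show "p \<in> \<Union>?D" by blast
    qed
  qed blast
qed

text \<open>Diagrams are invariant vectors. A nonzero term requires \<open>s\<close> to contain both
  ends of one arc and exactly one end of each other arc; removing either of the two ends gives two
  terms that cancel. In \<open>raise\<close>, the exponent at \<open>i\<close> is the weight of the
  factors to the right of \<open>i\<close>, shifted by \<open>m - 1\<close>, so that it does not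
  depend on \<open>m\<close>.\<close>

lemma raise_kwt:
  assumes D: "D \<in> NC {..<m}" and s: "s \<subseteq> {..<m}"
  shows "raise q (kwt q D) s = 0"
proof (cases "\<exists>e\<in>D. e \<subseteq> s")
  case False
  have "kwt q D (s - {i}) = 0" if i: "i \<in> s" for i
  proof -
    obtain j where j: "{i, j} \<in> D" "j \<noteq> i" using NC_partner[OF D] i s by blast
    have "j \<notin> s"
    proof
      assume "j \<in> s"
      then have "{i, j} \<subseteq> s" using i by simp
      with False j(1) show False by metis
    qed
    then have "{i, j} \<inter> (s - {i}) = {}" by blast
    then have "\<not> balanced (s - {i}) D" using j(1) unfolding balanced_def by (metis card.empty zero_neq_one)
    then show ?thesis by (simp add: kwt_def)
  qed
  then show ?thesis by (simp add: raise_def)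
next
  case True
  then obtain e where e: "e \<in> D" "e \<subseteq> s" by blast
  obtain x y where xy: "e = {x, y}" "x < y" using NC_arc[OF D e(1)] .
  have fs: "finite s" using s finite_subset by blast
  define D' where "D' = D - {{x, y}}"
  have D': "D' \<in> NC ({..<m} - {x, y})" unfolding D'_def using NC_remove[OF D e(1)] xy by simp
  have fD': "finite D'" using NC_finite[OF _ D'] by simp
  have n: "{x, y} \<notin> D'" by (simp add: D'_def)
  have Deq: "D = insert {x, y} D'" using e xy by (auto simp: D'_def)
  have xys: "x \<in> s" "y \<in> s" using e xy by auto
  have z: "kwt q D (s - {i}) = 0" if "i \<in> s - {x, y}" for i
    unfolding Deq using kwt_insert[OF fD' n less_imp_neq[OF xy(2)], of q "s - {i}"] xys that by auto
  have c: "kwt q D' (s - {x}) = kwt q D' s" "kwt q D' (s - {y}) = kwt q D' s"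
    by (rule kwt_cong[OF D'], blast)+
  have kx: "kwt q D (s - {x}) = kwt q D' s" and ky: "kwt q D (s - {y}) = - q * kwt q D' s"
    unfolding Deq kwt_insert[OF fD' n less_imp_neq[OF xy(2)]] using xys xy(2) c by (auto simp: min_def)
  have "raise q (kwt q D) s = (\<Sum>i\<in>{x, y}. q ^ (2 * card {j \<in> s. i < j} + i) * kwt q D (s - {i}))"
    unfolding raise_def by (rule sum.mono_neutral_right) (use fs xys z in auto)
  also have "\<dots> = q ^ (2 * card {j \<in> s. x < j} + x) * kwt q D' s
      - q ^ Suc (2 * card {j \<in> s. y < j} + y) * kwt q D' s"
    using xy(2) by (simp add: kx ky)
  also have "\<dots> = 0"
  proof (cases "balanced s D'")
    case True
    \<comment> \<open>The arcs under \<open>{x, y}\<close> are balanced, so half of the points in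
      between lie in \<open>s\<close>. This makes the exponents at \<open>x\<close> and
      \<open>y\<close> differ by exactly one, which compensates the factor \<open>q\<close> of the
      arc.\<close>
    define I where "I = {x<..<y}"
    let ?D = "{f \<in> D'. f \<subseteq> I}"
    have "y < m" using e xy s by auto
    then have "I \<subseteq> {..<m}" by (auto simp: I_def)
    then have "?D \<in> NC I" using NC_inside[OF D] e xy by (simp add: D'_def I_def)
    moreover have "balanced s ?D" using True by (auto simp: balanced_def)
    ultimately have cI: "card I = 2 * card (I \<inter> s)" using balanced_card[of ?D I s] by (simp add: I_def)
    have "{j \<in> s. x < j} = (I \<inter> s) \<union> insert y {j \<in> s. y < j}"
      using xy(2) xys by (auto simp: I_def)
    also have "card \<dots> = card (I \<inter> s) + card (insert y {j \<in> s. y < j})"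
      by (rule card_Un_disjoint) (use fs in \<open>auto simp: I_def\<close>)
    also have "\<dots> = card (I \<inter> s) + Suc (card {j \<in> s. y < j})" using fs by simp
    finally have "2 * card {j \<in> s. x < j} + x = Suc (2 * card {j \<in> s. y < j} + y)"
      using cI xy(2) by (simp add: I_def)
    then show ?thesis by simp
  qed (simp add: kwt_def)
  finally show ?thesis .
qed

section \<open>The triangular system of diagrams and ballot sequences\<close>

lemma balanced_openers:
  assumes D: "D \<in> NC A" shows "balanced (openers D) D"
  unfolding balanced_def
proof
  fix e assume e: "e \<in> D"
  have "e \<inter> openers D = {Min e}"
  proof
    show "e \<inter> openers D \<subseteq> {Min e}"
    proof
      fix p assume "p \<in> e \<inter> openers D"
      then obtain f where f: "f \<in> D" "p = Min f" "p \<in> e" by auto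
      then have "f = e" using NC_unique[OF D f(1) e] Min_arc[OF D f(1)] by metis
      then show "p \<in> {Min e}" using f by simp
    qed
  qed (use e Min_arc[OF D e] in auto)
  then show "card (e \<inter> openers D) = 1" by simp
qed

lemma kwt_openers:
  assumes D: "D \<in> NC A" shows "kwt q D (openers D) = (- q) ^ card D"
proof -
  note balanced_openers[OF D]
  moreover have "{e \<in> D. Min e \<in> openers D} = D" by auto
  ultimately show ?thesis by (simp add: kwt_def ups_def)
qed

lemma kwt_dominate:
  assumes "D \<in> NC A" "D' \<in> NC A" "finite A" "kwt q D' (openers D) \<noteq> 0" "D' \<noteq> D"
  shows "\<Sum>(openers D') < \<Sum>(openers D)"
proof -
  have "balanced (openers D) D'" using assms(4) by (auto simp: kwt_def split: if_splits)
  then show ?thesis using openers_dominate[OF assms(1-3)] assms(5) by (metis le_neq_implies_less)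
qed

text \<open>The matrix is triangular by \<open>kwt_dominate\<close>, with powers of
  \<open>-q\<close> on the diagonal; induction on the sum of openers.\<close>

lemma kwt_independent:
  assumes A: "finite A" and q: "q \<noteq> 0"
    and eq: "\<And>D. D \<in> NC A \<Longrightarrow> (\<Sum>D'\<in>NC A. c D' * kwt q D' (openers D)) = 0"
  shows "D \<in> NC A \<Longrightarrow> c D = 0"
proof (induction "\<Sum>(openers D)" arbitrary: D rule: less_induct)
  case less
  have z: "c D' * kwt q D' (openers D) = 0" if "D' \<in> NC A - {D}" for D'
  proof (cases "kwt q D' (openers D) = 0")
    case False
    then have "\<Sum>(openers D') < \<Sum>(openers D)" using kwt_dominate[OF less(2) _ A] that by blast
    then show ?thesis using less(1)[of D'] that by simp
  qed simp
  have "0 = (\<Sum>D'\<in>NC A. c D' * kwt q D' (openers D))" using eq[OF less(2)] by simp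
  also have "\<dots> = c D * kwt q D (openers D) + (\<Sum>D'\<in>NC A - {D}. c D' * kwt q D' (openers D))"
    by (rule sum.remove) (use finite_NC[OF A] less(2) in auto)
  also have "(\<Sum>D'\<in>NC A - {D}. c D' * kwt q D' (openers D)) = 0"
    by (rule sum.neutral) (use z in blast)
  finally show ?case using kwt_openers[OF less(2), of q] q by simp
qed

text \<open>Substitution divides only by powers of \<open>-q\<close>, so it stays inside any
  additive group \<open>L\<close> that is stable under \<open>q\<close> and \<open>1/q\<close>. This
  gives control over denominators in the application.\<close>

lemma kwt_triangular_solve:
  fixes q :: "'k::field"
  assumes A: "finite A" and q: "q \<noteq> 0"
    and L0: "0 \<in> L" and Lm: "\<And>x y. x \<in> L \<Longrightarrow> y \<in> L \<Longrightarrow> x - y \<in> L"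
    and Lq: "\<And>x. x \<in> L \<Longrightarrow> q * x \<in> L" "\<And>x. x \<in> L \<Longrightarrow> x / q \<in> L"
    and t: "\<And>D. D \<in> NC A \<Longrightarrow> t (openers D) \<in> L"
  shows "\<exists>c. (\<forall>D. c D \<in> L) \<and> (\<forall>D\<in>NC A. (\<Sum>D'\<in>NC A. c D' * kwt q D' (openers D)) = t (openers D))"
proof -
  have Ln: "- x \<in> L" if "x \<in> L" for x using Lm[OF L0 that] by simp
  have La: "x + y \<in> L" if "x \<in> L" "y \<in> L" for x y using Lm[OF that(1) Ln[OF that(2)]] by simp
  have Lpow: "x * (- q) ^ k \<in> L" if "x \<in> L" for x k
  proof (induction k)
    case (Suc k)
    then show ?case using Ln[OF Lq(1)] by (simp add: mult.left_commute)
  qed (use that in simp)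
  have Ldiv: "x / (- q) ^ k \<in> L" if "x \<in> L" for x k
  proof (induction k)
    case (Suc k)
    then have "- ((x / (- q) ^ k) / q) \<in> L" using Lq(2) Ln by blast
    then show ?case using q by (simp add: field_simps)
  qed (use that in simp)
  have Lk: "x * kwt q D s \<in> L" if "x \<in> L" for x D s
    using Lpow[OF that] L0 by (simp add: kwt_def)
  have Lsum: "sum f X \<in> L" if "\<And>x. x \<in> X \<Longrightarrow> f x \<in> L" for f :: "nat set set \<Rightarrow> 'k" and X
    using that by (induction X rule: infinite_finite_induct) (auto simp: L0 La)
  define S where "S c D = (\<Sum>D'\<in>NC A. c D' * kwt q D' (openers D))" for c :: "nat set set \<Rightarrow> 'k" and D
  \<comment> \<open>The solution is built level by level, the level of a diagram being its sum of
    openers, and is zero on the levels not yet reached.\<close>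
  have main: "\<exists>c. (\<forall>D. c D \<in> L) \<and> (\<forall>D. \<not> \<Sum>(openers D) < b \<longrightarrow> c D = 0)
      \<and> (\<forall>D\<in>NC A. \<Sum>(openers D) < b \<longrightarrow> S c D = t (openers D))" for b
  proof (induction b)
    case 0
    show ?case by (rule exI[of _ "\<lambda>_. 0"]) (simp add: L0)
  next
    case (Suc b)
    then obtain c where c: "\<And>D. c D \<in> L" "\<And>D. \<not> \<Sum>(openers D) < b \<Longrightarrow> c D = 0"
      "\<And>D. D \<in> NC A \<Longrightarrow> \<Sum>(openers D) < b \<Longrightarrow> S c D = t (openers D)" by blast
    define c' where "c' D = (if D \<in> NC A \<and> \<Sum>(openers D) = b
      then (t (openers D) - S c D) / (- q) ^ card D else c D)" for D
    have SL: "S c D \<in> L" for D unfolding S_def by (rule Lsum) (rule Lk[OF c(1)])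
    have 1: "c' D \<in> L" for D unfolding c'_def using Ldiv Lm t SL c(1) by auto
    have 2: "c' D = 0" if "\<not> \<Sum>(openers D) < Suc b" for D
      using that c(2)[of D] by (simp add: c'_def)
    have 3: "S c' D = t (openers D)" if D: "D \<in> NC A" and lt: "\<Sum>(openers D) < Suc b" for D
    proof -
      have z: "(c' D' - c D') * kwt q D' (openers D) = 0" if D': "D' \<in> NC A - {D}" for D'
      proof (cases "kwt q D' (openers D) = 0")
        case False
        then have "\<Sum>(openers D') < \<Sum>(openers D)" using kwt_dominate[OF D _ A] D' by blast
        then show ?thesis using lt by (simp add: c'_def)
      qed simp
      have "S c' D - S c D = (\<Sum>D'\<in>NC A. (c' D' - c D') * kwt q D' (openers D))"
        by (simp add: S_def sum_subtractf[symmetric] left_diff_distrib)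
      also have "\<dots> = (c' D - c D) * kwt q D (openers D) + (\<Sum>D'\<in>NC A - {D}. (c' D' - c D') * kwt q D' (openers D))"
        by (rule sum.remove) (use finite_NC[OF A] D in auto)
      also have "(\<Sum>D'\<in>NC A - {D}. (c' D' - c D') * kwt q D' (openers D)) = 0"
        by (rule sum.neutral) (use z in blast)
      finally have S: "S c' D = S c D + (c' D - c D) * (- q) ^ card D"
        using kwt_openers[OF D, of q] by (simp add: algebra_simps)
      show ?thesis
      proof (cases "\<Sum>(openers D) < b")
        case True
        then show ?thesis using S c(3)[OF D True] by (simp add: c'_def)
      next
        case False
        then have "c D = 0" "c' D = (t (openers D) - S c D) / (- q) ^ card D"
          using c(2) D lt by (auto simp: c'_def)
        then show ?thesis using S q by simp
      qed
    qed
    show ?case using 1 2 3 by blast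
  qed
  define b where "b = Suc (Max ((\<lambda>D. \<Sum>(openers D)) ` NC A))"
  have "\<Sum>(openers D) < b" if "D \<in> NC A" for D
    unfolding b_def less_Suc_eq_le using that finite_NC[OF A] by (intro Max_ge) auto
  then show ?thesis using main[of b] unfolding S_def by blast
qed

section \<open>The kernel of the raising operator\<close>

text \<open>The sum \<open>1 + q^2 + ... + q^(2 j - 2)\<close>, which is \<open>q^(j - 1)\<close>
  times the quantum integer \<open>[j]\<close>, written without division.\<close>

primrec qsum :: "'k::field \<Rightarrow> nat \<Rightarrow> 'k" where
  "qsum q 0 = 0"
| "qsum q (Suc j) = q^2 * qsum q j + 1"

lemma qsum_closed: "(q^2 - 1) * qsum q j = q ^ (2 * j) - 1"
proof (induction j)
  case (Suc j)
  have "(q^2 - 1) * qsum q (Suc j) = q^2 * ((q^2 - 1) * qsum q j) + (q^2 - 1)"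
    by (simp add: algebra_simps)
  then show ?case unfolding Suc by (simp add: algebra_simps power2_eq_square)
qed simp

lemma qsum_Suc_top: "qsum q (Suc j) = qsum q j + q ^ (2 * j)"
  by (induction j) (simp_all add: algebra_simps power2_eq_square)

lemma sum_rank: "finite s \<Longrightarrow> (\<Sum>i\<in>s. q ^ (2 * card {j \<in> s. i < j})) = qsum q (card (s :: nat set))"
proof (induction s rule: finite_linorder_min_induct)
  case (insert b s)
  have b: "b \<notin> s" using insert(2) by blast
  have "{j \<in> insert b s. b < j} = s" using insert(2) by auto
  moreover have "{j \<in> insert b s. i < j} = {j \<in> s. i < j}" if "i \<in> s" for i using insert(2) that by auto
  ultimately show ?case using insert b qsum_Suc_top[of q "card s"] by (simp add: add.commute)
qed simp

lemma raise_cong: "(\<And>i. i \<in> s \<Longrightarrow> \<phi> (s - {i}) = \<psi> (s - {i})) \<Longrightarrow> raise q \<phi> s = raise q \<psi> s"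
  unfolding raise_def by (rule sum.cong) auto

lemma raise_linear: "raise q (\<lambda>t. a * \<phi> t + b * \<psi> t) s = a * raise q \<phi> s + b * raise q \<psi> s"
  unfolding raise_def sum_distrib_left sum.distrib[symmetric]
  by (rule sum.cong) (simp_all add: algebra_simps)

lemma raise_sum: "raise q (\<lambda>t. \<Sum>x\<in>X. c x * \<phi> x t) s = (\<Sum>x\<in>X. c x * raise q (\<phi> x) s)"
  unfolding raise_def sum_distrib_left
  by (subst sum.swap) (simp add: mult.left_commute)

text \<open>The coproduct of the raising operator with the last tensor factor split off: every
  smaller element gets one more element above it, hence the factor \<open>q^2\<close>.\<close>

lemma raise_insert:
  assumes "s \<subseteq> {..<m}"
  shows "raise q \<phi> (insert m s) = q^2 * raise q (\<lambda>t. \<phi> (insert m t)) s + q ^ m * \<phi> s"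
proof -
  have fs: "finite s" and m: "m \<notin> s" using assms finite_subset by auto
  have 1: "{j \<in> insert m s. m < j} = {}" "insert m s - {m} = s" using assms m by auto
  have 2: "q ^ (2 * card {j \<in> insert m s. i < j} + i) * \<phi> (insert m s - {i})
    = q^2 * (q ^ (2 * card {j \<in> s. i < j} + i) * \<phi> (insert m (s - {i})))" if i: "i \<in> s" for i
  proof -
    have "{j \<in> insert m s. i < j} = insert m {j \<in> s. i < j}" using i assms by auto
    then have "card {j \<in> insert m s. i < j} = Suc (card {j \<in> s. i < j})" using fs m by simp
    moreover have "insert m s - {i} = insert m (s - {i})" using i m by auto
    moreover have "q ^ (2 * Suc c + i) = q^2 * q ^ (2 * c + i)" for c by (simp add: power2_eq_square)
    ultimately show ?thesis by (simp only: mult.assoc)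
  qed
  have "raise q \<phi> (insert m s) = q ^ m * \<phi> s + (\<Sum>i\<in>s. q ^ (2 * card {j \<in> insert m s. i < j} + i) * \<phi> (insert m s - {i}))"
    unfolding raise_def sum.insert[OF fs m] 1 by simp
  also have "(\<Sum>i\<in>s. q ^ (2 * card {j \<in> insert m s. i < j} + i) * \<phi> (insert m s - {i}))
     = q^2 * raise q (\<lambda>t. \<phi> (insert m t)) s"
    unfolding raise_def sum_distrib_left by (rule sum.cong) (simp_all only: 2)
  finally show ?thesis by simp
qed

text \<open>On one tensor factor the raising operator squares to zero, so at most one of the
  \<open>j\<close> applications concerns the last factor; \<open>qsum q j\<close> sums over the
  possible places. For \<open>j = 0\<close> the truncated \<open>j - 1\<close> is harmless because
  \<open>qsum q 0 = 0\<close>.\<close>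

lemma raise_pow_insert:
  "s \<subseteq> {..<m} \<Longrightarrow> (raise q ^^ j) \<phi> (insert m s)
    = q ^ (2 * j) * (raise q ^^ j) (\<lambda>t. \<phi> (insert m t)) s + q ^ m * qsum q j * (raise q ^^ (j - 1)) \<phi> s"
proof (induction j arbitrary: s)
  case (Suc j)
  let ?\<psi> = "\<lambda>t. \<phi> (insert m t)"
  have "(raise q ^^ Suc j) \<phi> (insert m s)
      = q^2 * raise q (\<lambda>t. (raise q ^^ j) \<phi> (insert m t)) s + q ^ m * (raise q ^^ j) \<phi> s"
    using raise_insert[OF Suc(2)] by simp
  also have "raise q (\<lambda>t. (raise q ^^ j) \<phi> (insert m t)) s
     = raise q (\<lambda>t. q ^ (2 * j) * (raise q ^^ j) ?\<psi> t + q ^ m * qsum q j * (raise q ^^ (j - 1)) \<phi> t) s"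
    by (rule raise_cong, rule Suc(1)) (use Suc(2) in blast)
  also have "\<dots> = q ^ (2 * j) * (raise q ^^ Suc j) ?\<psi> s + (q ^ m * qsum q j) * raise q ((raise q ^^ (j - 1)) \<phi>) s"
    by (simp add: raise_linear)
  also have "(q ^ m * qsum q j) * raise q ((raise q ^^ (j - 1)) \<phi>) s
      = q ^ m * (qsum q j * raise q ((raise q ^^ (j - 1)) \<phi>) s)" by (rule mult.assoc)
  also have "qsum q j * raise q ((raise q ^^ (j - 1)) \<phi>) s = qsum q j * (raise q ^^ j) \<phi> s"
    by (cases j) simp_all
  finally show ?case by (simp add: algebra_simps power2_eq_square)
qed simp

lemma raise_pow_zero:
  "finite s \<Longrightarrow> (\<And>t. t \<subseteq> s \<Longrightarrow> card t + j = card s \<Longrightarrow> \<phi> t = 0) \<Longrightarrow> (raise q ^^ j) \<phi> s = 0"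
proof (induction j arbitrary: s)
  case (Suc j)
  have "(raise q ^^ j) \<phi> (s - {i}) = 0" if i: "i \<in> s" for i
  proof (rule Suc(1))
    fix t assume t: "t \<subseteq> s - {i}" "card t + j = card (s - {i})"
    have "card s = Suc (card (s - {i}))" using card.remove[OF Suc(2) i] .
    then show "\<phi> t = 0" using Suc(3)[of t] t by auto
  qed (use Suc(2) in simp)
  then have "raise q ((raise q ^^ j) \<phi>) s = raise q (\<lambda>_. 0) s" by (rule raise_cong)
  then show ?case by (simp add: raise_def[of q "\<lambda>_. 0"])
qed simp

lemma subset_lessThan_Suc_cases:
  assumes "s \<subseteq> {..<Suc m}"
  obtains "s \<subseteq> {..<m}" | s' where "s = insert m s'" "s' \<subseteq> {..<m}" "card s = Suc (card s')"
proof (cases "m \<in> s")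
  case True
  have f: "finite s" using assms finite_subset by blast
  have "s = insert m (s - {m})" "s - {m} \<subseteq> {..<m}" using True assms by (auto simp: less_Suc_eq)
  then show ?thesis using that(2) card.remove[OF f True] by blast
next
  case False
  then have "s \<subseteq> {..<m}" using assms by (auto simp: less_Suc_eq)
  then show ?thesis using that(1) by blast
qed

text \<open>With \<open>p\<close> of \<open>m\<close> signs up the weight is \<open>2 p - m\<close>,
  and the bound says that the \<open>j\<close>-th power does not go beyond the opposite weight,
  where sl2 theory predicts injectivity. The induction on \<open>m\<close> splits off the last
  factor and avoids a decomposition into irreducibles.\<close>

lemma raise_pow_inj:
  assumes q: "q \<noteq> 0" and qs: "\<And>j. j > 0 \<Longrightarrow> qsum q j \<noteq> 0"
  shows "2 * p + j \<le> m \<Longrightarrow> (\<And>t. t \<subseteq> {..<m} \<Longrightarrow> card t = p + j \<Longrightarrow> (raise q ^^ j) \<phi> t = 0)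
    \<Longrightarrow> s \<subseteq> {..<m} \<Longrightarrow> card s = p \<Longrightarrow> \<phi> s = 0"
proof (induction m arbitrary: p j \<phi> s)
  case 0
  then show ?case by simp
next
  case (Suc m)
  note pj = Suc.prems(1) and R = Suc.prems(2) and IH = Suc.IH
  have R': "(raise q ^^ j) \<phi> t = 0" if "t \<subseteq> {..<m}" "card t = p + j" for t
    by (rule R) (use that in auto)
  have fin: "finite t" if "t \<subseteq> {..<m}" for t using that finite_subset by blast
  have Ri: "q ^ (2 * j) * (raise q ^^ j) (\<lambda>t. \<phi> (insert m t)) t + q ^ m * qsum q j * (raise q ^^ (j - 1)) \<phi> t = 0"
    if t: "t \<subseteq> {..<m}" "Suc (card t) = p + j" for t
  proof -
    have "m \<notin> t" using t by auto
    then have "(raise q ^^ j) \<phi> (insert m t) = 0"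
      by (intro R) (use t fin in \<open>auto simp: less_Suc_eq\<close>)
    then show ?thesis using raise_pow_insert[OF t(1), of j q \<phi>] by simp
  qed
  show ?case
  proof (cases "j = 0")
    case True
    then show ?thesis using R[of s] Suc.prems by simp
  next
    case j: False
    \<comment> \<open>If the bound has slack, the sets without \<open>m\<close> are settled first,
      with the same \<open>p\<close> and \<open>j\<close>. On the boundary the order is reversed:
      the part with \<open>m\<close> is treated by one more power, then the part without
      \<open>m\<close> by one power less, which is where \<open>qsum q j \<noteq> 0\<close>
      enters.\<close>
    consider "2 * p + j \<le> m" | "2 * p + j = Suc m" using pj by linarith
    then show ?thesis
    proof cases
      case 1
      have b: "\<phi> t = 0" if "t \<subseteq> {..<m}" "card t = p" for t
        by (rule IH[OF 1 R']) (use that in auto)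
      show ?thesis using Suc.prems(3)
      proof (cases rule: subset_lessThan_Suc_cases)
        case 1
        then show ?thesis using b Suc.prems(4) by blast
      next
        case (2 s')
        then obtain p' where p': "p = Suc p'" "card s' = p'" using Suc.prems(4) by auto
        have "(raise q ^^ j) (\<lambda>t. \<phi> (insert m t)) t = 0" if t: "t \<subseteq> {..<m}" "card t = p' + j" for t
        proof -
          have "(raise q ^^ (j - 1)) \<phi> t = 0"
          proof (rule raise_pow_zero)
            fix u assume u: "u \<subseteq> t" "card u + (j - 1) = card t"
            then have "card u = p" using t p' j by linarith
            then show "\<phi> u = 0" using b u t by blast
          qed (use fin t in blast)
          then show ?thesis using Ri[OF t(1)] t p' q by simp
        qed
        then have "\<phi> (insert m s') = 0"
          using IH[of p' j "\<lambda>t. \<phi> (insert m t)" s'] 2 p' \<open>2 * p + j \<le> m\<close> by simp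
        then show ?thesis using 2 by simp
      qed
    next
      case eq: 2
      have a: "\<phi> (insert m t) = 0" if t: "t \<subseteq> {..<m}" "Suc (card t) = p" for t
      proof -
        have "(raise q ^^ Suc j) (\<lambda>t. \<phi> (insert m t)) u = 0" if u: "u \<subseteq> {..<m}" "card u = card t + Suc j" for u
        proof -
          have m: "m \<notin> u" using u by auto
          have "(raise q ^^ Suc j) \<phi> (insert m u) = raise q (\<lambda>_. 0) (insert m u)"
            unfolding funpow.simps(2) comp_def
          proof (rule raise_cong)
            fix i assume "i \<in> insert m u"
            then have "Suc (card (insert m u - {i})) = Suc (card u)"
              using card.remove[of "insert m u" i] fin[OF u(1)] m by simp
            then show "(raise q ^^ j) \<phi> (insert m u - {i}) = 0"
              by (intro R) (use u t in \<open>auto simp: less_Suc_eq\<close>)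
          qed
          also have "\<dots> = 0" by (simp add: raise_def)
          finally have "(raise q ^^ Suc j) \<phi> (insert m u) = 0" .
          moreover have "(raise q ^^ j) \<phi> u = 0" by (rule R') (use u t in auto)
          ultimately show ?thesis using raise_pow_insert[OF u(1), of "Suc j" q \<phi>] q by simp
        qed
        then show ?thesis
          using IH[of "card t" "Suc j" "\<lambda>t. \<phi> (insert m t)" t] t eq by simp
      qed
      have b: "\<phi> t = 0" if t: "t \<subseteq> {..<m}" "card t = p" for t
      proof (rule IH[of p "j - 1"])
        fix u assume u: "u \<subseteq> {..<m}" "card u = p + (j - 1)"
        have "(raise q ^^ j) (\<lambda>t. \<phi> (insert m t)) u = 0"
        proof (rule raise_pow_zero)
          fix v assume v: "v \<subseteq> u" "card v + j = card u"
          then have "Suc (card v) = p" using u j by linarith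
          then show "\<phi> (insert m v) = 0" using a v u by blast
        qed (use fin u in blast)
        then show "(raise q ^^ (j - 1)) \<phi> u = 0" using Ri[OF u(1)] u j q qs by simp
      qed (use t eq j in auto)
      show ?thesis using Suc.prems(3)
      proof (cases rule: subset_lessThan_Suc_cases)
        case 1
        then show ?thesis using b Suc.prems(4) by blast
      next
        case (2 s')
        then show ?thesis using a Suc.prems(4) by simp
      qed
    qed
  qed
qed

text \<open>Split off the last factor. If it is down, the remaining vector has weight one larger and
  the induction applies. If it is up, the remaining weight is one smaller: either it is still
  nonnegative, or it is negative and the raising operator is injective there.\<close>

lemma raise_kernel_ballot:
  assumes q: "q \<noteq> 0" and qs: "\<And>j. j > 0 \<Longrightarrow> qsum q j \<noteq> 0"
  shows "m \<le> 2 * p \<Longrightarrow> (\<And>t. t \<subseteq> {..<m} \<Longrightarrow> card t = Suc p \<Longrightarrow> raise q \<phi> t = 0)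
    \<Longrightarrow> (\<And>t. t \<subseteq> {..<m} \<Longrightarrow> card t = p \<Longrightarrow> (\<forall>l\<le>m. l \<le> 2 * card (t \<inter> {..<l})) \<Longrightarrow> \<phi> t = 0)
    \<Longrightarrow> s \<subseteq> {..<m} \<Longrightarrow> card s = p \<Longrightarrow> \<phi> s = 0"
proof (induction m arbitrary: p \<phi> s)
  case 0
  then show ?case by simp
next
  case (Suc m)
  note mp = Suc.prems(1) and R = Suc.prems(2) and V = Suc.prems(3) and IH = Suc.IH
  have b: "\<phi> t = 0" if t: "t \<subseteq> {..<m}" "card t = p" for t
  proof (rule IH[of p])
    fix u assume u: "u \<subseteq> {..<m}" "card u = p" "\<forall>l\<le>m. l \<le> 2 * card (u \<inter> {..<l})"
    have u': "u \<inter> {..<Suc m} = u" using u by auto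
    have "l \<le> 2 * card (u \<inter> {..<l})" if "l \<le> Suc m" for l
      using that u(3) mp u(2) u' by (cases "l = Suc m") auto
    then show "\<phi> u = 0" by (intro V) (use u in auto)
  next
    fix u assume "u \<subseteq> {..<m}" "card u = Suc p"
    then show "raise q \<phi> u = 0" by (intro R) auto
  qed (use mp t in auto)
  show ?case using Suc.prems(4)
  proof (cases rule: subset_lessThan_Suc_cases)
    case 1
    then show ?thesis using b Suc.prems(5) by blast
  next
    case (2 s')
    then obtain p' where p': "p = Suc p'" "card s' = p'" using Suc.prems(5) by auto
    let ?\<psi> = "\<lambda>t. \<phi> (insert m t)"
    have Ra: "raise q ?\<psi> t = 0" if t: "t \<subseteq> {..<m}" "card t = Suc p'" for t
    proof -
      have "m \<notin> t" "finite t" using t finite_subset by auto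
      then have "raise q \<phi> (insert m t) = 0" by (intro R) (use t p' in \<open>auto simp: less_Suc_eq\<close>)
      moreover have "\<phi> t = 0" using b t p' by simp
      ultimately show ?thesis using raise_insert[OF t(1), of q \<phi>] q by simp
    qed
    have "?\<psi> s' = 0"
    proof (cases "m \<le> 2 * p'")
      case True
      show ?thesis
      proof (rule IH[of p' ?\<psi>, OF True])
        fix t assume t: "t \<subseteq> {..<m}" "card t = p'" "\<forall>l\<le>m. l \<le> 2 * card (t \<inter> {..<l})"
        have m: "m \<notin> t" "finite t" using t finite_subset by auto
        have i: "insert m t \<inter> {..<l} = (if l \<le> m then t \<inter> {..<l} else insert m (t \<inter> {..<l}))" for l by auto
        have t': "t \<inter> {..<Suc m} = t" using t by auto
        have "l \<le> 2 * card (insert m t \<inter> {..<l})" if "l \<le> Suc m" for l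
          using that t(2,3) mp p' m t' by (cases "l = Suc m") (auto simp: i)
        then show "\<phi> (insert m t) = 0" by (intro V) (use t m p' in \<open>auto simp: less_Suc_eq\<close>)
      qed (use Ra 2 p' in auto)
    next
      case False
      have "2 * p' + 1 \<le> m" using False by simp
      then show ?thesis
        using raise_pow_inj[OF q qs, of p' 1 m ?\<psi> s'] Ra 2 p' by simp
    qed
    then show ?thesis using 2 by simp
  qed
qed

text \<open>The vector is q-symmetric in each half, since moving an element up by one multiplies
  \<open>q ^ \<Sum>t\<close> by \<open>q\<close>. The factor \<open>q ^ i\<close> of
  \<open>raise\<close> restores \<open>q ^ \<Sum>s\<close>, so only ranks remain. They add up to one
  \<open>qsum\<close> for each half, which leaves a two-term recurrence for
  \<open>z\<close>.\<close>

lemma raise_block_symmetric: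
  assumes s: "s \<subseteq> {..<2 * n}" "card s = Suc n"
    and z: "\<And>k. 0 < k \<Longrightarrow> k \<le> n \<Longrightarrow> z k * qsum q (Suc n - k) + z (k - 1) * q ^ (2 * (Suc n - k)) * qsum q k = 0"
  shows "raise q (\<lambda>t. z (card (t \<inter> {..<n})) * q ^ (\<Sum>t)) s = 0"
proof -
  define s1 where "s1 = s \<inter> {..<n}"
  define s2 where "s2 = s \<inter> {n..}"
  define k where "k = card s1"
  have fs: "finite s" using s finite_subset by blast
  have f: "finite s1" "finite s2" "s1 \<inter> s2 = {}" "s = s1 \<union> s2" using fs by (auto simp: s1_def s2_def)
  have "card s = k + card s2" unfolding k_def using card_Un_disjoint[OF f(1-3)] f(4) by simp
  then have c2: "card s2 = Suc n - k" "k \<le> Suc n" using s by auto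
  have "s1 \<subseteq> {..<n}" "s2 \<subseteq> {n..<2*n}" using s by (auto simp: s1_def s2_def)
  then have "card s1 \<le> n" "card s2 \<le> n" using card_mono[of "{..<n}" s1] card_mono[of "{n..<2*n}" s2] by auto
  then have k: "0 < k" "k \<le> n" using c2 k_def by auto
  have S: "\<Sum>s = i + \<Sum>(s - {i})" if "i \<in> s" for i using sum.remove[OF fs that, of "\<lambda>x. x"] by simp
  define F where "F i = q ^ (2 * card {j \<in> s. i < j}) * z (card ((s - {i}) \<inter> {..<n}))" for i
  have "raise q (\<lambda>t. z (card (t \<inter> {..<n})) * q ^ (\<Sum>t)) s = (\<Sum>i\<in>s. q ^ (\<Sum>s) * F i)"
    unfolding raise_def F_def by (rule sum.cong) (simp_all add: S power_add)
  also have "\<dots> = q ^ (\<Sum>s) * ((\<Sum>i\<in>s1. F i) + (\<Sum>i\<in>s2. F i))"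
    unfolding sum_distrib_left[symmetric] using sum.union_disjoint[OF f(1-3), of F] f(4) by simp
  also have "(\<Sum>i\<in>s1. F i) = (\<Sum>i\<in>s1. z (k - 1) * q ^ (2 * (Suc n - k)) * q ^ (2 * card {j \<in> s1. i < j}))"
  proof (rule sum.cong[OF refl])
    fix i assume i: "i \<in> s1"
    have "{j \<in> s. i < j} = {j \<in> s1. i < j} \<union> s2" using i by (auto simp: s1_def s2_def)
    also have "card \<dots> = card {j \<in> s1. i < j} + card s2" by (rule card_Un_disjoint) (use f in auto)
    finally have c: "card {j \<in> s. i < j} = card {j \<in> s1. i < j} + (Suc n - k)" using c2 by simp
    have "(s - {i}) \<inter> {..<n} = s1 - {i}" by (auto simp: s1_def)
    then have "card ((s - {i}) \<inter> {..<n}) = k - 1" using i by (simp add: k_def)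
    then show "F i = z (k - 1) * q ^ (2 * (Suc n - k)) * q ^ (2 * card {j \<in> s1. i < j})"
      unfolding F_def c by (simp add: power_add distrib_left)
  qed
  also have "\<dots> = z (k - 1) * q ^ (2 * (Suc n - k)) * qsum q k"
    unfolding sum_distrib_left[symmetric] sum_rank[OF f(1)] k_def ..
  also have "(\<Sum>i\<in>s2. F i) = (\<Sum>i\<in>s2. z k * q ^ (2 * card {j \<in> s2. i < j}))"
  proof (rule sum.cong[OF refl])
    fix i assume i: "i \<in> s2"
    have "{j \<in> s. i < j} = {j \<in> s2. i < j}" using i by (auto simp: s2_def)
    moreover have "(s - {i}) \<inter> {..<n} = s1" using i by (auto simp: s1_def s2_def)
    ultimately show "F i = z k * q ^ (2 * card {j \<in> s2. i < j})" unfolding F_def k_def by simp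
  qed
  also have "\<dots> = z k * qsum q (Suc n - k)"
    unfolding sum_distrib_left[symmetric] sum_rank[OF f(2)] c2 ..
  finally show ?thesis using z[OF k] by (simp add: add.commute)
qed

section \<open>Quantum integers and binomial coefficients\<close>

definition eval_int :: "'a::comm_ring_1 \<Rightarrow> int poly \<Rightarrow> 'a" where
  "eval_int x p = poly (map_poly of_int p) x"

lemma eval_int_0: "eval_int x 0 = 0" by (simp add: eval_int_def)

lemma eval_int_pCons: "eval_int x (pCons c p) = of_int c + x * eval_int x p"
  by (simp add: eval_int_def map_poly_pCons)

lemma eval_int_1: "eval_int x 1 = 1" by (simp add: eval_int_def)

lemma eval_int_add: "eval_int x (p + q) = eval_int x p + eval_int x q"
  by (induction p q rule: poly_induct2) (simp_all add: eval_int_0 eval_int_pCons algebra_simps)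

lemma eval_int_uminus: "eval_int x (- p) = - eval_int x p"
  using eval_int_add[of x p "- p"] by (simp add: eval_int_0 eq_neg_iff_add_eq_0 add.commute)

lemma eval_int_diff: "eval_int x (p - q) = eval_int x p - eval_int x q"
  using eval_int_add[of x p "- q"] by (simp add: eval_int_uminus)

lemma eval_int_smult: "eval_int x (smult c p) = of_int c * eval_int x p"
  by (induction p) (simp_all add: eval_int_0 eval_int_pCons algebra_simps)

lemma eval_int_mult: "eval_int x (p * q) = eval_int x p * eval_int x q"
  by (induction p) (simp_all add: eval_int_0 eval_int_pCons eval_int_add eval_int_smult algebra_simps)

lemma eval_int_sum: "eval_int x (sum f X) = (\<Sum>i\<in>X. eval_int x (f i))"
  by (induction X rule: infinite_finite_induct) (simp_all add: eval_int_0 eval_int_add)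

abbreviation ev :: "int poly \<Rightarrow> int poly fract" where
  "ev \<equiv> eval_int (qvar + inverse qvar)"

lemma Fract_add_1: "Fract (a :: int poly) 1 + Fract b 1 = Fract (a + b) 1"
  by simp

lemma of_int_fract: "(of_int c :: int poly fract) = Fract [:c:] 1"
proof -
  have n: "(of_nat k :: int poly fract) = Fract [:int k:] 1" for k
    by (simp add: of_nat_fract of_nat_poly)
  show ?thesis
  proof (cases c rule: int_cases2)
    case (nonneg k) then show ?thesis using n by simp
  next
    case (nonpos k) then show ?thesis using n[of k] by simp
  qed
qed

lemma qvar_nz: "qvar \<noteq> 0" by (simp add: qvar_def Zero_fract_def eq_fract)

lemma Fract_X_pow: "Fract ([:0, 1:] ^ k) 1 = qvar ^ k"
proof (induction k)
  case (Suc k)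
  have "Fract ([:0, 1:] ^ Suc k) 1 = Fract [:0, 1:] 1 * Fract ([:0, 1:] ^ k) (1 :: int poly)"
    by (simp only: power_Suc mult_fract mult_1_right)
  then show ?case unfolding Suc by (simp add: qvar_def)
qed (simp add: One_fract_def)

text \<open>Clearing denominators turns \<open>p(q + 1/q)\<close> into an ordinary polynomial, which is compared
  with real evaluations of \<open>p\<close>.\<close>

lemma ev_clear_denominators:
  "\<exists>M P. qvar ^ M * ev p = Fract P 1 \<and>
     (\<forall>x::real. x \<noteq> 0 \<longrightarrow> eval_int x P = x ^ M * eval_int (x + inverse x) p)"
proof (induction p)
  case 0
  show ?case by (intro exI[of _ 0]) (simp add: eval_int_0 Zero_fract_def)
next
  case (pCons c p)
  then obtain M P where MP: "qvar ^ M * ev p = Fract P 1"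
    "\<And>x::real. x \<noteq> 0 \<Longrightarrow> eval_int x P = x ^ M * eval_int (x + inverse x) p" by blast
  let ?X = "[:0, 1:] :: int poly"
  note X = Fract_X_pow
  have "qvar ^ Suc M * ev (pCons c p) = of_int c * qvar ^ Suc M + (qvar^2 + 1) * (qvar ^ M * ev p)"
    using qvar_nz by (simp add: eval_int_pCons field_simps power2_eq_square)
  also have "\<dots> = Fract [:c:] 1 * Fract (?X ^ Suc M) 1 + (Fract (?X ^ 2) 1 + Fract 1 1) * Fract P 1"
    by (simp only: MP(1) of_int_fract X One_fract_def)
  also have "\<dots> = Fract ([:c:] * ?X ^ Suc M + (?X ^ 2 + 1) * P) 1"
    by (simp only: mult_fract Fract_add_1 mult_1_right)
  finally have 1: "qvar ^ Suc M * ev (pCons c p) = Fract ([:c:] * ?X ^ Suc M + (?X ^ 2 + 1) * P) 1" .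
  have 2: "eval_int x ([:c:] * ?X ^ Suc M + (?X ^ 2 + 1) * P) = x ^ Suc M * eval_int (x + inverse x) (pCons c p)"
    if x: "x \<noteq> 0" for x :: real
  proof -
    have Xe: "eval_int x (?X ^ k) = x ^ k" for k
      by (induction k) (simp_all add: eval_int_1 eval_int_mult eval_int_pCons eval_int_0 del: mult_pCons_left)
    have ce: "eval_int x [:c:] = of_int c" by (simp add: eval_int_pCons eval_int_0)
    have "eval_int x ([:c:] * ?X ^ Suc M + (?X ^ 2 + 1) * P)
        = of_int c * x ^ Suc M + (x^2 + 1) * (x ^ M * eval_int (x + inverse x) p)"
      by (simp only: eval_int_add eval_int_mult Xe ce eval_int_1 MP(2)[OF x])
    also have "\<dots> = x ^ Suc M * eval_int (x + inverse x) (pCons c p)"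
      using x by (simp add: eval_int_pCons field_simps power2_eq_square)
    finally show ?thesis .
  qed
  show ?case using 1 2 by blast
qed

lemma Fract_eq_0: "Fract (P :: int poly) 1 = 0 \<Longrightarrow> P = 0"
  by (simp add: Zero_fract_def eq_fract)

text \<open>Evaluated at a real \<open>x > 1\<close> and at \<open>1/x\<close>, where
  \<open>x + 1/x\<close> is the same, the relation yields two equations whose difference is
  \<open>(x - 1/x) b = 0\<close>. Infinitely many values of \<open>x + 1/x\<close> then force both
  polynomials to vanish.\<close>

lemma ev_independent:
  assumes "ev a + qvar * ev b = 0" shows "a = 0" "b = 0"
proof -
  obtain M P where MP: "qvar ^ M * ev a = Fract P 1"
    "\<And>x::real. x \<noteq> 0 \<Longrightarrow> eval_int x P = x ^ M * eval_int (x + inverse x) a"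
    using ev_clear_denominators by blast
  obtain N Q where NQ: "qvar ^ N * ev b = Fract Q 1"
    "\<And>x::real. x \<noteq> 0 \<Longrightarrow> eval_int x Q = x ^ N * eval_int (x + inverse x) b"
    using ev_clear_denominators by blast
  let ?X = "[:0, 1:] :: int poly"
  note X = Fract_X_pow
  have "0 = qvar ^ (M + N) * (ev a + qvar * ev b)" using assms by simp
  also have "\<dots> = qvar ^ N * (qvar ^ M * ev a) + qvar ^ Suc M * (qvar ^ N * ev b)"
    by (simp add: algebra_simps power_add)
  also have "\<dots> = qvar ^ N * Fract P 1 + qvar ^ Suc M * Fract Q 1" by (simp only: MP(1) NQ(1))
  also have "\<dots> = Fract (?X ^ N * P + ?X ^ Suc M * Q) 1"
    by (simp only: X[symmetric] mult_fract Fract_add_1 mult_1_right)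
  finally have z: "?X ^ N * P + ?X ^ Suc M * Q = 0" by (intro Fract_eq_0) simp
  have E: "eval_int (x + inverse x) a + x * eval_int (x + inverse x) b = 0" if x: "x \<noteq> 0" for x :: real
  proof -
    have Xe: "eval_int x (?X ^ k) = x ^ k" for k
      by (induction k) (simp_all add: eval_int_1 eval_int_mult eval_int_pCons eval_int_0 del: mult_pCons_left)
    have "0 = eval_int x (?X ^ N * P + ?X ^ Suc M * Q)" unfolding z by (simp add: eval_int_0)
    also have "\<dots> = x ^ N * (x ^ M * eval_int (x + inverse x) a) + x ^ Suc M * (x ^ N * eval_int (x + inverse x) b)"
      by (simp only: eval_int_add eval_int_mult Xe MP(2)[OF x] NQ(2)[OF x])
    also have "\<dots> = x ^ (M + N) * (eval_int (x + inverse x) a + x * eval_int (x + inverse x) b)"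
      by (simp add: algebra_simps power_add)
    finally show ?thesis using x by simp
  qed
  have B: "eval_int (x + inverse x) b = 0" if x: "x > 1" for x :: real
  proof -
    have "inverse x < x" using x by (metis inverse_less_1_iff less_trans zero_less_one)
    moreover have "eval_int (x + inverse x) a + inverse x * eval_int (x + inverse x) b = 0"
      using E[of "inverse x"] x by (simp add: add.commute)
    then have "x * eval_int (x + inverse x) b = inverse x * eval_int (x + inverse x) b"
      using E[of x] x by linarith
    ultimately show ?thesis by simp
  qed
  have A: "eval_int (x + inverse x) a = 0" if x: "x > 1" for x :: real
    using E[of x] B[OF x] x by simp
  have inj: "inj_on (\<lambda>x::real. x + inverse x) {1<..}"
  proof (rule inj_onI)
    fix x y :: real assume xy: "x \<in> {1<..}" "y \<in> {1<..}" "x + inverse x = y + inverse y"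
    then have "(x - y) * (x * y - 1) = 0" by (simp add: field_simps)
    moreover have "x * y > 1" using xy by (simp add: less_1_mult)
    ultimately show "x = y" by simp
  qed
  have inf: "infinite ((\<lambda>x::real. x + inverse x) ` {1<..})"
    using inj by (simp add: finite_image_iff infinite_Ioi)
  have zero: "p = 0" if "\<And>x::real. x > 1 \<Longrightarrow> eval_int (x + inverse x) p = 0" for p
  proof (rule ccontr)
    assume "p \<noteq> 0"
    then have "map_poly (of_int :: int \<Rightarrow> real) p \<noteq> 0" by (simp add: map_poly_eq_0_iff)
    then have "finite {y. poly (map_poly (of_int :: int \<Rightarrow> real) p) y = 0}" by (rule poly_roots_finite)
    moreover have "(\<lambda>x::real. x + inverse x) ` {1<..} \<subseteq> {y. poly (map_poly (of_int :: int \<Rightarrow> real) p) y = 0}"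
      using that by (auto simp: eval_int_def)
    ultimately show False using inf finite_subset by blast
  qed
  show "b = 0" by (rule zero[OF B])
  show "a = 0" by (rule zero[OF A])
qed

lemma ev_eq_0: "ev a = 0 \<Longrightarrow> a = 0"
  using ev_independent(1)[of a 0] by (simp add: eval_int_0)

lemma ev_inject: "ev a = ev b \<Longrightarrow> a = b"
  using ev_eq_0[of "a - b"] by (simp add: eval_int_diff)

section \<open>Quantum integers as polynomials in delta\<close>

definition delta :: "int poly" where "delta = [:0, 1:]"

text \<open>For \<open>n > 0\<close>, the Chebyshev polynomial of the second kind of degree
  \<open>n - 1\<close>, evaluated at \<open>\<delta> / 2\<close>.\<close>

fun chebU :: "nat \<Rightarrow> int poly" where
  "chebU 0 = 0"
| "chebU (Suc 0) = 1"
| "chebU (Suc (Suc n)) = delta * chebU (Suc n) - chebU n"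

lemma ev_delta: "ev delta = qvar + inverse qvar"
  by (simp add: delta_def eval_int_pCons eval_int_0)

lemma qvar_inverse: "qvar * inverse qvar = 1" using qvar_nz by simp

lemma qvar_sub_inverse_nz: "qvar - inverse qvar \<noteq> 0"
proof
  assume "qvar - inverse qvar = 0"
  then have "qvar * qvar = 1" using qvar_inverse by simp
  then show False by (simp add: qvar_def One_fract_def eq_fract one_pCons)
qed

lemma ev_chebU: "ev (chebU n) = qint n"
proof (induction n rule: chebU.induct)
  case (3 n)
  let ?q = qvar and ?p = "inverse qvar"
  have pq: "?p * (?q * x) = x" "?q * (?p * x) = x" for x using qvar_nz by simp_all
  have "ev (chebU (Suc (Suc n))) = (?q + ?p) * qint (Suc n) - qint n"
    unfolding chebU.simps(3) eval_int_diff eval_int_mult ev_delta 3 ..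
  also have "\<dots> = qint (Suc (Suc n))"
    unfolding qint_def times_divide_eq_right diff_divide_distrib[symmetric]
    by (simp add: algebra_simps pq)
  finally show ?case .
qed (use qvar_sub_inverse_nz in \<open>simp_all add: eval_int_0 eval_int_1 qint_def\<close>)

text \<open>The specialisation \<open>q = 1\<close>, where quantum integers become ordinary ones. It
  shows that they do not vanish.\<close>

lemma poly_chebU_2: "poly (chebU n) 2 = int n"
  by (induction n rule: chebU.induct) (simp_all add: delta_def)

lemma chebU_nz: "n > 0 \<Longrightarrow> chebU n \<noteq> 0"
  using poly_chebU_2[of n] by auto

lemma qint_nz: "n > 0 \<Longrightarrow> qint n \<noteq> 0"
  using chebU_nz ev_eq_0 ev_chebU by metis

lemma chebU_add: "chebU (Suc (a + b)) = chebU (Suc a) * chebU (Suc b) - chebU a * chebU b"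
proof (induction a rule: chebU.induct)
  case (3 n)
  have "chebU (Suc (Suc (Suc n) + b)) = delta * chebU (Suc (Suc n + b)) - chebU (Suc (n + b))" by simp
  also have "\<dots> = chebU (Suc b) * (delta * chebU (Suc (Suc n)) - chebU (Suc n))
      - (delta * chebU (Suc n) - chebU n) * chebU b"
    unfolding 3 by (simp only: algebra_simps)
  finally show ?case by (simp only: chebU.simps mult.commute)
qed simp_all

text \<open>A determinant of two solutions of the recurrence does not change when both are shifted,
  because the recurrence has determinant 1; the value is read off at \<open>k = 0\<close>. For
  Fibonacci numbers this is d'Ocagne's identity.\<close>

lemma chebU_docagne: "chebU (Suc k + r) * chebU (Suc k) - chebU k * chebU (Suc (Suc k + r)) = chebU (Suc r)"
proof (induction k)
  case (Suc k)
  then show ?case by (simp add: algebra_simps)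
qed simp

section \<open>Quantum binomial coefficients as polynomials in delta\<close>

definition qfact :: "nat \<Rightarrow> int poly fract" where
  "qfact n = (\<Prod>i=1..n. qint i)"

lemma qfact_Suc: "qfact (Suc n) = qint (Suc n) * qfact n" by (simp add: qfact_def mult.commute)
lemma qfact_0: "qfact 0 = 1" by (simp add: qfact_def)
lemma qfact_nz: "qfact n \<noteq> 0" by (simp add: qfact_def qint_nz)

text \<open>The coefficients of the Pascal rule become polynomials in \<open>\<delta>\<close> when its powers of \<open>q\<close> are
  expanded in the basis \<open>1, q\<close> of \<open>\<int>[q, 1/q]\<close> over \<open>\<int>[\<delta>]\<close>: the coefficient of \<open>q\<close> cancels. The case
  \<open>n = k\<close> is separate because \<open>chebU\<close> does not represent \<open>[-1] = -1\<close>.\<close>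

fun qbin :: "nat \<Rightarrow> nat \<Rightarrow> int poly" where
  "qbin n 0 = 1"
| "qbin 0 (Suc k) = 0"
| "qbin (Suc n) (Suc k) = (if n = k then 1 else chebU (Suc (Suc k)) * qbin n (Suc k) - chebU (n - Suc k) * qbin n k)"

text \<open>After clearing the factorials the recursion of \<open>qbin\<close> amounts to
  \<open>[n + 1] = [a + 2] [b + 1] - [a + 1] [b]\<close> for \<open>n = a + b + 1\<close>, an
  instance of \<open>chebU_add\<close>.\<close>

lemma ev_qbin: "ev (qbin (k + r) k) = qfact (k + r) / (qfact k * qfact r)"
proof (induction "k + r" arbitrary: k r)
  case 0
  then show ?case by (simp add: eval_int_1 qfact_0)
next
  case (Suc n)
  show ?case
  proof (cases "k = 0 \<or> r = 0")
    case True
    then show ?thesis using Suc(2) by (cases k) (auto simp: eval_int_1 qfact_0 qfact_nz)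
  next
    case False
    then obtain a b where ab: "k = Suc a" "r = Suc b" by (metis not0_implies_Suc)
    then have n: "n = Suc (a + b)" using Suc(2) by simp
    have 1: "ev (qbin n (Suc a)) = qfact n / (qfact (Suc a) * qfact b)" using Suc(1)[of "Suc a" b] n by simp
    have 2: "ev (qbin n a) = qfact n / (qfact a * qfact (Suc b))" using Suc(1)[of a "Suc b"] n by simp
    have "ev (chebU (Suc (Suc a + b))) = ev (chebU (Suc (Suc a)) * chebU (Suc b) - chebU (Suc a) * chebU b)"
      by (simp only: chebU_add)
    then have 3: "qint (Suc n) = qint (Suc (Suc a)) * qint (Suc b) - qint (Suc a) * qint b"
      by (simp only: n eval_int_diff eval_int_mult ev_chebU plus_nat.simps)
    have "qbin (k + r) k = chebU (Suc (Suc a)) * qbin n (Suc a) - chebU b * qbin n a"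
      by (simp add: ab n)
    then have "ev (qbin (k + r) k) = qint (Suc (Suc a)) * (qfact n / (qfact (Suc a) * qfact b))
        - qint b * (qfact n / (qfact a * qfact (Suc b)))"
      by (simp only: eval_int_diff eval_int_mult ev_chebU 1 2)
    also have "\<dots> = qfact n * (qint (Suc (Suc a)) * qint (Suc b) - qint (Suc a) * qint b) / (qfact (Suc a) * qfact (Suc b))"
      using qfact_nz[of a] qfact_nz[of b] qint_nz[of "Suc a"] qint_nz[of "Suc b"]
      by (simp add: qfact_Suc field_simps)
    also have "\<dots> = qfact (k + r) / (qfact k * qfact r)"
      unfolding 3[symmetric] by (simp add: ab n qfact_Suc mult.commute)
    finally show ?thesis .
  qed
qed

lemma qbin_self: "qbin n n = 1"
  by (cases n) auto

text \<open>This and \<open>qbin_pascal_add\<close> are the coefficients of \<open>q\<close> and of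
  \<open>1\<close> in the Pascal rule of \<open>rho_pascal\<close>, expanded by
  \<open>q^(m + 1) = [m + 1] q - [m]\<close>. They are proved in the fraction field, where
  factorials are invertible, and pulled back by injectivity of \<open>ev\<close>, so that
  \<open>h\<close> can be applied.\<close>

lemma qbin_pascal_mult:
  "chebU (Suc k) * qbin (Suc (k + r)) (Suc k) = chebU (Suc (k + r)) * qbin (k + r) k"
proof (rule ev_inject)
  have "ev (qbin (Suc k + r) (Suc k)) = qfact (Suc k + r) / (qfact (Suc k) * qfact r)" by (rule ev_qbin)
  then show "ev (chebU (Suc k) * qbin (Suc (k + r)) (Suc k)) = ev (chebU (Suc (k + r)) * qbin (k + r) k)"
    using qint_nz[of "Suc k"] by (simp add: eval_int_mult ev_chebU ev_qbin qfact_Suc)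
qed

lemma qbin_pascal_add:
  assumes "Suc k \<le> n"
  shows "chebU n * qbin n k = qbin n (Suc k) + chebU k * qbin (Suc n) (Suc k)"
proof (rule ev_inject)
  obtain r where n: "n = Suc (k + r)" using assms by (metis add_Suc less_eqE)
  have 1: "ev (qbin n k) = qfact n / (qfact k * qfact (Suc r))" using ev_qbin[of k "Suc r"] n by simp
  have 2: "ev (qbin n (Suc k)) = qfact n / (qfact (Suc k) * qfact r)" using ev_qbin[of "Suc k" r] n by simp
  have 3: "ev (qbin (Suc n) (Suc k)) = qfact (Suc n) / (qfact (Suc k) * qfact (Suc r))"
    using ev_qbin[of "Suc k" "Suc r"] n by simp
  have "ev (chebU (Suc k + r) * chebU (Suc k) - chebU k * chebU (Suc (Suc k + r))) = ev (chebU (Suc r))"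
    by (simp only: chebU_docagne)
  then have 4: "qint n * qint (Suc k) = qint (Suc r) + qint k * qint (Suc n)"
    by (simp only: eval_int_diff eval_int_mult ev_chebU plus_nat.simps n[symmetric] diff_eq_eq)
  have nz: "qfact k \<noteq> 0" "qfact r \<noteq> 0" "qint (Suc k) \<noteq> 0" "qint (Suc r) \<noteq> 0"
    by (simp_all add: qfact_nz qint_nz)
  have "ev (chebU n * qbin n k) = (qint n * qint (Suc k)) * (qfact n / (qfact (Suc k) * qfact (Suc r)))"
    using nz by (simp add: eval_int_mult ev_chebU 1 qfact_Suc)
  also have "\<dots> = ev (qbin n (Suc k) + chebU k * qbin (Suc n) (Suc k))"
    unfolding 4 using nz
    by (simp del: qbin.simps add: eval_int_mult eval_int_add ev_chebU 2 3 qfact_Suc[of r] qfact_Suc[of n] distrib_right add_divide_distrib)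
  finally show "ev (chebU n * qbin n k) = ev (qbin n (Suc k) + chebU k * qbin (Suc n) (Suc k))" .
qed

lemma qbinom_eq_qbin:
  assumes "k \<le> n" shows "qbinom n k = qbin n k"
proof -
  obtain r where n: "n = k + r" using assms le_Suc_ex by blast
  have "(\<Prod>i<k. qint (n - i)) * qfact (n - k) = qfact n"
    using assms
  proof (induction k)
    case (Suc k)
    then have "n - k = Suc (n - Suc k)" by simp
    then have "qfact (n - k) = qint (n - k) * qfact (n - Suc k)" by (metis qfact_Suc)
    then show ?case using Suc by (simp add: mult.assoc)
  qed simp
  then have P: "(\<Prod>i<k. qint (n - i)) = qfact n / qfact (n - k)"
    using qfact_nz[of "n - k"] by (simp add: field_simps)
  have "(\<Prod>i=1..k. qint i) = qfact k" by (simp only: qfact_def)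
  then have "(\<Prod>i<k. qint (n - i)) / (\<Prod>i=1..k. qint i) = qfact n / (qfact k * qfact (n - k))"
    unfolding P by (simp add: mult.commute)
  then have e: "(\<Prod>i<k. qint (n - i)) / (\<Prod>i=1..k. qint i) = ev (qbin n k)"
    using ev_qbin[of k r] n by simp
  show ?thesis
    unfolding qbinom_def e eval_int_def[symmetric]
    by (rule the_equality) (auto dest: ev_inject)
qed

lemma qsum_qint: "qsum qvar (Suc m) = qvar ^ m * qint (Suc m)"
proof -
  have nz: "qvar^2 - 1 \<noteq> 0"
    using qvar_sub_inverse_nz qvar_nz by (auto simp: field_simps power2_eq_square)
  have "(qvar^2 - 1) * (qvar ^ m * qint (Suc m)) = qvar ^ (2 * Suc m) - 1"
  proof -
    have e: "qvar * (qvar - inverse qvar) = qvar^2 - 1"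
      using qvar_nz by (simp add: right_diff_distrib power2_eq_square)
    have "qint (Suc m) * (qvar - inverse qvar) = qvar ^ Suc m - inverse qvar ^ Suc m"
      using qvar_sub_inverse_nz by (simp add: qint_def)
    then have "qvar ^ Suc m * (qint (Suc m) * (qvar - inverse qvar)) = qvar ^ Suc m * qvar ^ Suc m - (qvar * inverse qvar) ^ Suc m"
      by (simp only: right_diff_distrib power_mult_distrib)
    moreover have "qvar ^ Suc m * (qint (Suc m) * (qvar - inverse qvar)) = (qvar^2 - 1) * (qvar ^ m * qint (Suc m))"
      unfolding e[symmetric] by (simp add: ac_simps)
    ultimately show ?thesis unfolding qvar_inverse by (simp only: power_add[symmetric] mult_2 power_one)
  qed
  then have "(qvar^2 - 1) * qsum qvar (Suc m) = (qvar^2 - 1) * (qvar ^ m * qint (Suc m))"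
    by (simp only: qsum_closed)
  then show ?thesis using nz by simp
qed

lemma qsum_qvar_nz: "j > 0 \<Longrightarrow> qsum qvar j \<noteq> 0"
  using qsum_qint qint_nz qvar_nz by (cases j) auto

section \<open>The ring obtained by adjoining q\<close>

text \<open>The identity bent onto the line: the bottom points come first, the top points follow
  from right to left, and the strands become nested arcs.\<close>

definition idNC :: "nat \<Rightarrow> nat set set" where
  "idNC n = (\<lambda>i. {i, 2 * n - 1 - i}) ` {..<n}"

lemma idNC_in_NC: "idNC n \<in> NC {..<2 * n}"
proof (rule NC_I)
  show "disjoint (idNC n)"
  proof (rule disjointI)
    fix a b assume "a \<in> idNC n" "b \<in> idNC n" "a \<noteq> b"
    then obtain i j where ij: "i < n" "j < n" "a = {i, 2 * n - 1 - i}" "b = {j, 2 * n - 1 - j}"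
      unfolding idNC_def by blast
    then have "i \<noteq> j" using \<open>a \<noteq> b\<close> by auto
    then show "a \<inter> b = {}" using ij by auto
  qed
  show "card e = 2" if "e \<in> idNC n" for e using that by (auto simp: idNC_def card_insert_if)
  show "\<Union>(idNC n) = {..<2 * n}"
  proof
    show "{..<2 * n} \<subseteq> \<Union>(idNC n)"
    proof
      fix x assume x: "x \<in> {..<2 * n}"
      show "x \<in> \<Union>(idNC n)"
      proof (cases "x < n")
        case True then show ?thesis by (auto simp: idNC_def)
      next
        case False
        then have "2 * n - 1 - x < n" "x = 2 * n - 1 - (2 * n - 1 - x)" using x by auto
        then show ?thesis unfolding idNC_def by blast
      qed
    qed
  qed (auto simp: idNC_def)
  show "noncross (idNC n)" unfolding noncross_def
  proof (intro ballI impI)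
    fix e f a b c d
    assume *: "e \<in> idNC n" "f \<in> idNC n" "e \<noteq> f" "a \<in> e" "b \<in> e" "c \<in> f" "d \<in> f"
    obtain i where i: "i < n" "e = {i, 2 * n - 1 - i}" using *(1) unfolding idNC_def by blast
    obtain j where j: "j < n" "f = {j, 2 * n - 1 - j}" using *(2) unfolding idNC_def by blast
    note ij = i(1) j(1) i(2) j(2)
    then have "i \<noteq> j" using *(3) by auto
    then consider "i < j" | "j < i" by linarith
    then show "separates a b c = separates a b d"
      using *(4-7) ij by cases (auto simp: separates_def)
  qed
qed

lemma openers_idNC: "openers (idNC n) = {..<n}"
proof -
  have "Min {i, 2 * n - 1 - i} = i" if "i < n" for i using that by (simp add: min_def)
  then have "openers (idNC n) = id ` {..<n}" unfolding idNC_def image_image by (intro image_cong) auto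
  then show ?thesis by simp
qed

text \<open>Without an arc inside the lower half, its \<open>n\<close> points are all left ends.
  There are only \<open>n\<close> left ends altogether, and they determine the matching.\<close>

lemma eq_idNC_or_arc_below:
  assumes D: "D \<in> NC {..<2 * n}" and ne: "D \<noteq> idNC n"
  shows "\<exists>e\<in>D. e \<subseteq> {..<n}"
proof (rule ccontr)
  assume *: "\<not> (\<exists>e\<in>D. e \<subseteq> {..<n})"
  have "{..<n} \<subseteq> openers D"
  proof
    fix i assume i: "i \<in> {..<n}"
    then have "i \<in> {..<2 * n}" by simp
    then obtain j where j: "{i, j} \<in> D" by (rule NC_partner[OF D])
    then have "\<not> {i, j} \<subseteq> {..<n}" using * by blast
    then have "Min {i, j} = i" using i by auto
    then show "i \<in> openers D" using j by (metis imageI)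
  qed
  moreover have "card (openers D) = n"
  proof -
    have "2 * n = 2 * card ({..<2 * n} \<inter> openers D)" using balanced_card[OF D _ balanced_openers[OF D]] by simp
    moreover have "{..<2 * n} \<inter> openers D = openers D" using openers_subset[OF D] by blast
    ultimately show ?thesis by simp
  qed
  moreover have "finite (openers D)" using NC_finite[OF _ D] by simp
  ultimately have "openers D = {..<n}" by (metis card_lessThan card_subset_eq)
  then have "D = idNC n" using openers_inject[OF _ D idNC_in_NC] openers_idNC by simp
  then show False using ne by simp
qed

lemma adjacent_arc_below:
  assumes D: "D \<in> NC {..<m}" and e: "e \<in> D" "e \<subseteq> {l..<u}" "u \<le> m"
  obtains i where "l \<le> i" "Suc i < u" "{i, Suc i} \<in> D"
proof -
  obtain x y where xy: "e = {x, y}" "x < y" using NC_arc[OF D e(1)] .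
  then have "{x..y} \<subseteq> {..<m}" using e by auto
  then obtain i where "x \<le> i" "i < y" "{i, Suc i} \<in> D"
    using NC_adjacent_arc_between[OF D, of x y] e(1) xy by auto
  then show ?thesis using that[of i] e xy by auto
qed

text \<open>The case \<open>Suc j = n\<close> is left out because this pair consists of the
  rightmost bottom point and the rightmost top point. The sum is the coefficient of \<open>G\<close>
  after contraction at \<open>j\<close> and \<open>Suc j\<close>.\<close>

definition null_contractions :: "'a::{comm_ring, comm_monoid_mult} \<Rightarrow> nat \<Rightarrow> (nat set set \<Rightarrow> 'a) \<Rightarrow> bool" where
  "null_contractions d n c \<longleftrightarrow> (\<forall>j G. Suc j < 2 * n \<longrightarrow> Suc j \<noteq> n \<longrightarrow>
     (\<Sum>D\<in>{D \<in> NC {..<2 * n}. merge j (Suc j) D = G}. if {j, Suc j} \<in> D then - d * c D else c D) = 0)"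

section \<open>The action of q on pairs\<close>

locale delta_image =
  fixes h :: "int poly \<Rightarrow> 'a::{comm_ring, comm_monoid_mult}"
  assumes h_add: "h (p + q) = h p + h q"
    and h_mult: "h (p * q) = h p * h q"
    and h_one: "h 1 = 1"
begin

lemma h_0: "h 0 = 0" using h_add[of 0 0] by simp

lemma h_uminus: "h (- p) = - h p"
  using h_add[of p "- p"] h_0 by (simp add: eq_neg_iff_add_eq_0 add.commute)

lemma h_diff: "h (p - q) = h p - h q"
  using h_add[of p "- q"] h_uminus by simp

lemma h_sum: "h (sum f X) = (\<Sum>i\<in>X. h (f i))"
  by (induction X rule: infinite_finite_induct) (simp_all add: h_0 h_add)

abbreviation d :: 'a where "d \<equiv> h delta"

text \<open>Pairs \<open>(x, y)\<close> stand for \<open>x + y q\<close> in \<open>R[q]/(q\<^sup>2 - \<delta> q + 1)\<close>, and \<open>rho\<close> is multiplication by \<open>q\<close>.\<close>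

definition rho :: "'a \<times> 'a \<Rightarrow> 'a \<times> 'a" where "rho m = (- snd m, fst m + d * snd m)"
definition rho_inv :: "'a \<times> 'a \<Rightarrow> 'a \<times> 'a" where "rho_inv m = (d * fst m + snd m, - fst m)"
definition scal :: "'a \<Rightarrow> 'a \<times> 'a \<Rightarrow> 'a \<times> 'a" where "scal r m = (r * fst m, r * snd m)"

lemma rho_add: "rho (x + y) = rho x + rho y"
  by (simp add: rho_def prod_eq_iff algebra_simps)
lemma rho_uminus: "rho (- x) = - rho x"
  by (simp add: rho_def prod_eq_iff algebra_simps)
lemma rho_0: "rho 0 = 0" by (simp add: rho_def prod_eq_iff)
lemma rho_inv_rho: "rho_inv (rho x) = x"
  by (simp add: rho_def rho_inv_def prod_eq_iff algebra_simps)
lemma rho_rho: "rho (rho x) = scal d (rho x) - x"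
  by (simp add: rho_def scal_def prod_eq_iff algebra_simps)
lemma rho_scal: "rho (scal r x) = scal r (rho x)"
  by (simp add: rho_def scal_def prod_eq_iff algebra_simps)
lemma rho_inv_scal: "rho_inv (scal r x) = scal r (rho_inv x)"
  by (simp add: rho_inv_def scal_def prod_eq_iff algebra_simps)

lemma rho_pow_add: "(rho ^^ k) (x + y) = (rho ^^ k) x + (rho ^^ k) y"
  by (induction k) (simp_all add: rho_add)
lemma rho_pow_uminus: "(rho ^^ k) (- x) = - (rho ^^ k) x"
  by (induction k) (simp_all add: rho_uminus)
lemma rho_pow_0: "(rho ^^ k) 0 = 0"
  by (induction k) (simp_all add: rho_0)
lemma rho_pow_sum: "(rho ^^ k) (sum f X) = (\<Sum>i\<in>X. (rho ^^ k) (f i))"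
  by (induction X rule: infinite_finite_induct) (simp_all add: rho_pow_0 rho_pow_add)
lemma rho_pow_scal: "(rho ^^ k) (scal r x) = scal r ((rho ^^ k) x)"
  by (induction k) (simp_all add: rho_scal)
lemma rho_inv_pow_scal: "(rho_inv ^^ k) (scal r x) = scal r ((rho_inv ^^ k) x)"
  by (induction k) (simp_all add: rho_inv_scal)
lemma rho_inv_pow_rho_pow: "(rho_inv ^^ k) ((rho ^^ k) x) = x"
  by (induction k) (simp_all add: funpow_swap1[of rho_inv] rho_inv_rho)

text \<open>Both sides obey the recurrence coming from \<open>q^2 = \<delta> q - 1\<close>. This
  reduces identities between powers of \<open>q\<close> to identities in \<open>R\<close>.\<close>

lemma rho_pow_Suc: "(rho ^^ Suc m) x = scal (h (chebU (Suc m))) (rho x) - scal (h (chebU m)) x"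
proof (induction m)
  case 0
  show ?case by (simp add: h_0 h_one scal_def prod_eq_iff)
next
  case (Suc m)
  have "(rho ^^ Suc (Suc m)) x = rho (scal (h (chebU (Suc m))) (rho x) - scal (h (chebU m)) x)"
    using Suc by simp
  also have "\<dots> = scal (h (chebU (Suc m))) (scal d (rho x) - x) - scal (h (chebU m)) (rho x)"
    unfolding diff_conv_add_uminus rho_add rho_uminus rho_scal rho_rho ..
  also have "\<dots> = scal (h (chebU (Suc (Suc m)))) (rho x) - scal (h (chebU (Suc m))) x"
    by (simp add: scal_def prod_eq_iff h_mult h_diff algebra_simps)
  finally show ?case .
qed

lemma rho_pascal:
  assumes "Suc k \<le> n"
  shows "scal (h (qbin n (Suc k))) x + (rho ^^ Suc n) (scal (h (qbin n k)) x)
    = (rho ^^ Suc k) (scal (h (qbin (Suc n) (Suc k))) x)"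
proof -
  obtain r where n: "n = k + r" using assms by (metis add_leD2 le_Suc_ex plus_1_eq_Suc)
  have 1: "h (chebU (Suc k)) * h (qbin (Suc n) (Suc k)) = h (chebU (Suc n)) * h (qbin n k)"
    using qbin_pascal_mult[of k r] unfolding n h_mult[symmetric] by simp
  have 2: "h (chebU n) * h (qbin n k) = h (qbin n (Suc k)) + h (chebU k) * h (qbin (Suc n) (Suc k))"
    using qbin_pascal_add[OF assms] unfolding h_mult[symmetric] h_add[symmetric] by simp
  have 3: "scal a (scal b y) = scal (a * b) y" for a b y by (simp add: scal_def mult.assoc)
  have 4: "scal (a + b) y = scal a y + scal b y" for a b y by (simp add: scal_def algebra_simps)
  show ?thesis unfolding rho_pow_Suc rho_scal 3 1 2 4 by (simp add: algebra_simps)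
qed

text \<open>By symmetry \<open>\<psi> s\<close> is \<open>\<psi> {..<k}\<close> times
  \<open>q\<close> to the power \<open>\<Sum>s - \<Sum>{..<k}\<close>, so the sum is governed by the
  sum of \<open>q^(2 \<Sum>s)\<close> over the \<open>k\<close>-subsets, a Gaussian binomial
  coefficient. The proof distinguishes whether the largest element occurs and applies
  \<open>rho_pascal\<close>.\<close>

lemma sum_symmetric:
  "k \<le> n \<Longrightarrow> (\<And>j s. Suc j < n \<Longrightarrow> s \<subseteq> {..<n} \<Longrightarrow> j \<notin> s \<Longrightarrow> Suc j \<notin> s \<Longrightarrow>
      \<psi> (insert (Suc j) s) = rho (\<psi> (insert j s))) \<Longrightarrow>
   (\<Sum>s\<in>{s. s \<subseteq> {..<n} \<and> card s = k}. (rho ^^ \<Sum>s) (\<psi> s))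
     = (rho ^^ (\<Sum>{..<k} + k * (n - k))) (scal (h (qbin n k)) (\<psi> {..<k}))"
proof (induction n arbitrary: k \<psi>)
  case 0
  have "{s. s \<subseteq> {..<0} \<and> card s = k} = {{} :: nat set}" using 0 by auto
  then show ?case using 0 by (simp add: h_one scal_def)
next
  case (Suc n)
  note sym = Suc.prems(2)
  consider "k = 0" | "k = Suc n" | k' where "k = Suc k'" "k \<le> n"
    using Suc.prems(1) by (metis le_Suc_eq not0_implies_Suc)
  then show ?case
  proof cases
    case 1
    have "{s. s \<subseteq> {..<Suc n} \<and> card s = k} = {{}}"
      using 1 by (auto dest: finite_subset[OF _ finite_lessThan])
    then show ?thesis using 1 by (simp add: h_one scal_def)
  next
    case 2
    have "s = {..<Suc n}" if "s \<subseteq> {..<Suc n}" "card s = k" for s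
      by (rule card_subset_eq) (use that 2 in auto)
    then have "{s. s \<subseteq> {..<Suc n} \<and> card s = k} = {{..<Suc n}}" using 2 by auto
    then show ?thesis using 2 by (simp add: h_one scal_def qbin_self)
  next
    case (3 k')
    define A where "A = {s. s \<subseteq> {..<n} \<and> card s = k}"
    define B where "B = {s. s \<subseteq> {..<n} \<and> card s = k'}"
    have fin: "finite s" if "s \<subseteq> {..<n}" for s using that finite_subset by blast
    have split: "{s. s \<subseteq> {..<Suc n} \<and> card s = k} = A \<union> insert n ` B"
    proof (intro equalityI subsetI)
      fix s assume "s \<in> {s. s \<subseteq> {..<Suc n} \<and> card s = k}"
      then have s: "s \<subseteq> {..<Suc n}" "card s = k" by auto
      show "s \<in> A \<union> insert n ` B" using s(1)
      proof (cases rule: subset_lessThan_Suc_cases)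
        case 1 then show ?thesis using s by (simp add: A_def)
      next
        case (2 s') then show ?thesis using s 3 by (auto simp: B_def)
      qed
    next
      fix s assume "s \<in> A \<union> insert n ` B"
      then consider "s \<in> A" | s' where "s' \<in> B" "s = insert n s'" by blast
      then show "s \<in> {s. s \<subseteq> {..<Suc n} \<and> card s = k}"
      proof cases
        case 1 then show ?thesis by (auto simp: A_def)
      next
        case 2
        then have "n \<notin> s'" "finite s'" using fin by (auto simp: B_def)
        then show ?thesis using 2 3 by (auto simp: B_def)
      qed
    qed
    have nB: "n \<notin> s" if "s \<in> B" for s using that by (auto simp: B_def)
    have fA: "finite A" "finite B" unfolding A_def B_def by (auto intro: finite_subset[of _ "Pow {..<n}"])
    have inj: "inj_on (insert n) B" by (rule inj_onI) (metis nB insert_ident)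
    have disj: "A \<inter> insert n ` B = {}" by (auto simp: A_def)
    have sumA: "(\<Sum>s\<in>A. (rho ^^ \<Sum>s) (\<psi> s)) = (rho ^^ (\<Sum>{..<k} + k * (n - k))) (scal (h (qbin n k)) (\<psi> {..<k}))"
      unfolding A_def by (rule Suc.IH[OF 3(2)]) (rule sym; auto)
    have IHB: "(\<Sum>s\<in>B. (rho ^^ \<Sum>s) (\<psi> (insert n s)))
        = (rho ^^ (\<Sum>{..<k'} + k' * (n - k'))) (scal (h (qbin n k')) (\<psi> (insert n {..<k'})))"
      unfolding B_def
    proof (rule Suc.IH)
      fix j s assume s: "Suc j < n" "s \<subseteq> {..<n}" "j \<notin> s" "Suc j \<notin> s"
      have "\<psi> (insert (Suc j) (insert n s)) = rho (\<psi> (insert j (insert n s)))"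
        by (rule sym) (use s in auto)
      then show "\<psi> (insert n (insert (Suc j) s)) = rho (\<psi> (insert n (insert j s)))"
        by (simp add: insert_commute)
    qed (use 3 in simp)
    \<comment> \<open>The largest element is brought down to the free place \<open>k'\<close>, with
      one factor \<open>q\<close> for each step.\<close>
    have move: "\<psi> (insert i {..<k'}) = (rho ^^ (i - k')) (\<psi> (insert k' {..<k'}))" if "k' \<le> i" "i \<le> n" for i
      using that
    proof (induction i rule: dec_induct)
      case (step i)
      have "\<psi> (insert (Suc i) {..<k'}) = rho (\<psi> (insert i {..<k'}))" by (rule sym) (use step in auto)
      then show ?case using step by (simp add: Suc_diff_le)
    qed simp
    have k: "insert k' {..<k'} = {..<k}" using 3 by auto
    let ?X = "\<psi> {..<k}"
    have mv: "\<psi> (insert n {..<k'}) = (rho ^^ (n - k')) ?X" using move[of n] 3 unfolding k by simp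
    have "(\<Sum>s\<in>insert n ` B. (rho ^^ \<Sum>s) (\<psi> s)) = (\<Sum>s\<in>B. (rho ^^ \<Sum>(insert n s)) (\<psi> (insert n s)))"
      using sum.reindex[OF inj] by simp
    also have "\<dots> = (\<Sum>s\<in>B. (rho ^^ n) ((rho ^^ \<Sum>s) (\<psi> (insert n s))))"
    proof (rule sum.cong[OF refl])
      fix s assume "s \<in> B"
      then have "\<Sum>(insert n s) = n + \<Sum>s" using nB fin by (simp add: B_def)
      then show "(rho ^^ \<Sum>(insert n s)) (\<psi> (insert n s)) = (rho ^^ n) ((rho ^^ \<Sum>s) (\<psi> (insert n s)))"
        by (simp add: funpow_add)
    qed
    also have "\<dots> = (rho ^^ n) ((rho ^^ (\<Sum>{..<k'} + k' * (n - k'))) ((rho ^^ (n - k')) (scal (h (qbin n k')) ?X)))"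
      unfolding rho_pow_sum[symmetric] IHB mv rho_pow_scal ..
    also have "\<dots> = (rho ^^ (n + (\<Sum>{..<k'} + k' * (n - k') + (n - k')))) (scal (h (qbin n k')) ?X)"
      by (simp only: funpow_add comp_apply)
    also have "n + (\<Sum>{..<k'} + k' * (n - k') + (n - k')) = (\<Sum>{..<k} + k * (n - k)) + Suc n"
    proof -
      obtain r where "n = Suc k' + r" using 3 le_Suc_ex by blast
      then show ?thesis using 3 by (simp add: algebra_simps)
    qed
    also have "(rho ^^ ((\<Sum>{..<k} + k * (n - k)) + Suc n)) (scal (h (qbin n k')) ?X)
        = (rho ^^ (\<Sum>{..<k} + k * (n - k))) ((rho ^^ Suc n) (scal (h (qbin n k')) ?X))"
      by (simp only: funpow_add comp_apply)
    finally have sumB: "(\<Sum>s\<in>insert n ` B. (rho ^^ \<Sum>s) (\<psi> s))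
        = (rho ^^ (\<Sum>{..<k} + k * (n - k))) ((rho ^^ Suc n) (scal (h (qbin n k')) ?X))" .
    have "(\<Sum>s\<in>{s. s \<subseteq> {..<Suc n} \<and> card s = k}. (rho ^^ \<Sum>s) (\<psi> s))
       = (rho ^^ (\<Sum>{..<k} + k * (n - k))) (scal (h (qbin n k)) ?X + (rho ^^ Suc n) (scal (h (qbin n k')) ?X))"
      unfolding split rho_pow_add
      by (subst sum.union_disjoint) (use fA disj sumA sumB in auto)
    also have "\<dots> = (rho ^^ (\<Sum>{..<k} + k * (n - k))) ((rho ^^ k) (scal (h (qbin (Suc n) k)) ?X))"
      using rho_pascal[of k' n ?X] 3 by simp
    also have "\<dots> = (rho ^^ ((\<Sum>{..<k} + k * (n - k)) + k)) (scal (h (qbin (Suc n) k)) ?X)"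
      by (simp only: funpow_add comp_apply)
    also have "(\<Sum>{..<k} + k * (n - k)) + k = \<Sum>{..<k} + k * (Suc n - k)"
    proof -
      obtain r where "n = k + r" using 3 le_Suc_ex by blast
      then show ?thesis by (simp add: Suc_diff_le)
    qed
    finally show ?thesis .
  qed
qed

end

section \<open>Null contractions and binomial coefficients\<close>

lemma idNC_balanced_iff:
  "balanced s (idNC n) \<longleftrightarrow> (\<forall>i<n. (i \<in> s) \<noteq> (2 * n - 1 - i \<in> s))"
proof -
  have "card ({i, 2 * n - 1 - i} \<inter> s) = 1 \<longleftrightarrow> (i \<in> s) \<noteq> (2 * n - 1 - i \<in> s)" if "i < n" for i
    using card_pair_Int_eq_1[of i "2 * n - 1 - i" s] that by simp
  then show ?thesis by (auto simp: balanced_def idNC_def)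
qed

context delta_image
begin

definition T :: "'a \<times> 'a \<Rightarrow> 'a \<times> 'a" where "T m = - rho m"

sublocale M: loop_module T "\<lambda>m. scal (- d) m"
proof
  show "T (x + y) = T x + T y" for x y by (simp add: T_def rho_add)
  show "T (T x) + x = T (scal (- d) x)" for x
    by (simp add: T_def rho_uminus rho_rho rho_scal) (simp add: scal_def prod_eq_iff)
qed

lemma T_pow: "(T ^^ k) x = (rho ^^ k) x \<or> (T ^^ k) x = - (rho ^^ k) x"
  by (induction k) (auto simp: T_def rho_uminus)

text \<open>Exchanging \<open>i\<close> and \<open>Suc i\<close> in \<open>s\<close> pairs up the
  nonzero terms. If \<open>i\<close> is up, the arc contributes \<open>-q\<close>; if
  \<open>Suc i\<close> is up, the exponent \<open>\<Sum>s\<close> contributes an additional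
  \<open>q\<close>.\<close>

lemma wt_adjacent_arc_cancel:
  assumes D: "D \<in> NC {..<2 * n}" and i: "{i, Suc i} \<in> D" "Suc i < n"
    and s2: "s2 \<inter> {..<n} = {}"
  shows "(\<Sum>s\<in>{s. s \<subseteq> {..<n} \<and> card s = k}. (rho ^^ \<Sum>s) (M.wt D (s \<union> s2) x)) = 0"
proof -
  define S where "S = {s. s \<subseteq> {..<n} \<and> card s = k}"
  define D' where "D' = D - {{i, Suc i}}"
  have D': "D' \<in> NC ({..<2 * n} - {i, Suc i})" unfolding D'_def using NC_remove[OF D i(1)] .
  have fD': "finite D'" using NC_finite[OF _ D'] by simp
  have new: "{i, Suc i} \<notin> D'" by (simp add: D'_def)
  have Deq: "D = insert {i, Suc i} D'" using i by (auto simp: D'_def)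
  have fS: "finite S" unfolding S_def by (auto intro: finite_subset[of _ "Pow {..<n}"])
  have fin: "finite s" if "s \<in> S" for s using that finite_subset by (auto simp: S_def)
  have out: "i \<notin> s2" "Suc i \<notin> s2" using s2 i(2) by auto
  let ?w = "\<lambda>s. M.wt D' (s \<union> s2) x"
  have W: "M.wt D (s \<union> s2) x = (if (i \<in> s) = (Suc i \<in> s) then 0 else if i \<in> s then T (?w s) else ?w s)" for s
    unfolding Deq using M.wt_insert[OF fD' new, of "s \<union> s2" x] out by (simp add: min_def)
  define S1 where "S1 = {s \<in> S. i \<in> s \<and> Suc i \<notin> s}"
  define S2 where "S2 = {s \<in> S. i \<notin> s \<and> Suc i \<in> s}"
  let ?f = "\<lambda>s. (rho ^^ \<Sum>s) (M.wt D (s \<union> s2) x)"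
  let ?g = "\<lambda>s. insert (Suc i) (s - {i})"
  have "sum ?f S = sum ?f (S1 \<union> S2)"
    by (rule sum.mono_neutral_right) (use fS W in \<open>auto simp: S1_def S2_def rho_pow_0\<close>)
  also have "\<dots> = sum ?f S1 + sum ?f S2"
    by (rule sum.union_disjoint) (use fS in \<open>auto simp: S1_def S2_def\<close>)
  also have "sum ?f S2 = sum (\<lambda>s. ?f (?g s)) S1"
  proof (rule sum.reindex_bij_witness[of _ "?g" "\<lambda>s. insert i (s - {Suc i})"])
    fix s assume s: "s \<in> S1"
    then have c: "card (?g s) = card s" using card.remove[of s i] fin[of s] by (simp add: S1_def)
    show "insert i (?g s - {Suc i}) = s" using s by (auto simp: S1_def)
    show "?g s \<in> S2" using s c i(2) by (auto simp: S1_def S2_def S_def)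
  next
    fix s assume s: "s \<in> S2"
    then have c: "card (insert i (s - {Suc i})) = card s" using card.remove[of s "Suc i"] fin[of s] by (simp add: S2_def)
    show "?g (insert i (s - {Suc i})) = s" using s by (auto simp: S2_def)
    show "insert i (s - {Suc i}) \<in> S1" using s c i(2) by (auto simp: S1_def S2_def S_def)
    then show "?f (?g (insert i (s - {Suc i}))) = ?f s" using \<open>?g (insert i (s - {Suc i})) = s\<close> by simp
  qed
  also have "sum ?f S1 + sum (\<lambda>s. ?f (?g s)) S1 = (\<Sum>s\<in>S1. ?f s + ?f (?g s))"
    by (simp add: sum.distrib)
  also have "\<dots> = 0"
  proof (rule sum.neutral, rule ballI)
    fix s assume s: "s \<in> S1"
    then have m: "i \<in> s" "Suc i \<notin> s" "finite s" using fin by (auto simp: S1_def)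
    have "\<Sum>(?g s) = Suc (\<Sum>s)" using m sum.remove[OF m(3,1), of "\<lambda>x. x"] by simp
    moreover have "?w (?g s) = ?w s" by (rule M.wt_cong[OF D']) auto
    ultimately show "?f s + ?f (?g s) = 0"
      using W[of s] W[of "?g s"] m by (simp add: T_def rho_pow_uminus funpow_swap1)
  qed
  finally show ?thesis by (simp add: S_def)
qed

lemma unit_of_null_contractions:
  assumes c: "null_contractions d n c" "c (idNC n) = 1" and k: "k \<le> n"
  shows "h (qbin n k) dvd 1"
proof -
  define A where "A = {..<2 * n}"
  define c' where "c' D = (c D, 0 :: 'a)" for D
  define \<phi> where "\<phi> = M.vec A c'"
  \<comment> \<open>The top signs are chosen so that the nested arcs of \<open>idNC n\<close> admit
    \<open>{..<k}\<close> as the only balanced choice of bottom signs.\<close>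
  define s2 where "s2 = {n..<2 * n - k}"
  define S where "S = {s. s \<subseteq> {..<n} \<and> card s = k}"
  \<comment> \<open>A vanishing contraction says that the vector pairs to zero with the cap, that
    is, moving an up sign from \<open>j\<close> to \<open>Suc j\<close> multiplies the value by
    \<open>q\<close>.\<close>
  have sym: "\<phi> (insert (Suc j) s) = rho (\<phi> (insert j s))"
    if j: "Suc j < 2 * n" "Suc j \<noteq> n" "j \<notin> s" "Suc j \<notin> s" for j s
  proof -
    have "M.contraction A j (Suc j) c' G = 0" for G
    proof -
      have "M.contraction A j (Suc j) c' G =
        (\<Sum>D\<in>{D \<in> NC A. merge j (Suc j) D = G}. (if {j, Suc j} \<in> D then - d * c D else c D, 0))"
        unfolding M.contraction_def by (rule sum.cong) (auto simp: c'_def scal_def)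
      also have "\<dots> = ((\<Sum>D\<in>{D \<in> NC A. merge j (Suc j) D = G}. if {j, Suc j} \<in> D then - d * c D else c D), 0)"
        by (simp add: prod_eq_iff fst_sum snd_sum)
      also have "\<dots> = 0" using c(1) j unfolding null_contractions_def A_def by (simp add: zero_prod_def)
      finally show ?thesis .
    qed
    then have "M.vec (A - {j, Suc j}) (M.contraction A j (Suc j) c') s = 0"
      unfolding M.vec_def by (simp add: M.wt_0)
    moreover have "\<phi> (insert (Suc j) s) + T (\<phi> (insert j s)) = T (M.vec (A - {j, Suc j}) (M.contraction A j (Suc j) c') s)"
      unfolding \<phi>_def by (rule M.vec_contract) (use j in \<open>auto simp: A_def\<close>)
    ultimately show ?thesis by (simp add: M.T_0) (simp add: T_def)
  qed
  have s2: "s2 \<inter> {..<n} = {}" by (auto simp: s2_def)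
  define \<psi> where "\<psi> s = \<phi> (s \<union> s2)" for s
  have L: "(\<Sum>s\<in>S. (rho ^^ \<Sum>s) (\<psi> s)) = (rho ^^ (\<Sum>{..<k} + k * (n - k))) (scal (h (qbin n k)) (\<psi> {..<k}))"
    unfolding S_def
  proof (rule sum_symmetric[OF k])
    fix j s assume s: "Suc j < n" "s \<subseteq> {..<n}" "j \<notin> s" "Suc j \<notin> s"
    show "\<psi> (insert (Suc j) s) = rho (\<psi> (insert j s))"
      unfolding \<psi>_def Un_insert_left by (rule sym) (use s s2 in auto)
  qed
  have fA: "finite (NC A)" by (simp add: A_def finite_NC)
  have id: "idNC n \<in> NC A" unfolding A_def by (rule idNC_in_NC)
  \<comment> \<open>The same sum computed diagram by diagram. Every diagram other than the identity
    has an arc between neighbours in the lower half and cancels.\<close>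
  have "(\<Sum>s\<in>S. (rho ^^ \<Sum>s) (\<psi> s)) = (\<Sum>D\<in>NC A. \<Sum>s\<in>S. (rho ^^ \<Sum>s) (M.wt D (s \<union> s2) (c' D)))"
    unfolding \<psi>_def \<phi>_def M.vec_def rho_pow_sum by (rule sum.swap)
  also have "\<dots> = (\<Sum>D\<in>{idNC n}. \<Sum>s\<in>S. (rho ^^ \<Sum>s) (M.wt D (s \<union> s2) (c' D)))"
  proof (rule sum.mono_neutral_right[OF fA])
    show "\<forall>D\<in>NC A - {idNC n}. (\<Sum>s\<in>S. (rho ^^ \<Sum>s) (M.wt D (s \<union> s2) (c' D))) = 0"
    proof
      fix D assume D: "D \<in> NC A - {idNC n}"
      then have D1: "D \<in> NC {..<2 * n}" by (simp add: A_def)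
      obtain e where e: "e \<in> D" "e \<subseteq> {..<n}" using eq_idNC_or_arc_below[OF D1] D by auto
      obtain i where "Suc i < n" "{i, Suc i} \<in> D"
        using adjacent_arc_below[OF D1 e(1), of 0 n] e(2) by (auto simp: atLeast0LessThan)
      then show "(\<Sum>s\<in>S. (rho ^^ \<Sum>s) (M.wt D (s \<union> s2) (c' D))) = 0"
        unfolding S_def using wt_adjacent_arc_cancel[OF D1 _ _ s2] by blast
    qed
  qed (use id in auto)
  also have "\<dots> = (\<Sum>s\<in>{{..<k}}. (rho ^^ \<Sum>s) (M.wt (idNC n) (s \<union> s2) (1, 0)))"
  proof -
    have "(\<Sum>s\<in>S. (rho ^^ \<Sum>s) (M.wt (idNC n) (s \<union> s2) (1, 0)))
        = (\<Sum>s\<in>{{..<k}}. (rho ^^ \<Sum>s) (M.wt (idNC n) (s \<union> s2) (1, 0)))"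
    proof (rule sum.mono_neutral_right)
      show "finite S" unfolding S_def by (auto intro: finite_subset[of _ "Pow {..<n}"])
      show "{{..<k}} \<subseteq> S" using k by (auto simp: S_def)
      show "\<forall>s\<in>S - {{..<k}}. (rho ^^ \<Sum>s) (M.wt (idNC n) (s \<union> s2) (1, 0)) = 0"
      proof
        fix s assume s: "s \<in> S - {{..<k}}"
        have "\<not> balanced (s \<union> s2) (idNC n)"
        proof
          assume b: "balanced (s \<union> s2) (idNC n)"
          have "i \<in> s \<longleftrightarrow> i < k" if i: "i < n" for i
          proof -
            have "2 * n - 1 - i \<notin> s" using s i by (auto simp: S_def)
            moreover have "i \<notin> s2" using i by (simp add: s2_def)
            moreover have "2 * n - 1 - i \<in> s2 \<longleftrightarrow> k \<le> i" using i k by (auto simp: s2_def)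
            ultimately show ?thesis using b[unfolded idNC_balanced_iff, rule_format, OF i] by auto
          qed
          then have "s = {..<k}" using s k by (auto simp: S_def)
          then show False using s by simp
        qed
        then show "(rho ^^ \<Sum>s) (M.wt (idNC n) (s \<union> s2) (1, 0)) = 0"
          by (simp add: M.wt_def rho_pow_0)
      qed
    qed
    then show ?thesis using c(2) by (simp add: c'_def)
  qed
  also have "\<dots> = (rho ^^ \<Sum>{..<k}) (M.wt (idNC n) ({..<k} \<union> s2) (1, 0))" by simp
  also have "M.wt (idNC n) ({..<k} \<union> s2) (1, 0) = (T ^^ ups ({..<k} \<union> s2) (idNC n)) (1, 0)"
  proof -
    have "balanced ({..<k} \<union> s2) (idNC n)" using k by (auto simp: idNC_balanced_iff s2_def)
    then show ?thesis by (simp add: M.wt_def)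
  qed
  finally have E: "(rho ^^ (\<Sum>{..<k} + k * (n - k))) (scal (h (qbin n k)) (\<psi> {..<k}))
      = (rho ^^ \<Sum>{..<k}) ((T ^^ ups ({..<k} \<union> s2) (idNC n)) (1, 0))"
    using L by simp
  let ?u = "ups ({..<k} \<union> s2) (idNC n)"
  \<comment> \<open>The sign is moved into \<open>R\<close>, so that only powers of
    \<open>rho\<close> are left, which \<open>rho_inv\<close> undoes.\<close>
  obtain \<epsilon> :: 'a where \<epsilon>: "\<epsilon> * \<epsilon> = 1" and T: "(T ^^ ?u) (1, 0) = (rho ^^ ?u) (\<epsilon>, 0)"
  proof -
    have m: "(- 1 :: 'a, 0 :: 'a) = - (1, 0)" by (simp add: prod_eq_iff)
    have "(T ^^ ?u) (1, 0) = (rho ^^ ?u) (1, 0) \<or> (T ^^ ?u) (1, 0) = (rho ^^ ?u) (- 1, 0)"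
      unfolding m rho_pow_uminus by (rule T_pow)
    then show ?thesis using that[of 1] that[of "- 1"] by auto
  qed
  define f where "f = \<Sum>{..<k} + ?u"
  define m where "m = (rho_inv ^^ f) ((rho ^^ (\<Sum>{..<k} + k * (n - k))) (\<psi> {..<k}))"
  have "scal (h (qbin n k)) m = (rho_inv ^^ f) ((rho ^^ (\<Sum>{..<k} + k * (n - k))) (scal (h (qbin n k)) (\<psi> {..<k})))"
    unfolding m_def by (simp add: rho_pow_scal rho_inv_pow_scal)
  also have "\<dots> = (rho_inv ^^ f) ((rho ^^ f) (\<epsilon>, 0))" unfolding E T f_def by (simp add: funpow_add)
  \<comment> \<open>\<open>scal\<close> acts on each component separately, so the first component is
    an equation in \<open>R\<close>.\<close>
  finally have "h (qbin n k) * fst m = \<epsilon>" by (simp add: rho_inv_pow_rho_pow scal_def prod_eq_iff)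
  then have "h (qbin n k) * (fst m * \<epsilon>) = 1" using \<epsilon> by (simp add: mult.assoc[symmetric])
  then show ?thesis by (metis dvdI)
qed

end

section \<open>The lattice spanned by 1 and q over the polynomials in delta\<close>

text \<open>This is the ring of Laurent polynomials in \<open>q\<close>. Being stable under division
  by \<open>q\<close>, it can serve as \<open>L\<close> in
  \<open>kwt_triangular_solve\<close>.\<close>

definition qlattice :: "int poly fract set" where
  "qlattice = {x. \<exists>a b. x = ev a + qvar * ev b}"

lemma qlattice_ev: "ev a \<in> qlattice"
  unfolding qlattice_def by (rule CollectI, rule exI[of _ a], rule exI[of _ 0]) (simp add: eval_int_0)

lemma qlattice_diff: "x \<in> qlattice \<Longrightarrow> y \<in> qlattice \<Longrightarrow> x - y \<in> qlattice"
proof -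
  assume "x \<in> qlattice" "y \<in> qlattice"
  then obtain a b a' b' where "x = ev a + qvar * ev b" "y = ev a' + qvar * ev b'"
    by (auto simp: qlattice_def)
  then have "x - y = ev (a - a') + qvar * ev (b - b')" by (simp add: eval_int_diff algebra_simps)
  then show ?thesis by (auto simp: qlattice_def)
qed

lemma qlattice_mult_qvar: "x \<in> qlattice \<Longrightarrow> qvar * x \<in> qlattice"
proof -
  assume "x \<in> qlattice"
  then obtain a b where x: "x = ev a + qvar * ev b" by (auto simp: qlattice_def)
  have "qvar * qvar * y = qvar * (qvar + inverse qvar) * y - y" for y
    using qvar_nz by (simp add: algebra_simps)
  then have "qvar * x = ev (- b) + qvar * ev (a + delta * b)"
    unfolding x eval_int_uminus eval_int_add eval_int_mult ev_delta
    by (simp add: distrib_left mult.assoc[symmetric])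
  then show ?thesis unfolding qlattice_def by blast
qed

lemma qlattice_div_qvar: "x \<in> qlattice \<Longrightarrow> x / qvar \<in> qlattice"
proof -
  assume "x \<in> qlattice"
  then obtain a b where x: "x = ev a + qvar * ev b" by (auto simp: qlattice_def)
  have "x / qvar = ev (b + delta * a) + qvar * ev (- a)"
    unfolding x eval_int_uminus eval_int_add eval_int_mult ev_delta
    using qvar_nz by (simp add: field_simps)
  then show ?thesis unfolding qlattice_def by blast
qed

interpretation K: loop_module "\<lambda>x. - (qvar * x)" "\<lambda>x. - (ev delta * x)"
  by unfold_locales (use qvar_nz in \<open>simp_all add: ev_delta algebra_simps\<close>)

lemma K_wt: "K.wt D s x = x * kwt qvar D s"
proof -
  have "((\<lambda>x. - (qvar * x)) ^^ k) x = x * (- qvar) ^ k" for k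
    by (induction k) (simp_all add: algebra_simps)
  then show ?thesis by (simp add: K.wt_def kwt_def)
qed

text \<open>The raising operator kills the block vector if these coefficients are proportional to
  \<open>(-q\<^sup>n\<^sup>+\<^sup>1)\<^sup>k\<close> divided by the \<open>k\<close>-th binomial coefficient. The other binomial coefficients
  clear the denominators, and the last factor makes the identity diagram appear with coefficient
  \<open>\<Prod>j\<le>n. qbin n j\<close>.\<close>

definition block_coeff :: "nat \<Rightarrow> nat \<Rightarrow> int poly fract" where
  "block_coeff n k = ev (\<Prod>j\<in>{..n} - {k}. qbin n j) * (- (qvar ^ Suc n)) ^ k / qvar ^ \<Sum>{n..<2 * n}"

text \<open>Up to the common factor \<open>P\<close> the binomial coefficients match by
  \<open>qbin n (k - 1) [n - k + 1] = qbin n k [k]\<close>. The powers of \<open>q\<close> match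
  because \<open>n + 1 + r = 2 (r + 1) + j\<close> for \<open>n = j + 1 + r\<close>; this is the
  origin of the base \<open>-q^(n + 1)\<close> in \<open>block_coeff\<close>.\<close>

lemma qsum_recurrence:
  assumes "0 < k" "k \<le> n"
  shows "block_coeff n k * qsum qvar (Suc n - k)
    + block_coeff n (k - 1) * qvar ^ (2 * (Suc n - k)) * qsum qvar k = 0"
proof -
  obtain j where k: "k = Suc j" using assms by (metis Suc_pred)
  obtain r where n: "n = Suc j + r" using assms k le_Suc_ex by blast
  define P where "P = ev (\<Prod>i\<in>{..n} - {j} - {k}. qbin n i)"
  have "(\<Prod>i\<in>{..n} - {k}. qbin n i) = qbin n j * (\<Prod>i\<in>{..n} - {k} - {j}. qbin n i)"
    by (rule prod.remove) (use assms k in auto)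
  moreover have "{..n} - {k} - {j} = {..n} - {j} - {k}" by auto
  ultimately have Pk: "ev (\<Prod>i\<in>{..n} - {k}. qbin n i) = ev (qbin n j) * P"
    unfolding P_def by (simp add: eval_int_mult)
  have "(\<Prod>i\<in>{..n} - {j}. qbin n i) = qbin n k * (\<Prod>i\<in>{..n} - {j} - {k}. qbin n i)"
    by (rule prod.remove) (use assms k in auto)
  then have Pj: "ev (\<Prod>i\<in>{..n} - {j}. qbin n i) = ev (qbin n k) * P"
    unfolding P_def by (simp add: eval_int_mult)
  have "ev (qbin n j) = qfact n / (qfact j * qfact (Suc r))" using ev_qbin[of j "Suc r"] n by simp
  moreover have "ev (qbin n k) = qfact n / (qfact k * qfact r)" using ev_qbin[of k r] n k by simp
  ultimately have R: "ev (qbin n j) * qint (Suc r) = ev (qbin n k) * qint k"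
    using qint_nz[of "Suc j"] qint_nz[of "Suc r"] by (simp add: k qfact_Suc field_simps)
  have s: "Suc n - k = Suc r" "k - 1 = j" using n k by auto
  have F: "(- (qvar ^ Suc n)) ^ k * qvar ^ r = - ((- (qvar ^ Suc n)) ^ j * qvar ^ (2 * Suc r) * qvar ^ j)"
    by (simp add: k n power_add[symmetric] mult.assoc mult.left_commute) (simp add: algebra_simps mult_2_right)
  have "ev (qbin n j) * P * (- (qvar ^ Suc n)) ^ k * (qvar ^ r * qint (Suc r))
     + ev (qbin n k) * P * (- (qvar ^ Suc n)) ^ j * qvar ^ (2 * Suc r) * (qvar ^ j * qint k)
     = ((- (qvar ^ Suc n)) ^ k * qvar ^ r) * P * (ev (qbin n j) * qint (Suc r))
     + ((- (qvar ^ Suc n)) ^ j * qvar ^ (2 * Suc r) * qvar ^ j) * P * (ev (qbin n k) * qint k)"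
    by (simp only: mult_ac)
  also have "\<dots> = 0" by (simp only: R F mult_minus_left add.left_inverse)
  finally show ?thesis unfolding s block_coeff_def Pk Pj k[symmetric] qsum_qint[of r]
    using qsum_qint[of j] k by (simp add: add_divide_distrib[symmetric] field_simps)
qed

lemma block_coeff_mult_qlattice:
  assumes "k \<le> n" shows "block_coeff n k * qvar ^ m \<in> qlattice"
proof -
  have neg: "- x \<in> qlattice" if "x \<in> qlattice" for x
    using qlattice_diff[OF qlattice_ev[of 0] that] by (simp add: eval_int_0)
  have pow: "x * qvar ^ j \<in> qlattice" if "x \<in> qlattice" for x j
  proof (induction j)
    case (Suc j)
    then show ?case using qlattice_mult_qvar[of "x * qvar ^ j"] by (simp add: mult.left_commute)
  qed (use that in simp)
  have neg_pow: "x * (- (qvar ^ i)) ^ j \<in> qlattice" if "x \<in> qlattice" for x i j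
  proof (induction j)
    case (Suc j)
    then have "- (x * (- (qvar ^ i)) ^ j * qvar ^ i) \<in> qlattice" by (intro neg pow)
    then show ?case by (simp add: mult_ac)
  qed (use that in simp)
  have div: "x / qvar ^ j \<in> qlattice" if "x \<in> qlattice" for x j
  proof (induction j)
    case (Suc j)
    then show ?case using qlattice_div_qvar[of "x / qvar ^ j"] by (simp add: mult.commute)
  qed (use that in simp)
  show ?thesis unfolding block_coeff_def by (intro pow div neg_pow qlattice_ev)
qed

lemma K_vec: "K.vec A c s = (\<Sum>D\<in>NC A. c D * kwt qvar D s)"
  by (simp add: K.vec_def K_wt)

lemma integral_null_contractions:
  obtains a where "a (idNC n) = (\<Prod>j\<le>n. qbin n j)" "null_contractions delta n a"
proof -
  define A where "A = {..<2 * n}"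
  define t where "t s = block_coeff n (card (s \<inter> {..<n})) * qvar ^ \<Sum>s" for s
  have card_le: "card (s \<inter> {..<n}) \<le> n" for s
    using card_mono[of "{..<n}" "s \<inter> {..<n}"] by simp
  have "\<exists>c. (\<forall>D. c D \<in> qlattice) \<and>
      (\<forall>D\<in>NC A. (\<Sum>D'\<in>NC A. c D' * kwt qvar D' (openers D)) = t (openers D))"
  proof (rule kwt_triangular_solve)
    show "t (openers D) \<in> qlattice" for D unfolding t_def by (rule block_coeff_mult_qlattice[OF card_le])
    show "0 \<in> qlattice" using qlattice_ev[of 0] by (simp add: eval_int_0)
  qed (simp_all add: A_def qvar_nz qlattice_diff qlattice_mult_qvar qlattice_div_qvar)
  then obtain c where cL: "\<And>D. c D \<in> qlattice"
    and cS: "\<And>D. D \<in> NC A \<Longrightarrow> (\<Sum>D'\<in>NC A. c D' * kwt qvar D' (openers D)) = t (openers D)" by blast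
  \<comment> \<open>Both vectors are killed by the raising operator and agree on the openers of
    diagrams, and every ballot set of size \<open>n\<close> arises as such openers.\<close>
  have vt: "K.vec A c s = t s" if s: "s \<subseteq> A" "card s = n" for s
  proof -
    let ?v = "\<lambda>s. 1 * K.vec A c s + (- 1) * t s"
    have "?v s = 0"
    proof (rule raise_kernel_ballot[OF qvar_nz qsum_qvar_nz, where m = "2 * n" and p = n and \<phi> = ?v])
      fix u assume u: "u \<subseteq> {..<2 * n}" "card u = Suc n"
      have "raise qvar (K.vec A c) u = (\<Sum>D\<in>NC A. c D * raise qvar (kwt qvar D) u)"
        unfolding K_vec[abs_def] by (rule raise_sum)
      also have "\<dots> = 0" by (rule sum.neutral) (use raise_kwt[OF _ u(1), of _ qvar] in \<open>simp add: A_def\<close>)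
      finally have "raise qvar (K.vec A c) u = 0" .
      moreover have "raise qvar t u = 0"
        unfolding t_def[abs_def] by (rule raise_block_symmetric[OF u qsum_recurrence])
      ultimately show "raise qvar ?v u = 0" unfolding raise_linear by simp
    next
      fix u assume u: "u \<subseteq> {..<2 * n}" "card u = n" "\<forall>l\<le>2 * n. l \<le> 2 * card (u \<inter> {..<l})"
      have "ballot A u" unfolding ballot_def
      proof
        fix l
        show "card (A \<inter> {..<l}) \<le> 2 * card (u \<inter> {..<l})"
        proof (cases "l \<le> 2 * n")
          case True
          then have "A \<inter> {..<l} = {..<l}" by (auto simp: A_def)
          then show ?thesis using u(3) True by simp
        next
          case False
          then have "u \<inter> {..<l} = u" "A \<inter> {..<l} = A" using u(1) by (auto simp: A_def)
          then show ?thesis using u(2) by (simp add: A_def)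
        qed
      qed
      then obtain D where "D \<in> NC A" "openers D = u"
        using openers_surj[of A u] u by (auto simp: A_def)
      then show "?v u = 0" using cS[of D] by (simp add: K_vec)
    qed (use s in \<open>auto simp: A_def\<close>)
    then show ?thesis by simp
  qed
  have id: "idNC n \<in> NC A" unfolding A_def by (rule idNC_in_NC)
  \<comment> \<open>With all bottom signs down and all top signs up only the identity is balanced,
    and its weight is 1 because no left end is up.\<close>
  have c_id: "c (idNC n) = ev (\<Prod>j\<le>n. qbin n j)"
  proof -
    let ?s = "{n..<2 * n}"
    have "kwt qvar D ?s = 0" if D: "D \<in> NC A - {idNC n}" for D
    proof -
      obtain e where e: "e \<in> D" "e \<subseteq> {..<n}" using eq_idNC_or_arc_below[of D n] D by (auto simp: A_def)
      then have "e \<inter> ?s = {}" by auto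
      then have "\<not> balanced ?s D" using e(1) unfolding balanced_def by (metis card.empty zero_neq_one)
      then show ?thesis by (simp add: kwt_def)
    qed
    then have "K.vec A c ?s = (\<Sum>D\<in>{idNC n}. c D * kwt qvar D ?s)"
      unfolding K_vec by (intro sum.mono_neutral_right) (use id in \<open>auto simp: A_def finite_NC\<close>)
    also have "kwt qvar (idNC n) ?s = 1"
    proof -
      have b: "balanced ?s (idNC n)" by (auto simp: idNC_balanced_iff)
      have "Min e < n" if "e \<in> idNC n" for e
        using that openers_idNC[of n] by (metis imageI lessThan_iff)
      then have e: "{e \<in> idNC n. Min e \<in> ?s} = {}" by fastforce
      have "ups ?s (idNC n) = 0" unfolding ups_def e by simp
      with b show ?thesis by (simp add: kwt_def)
    qed
    then have "(\<Sum>D\<in>{idNC n}. c D * kwt qvar D ?s) = c (idNC n)" by simp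
    finally have "c (idNC n) = t ?s" using vt[of ?s] by (simp add: A_def subset_iff)
    also have "\<dots> = ev (\<Prod>j\<in>{..n} - {0}. qbin n j)"
    proof -
      have "?s \<inter> {..<n} = {}" by auto
      then show ?thesis using qvar_nz by (simp add: t_def block_coeff_def)
    qed
    also have "(\<Prod>j\<in>{..n} - {0}. qbin n j) = (\<Prod>j\<le>n. qbin n j)"
      using prod.remove[of "{..n}" 0 "qbin n"] by simp
    finally show ?thesis .
  qed
  \<comment> \<open>The vector of the contraction vanishes by the q-symmetry of \<open>t\<close>,
    and then its coefficients vanish by the independence of diagrams on the remaining
    points.\<close>
  have null: "K.contraction A j (Suc j) c G = 0" if j: "Suc j < 2 * n" "Suc j \<noteq> n" for j G
  proof (cases "G \<in> NC (A - {j, Suc j})")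
    case False
    have "merge j (Suc j) D \<noteq> G" if D: "D \<in> NC A" for D
      using NC_merge[OF D, of j "Suc j"] j False by (auto simp: A_def)
    then have e: "{D \<in> NC A. merge j (Suc j) D = G} = {}" by blast
    show ?thesis unfolding K.contraction_def e by simp
  next
    case True
    let ?A = "A - {j, Suc j}"
    show ?thesis
    proof (rule kwt_independent[OF _ qvar_nz _ True])
      fix H assume H: "H \<in> NC ?A"
      let ?s = "openers H"
      have sub: "?s \<subseteq> ?A" using openers_subset[OF H] .
      then have js: "j \<notin> ?s" "Suc j \<notin> ?s" "finite ?s" using finite_subset[OF sub] by (auto simp: A_def)
      have "card ?A = 2 * card (?A \<inter> ?s)" by (rule balanced_card[OF H _ balanced_openers[OF H]]) (simp add: A_def)
      moreover have "?A \<inter> ?s = ?s" using sub by blast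
      moreover have "card ?A = 2 * n - 2" using j by (simp add: A_def card_Diff_subset)
      ultimately have cs: "Suc (card ?s) = n" using j by simp
      have "K.vec A c (insert (Suc j) ?s) + - (qvar * K.vec A c (insert j ?s))
          = - (qvar * K.vec ?A (K.contraction A j (Suc j) c) ?s)"
        by (rule K.vec_contract) (use j js in \<open>auto simp: A_def\<close>)
      moreover have "K.vec A c (insert (Suc j) ?s) = t (insert (Suc j) ?s)" "K.vec A c (insert j ?s) = t (insert j ?s)"
      proof -
        have "insert (Suc j) ?s \<subseteq> A" "insert j ?s \<subseteq> A" using sub j(1) by (auto simp: A_def)
        moreover have "card (insert (Suc j) ?s) = n" "card (insert j ?s) = n" using cs js by simp_all
        ultimately show "K.vec A c (insert (Suc j) ?s) = t (insert (Suc j) ?s)"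
          "K.vec A c (insert j ?s) = t (insert j ?s)" using vt by blast+
      qed
      moreover have "t (insert (Suc j) ?s) = qvar * t (insert j ?s)"
      proof -
        have "insert (Suc j) ?s \<inter> {..<n} = (if j < n then insert (Suc j) (?s \<inter> {..<n}) else ?s \<inter> {..<n})"
          "insert j ?s \<inter> {..<n} = (if j < n then insert j (?s \<inter> {..<n}) else ?s \<inter> {..<n})"
          using j by auto
        then have "card (insert (Suc j) ?s \<inter> {..<n}) = card (insert j ?s \<inter> {..<n})" using js by simp
        then show ?thesis using js by (simp add: t_def)
      qed
      ultimately have "K.vec ?A (K.contraction A j (Suc j) c) ?s = 0" using qvar_nz by simp
      then show "(\<Sum>D'\<in>NC ?A. K.contraction A j (Suc j) c D' * kwt qvar D' ?s) = 0"
        by (simp add: K_vec)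
    qed (simp add: A_def)
  qed
  \<comment> \<open>The contraction equations have coefficients in \<open>\<int>[\<delta>]\<close>,
    so they hold separately for the components of \<open>1\<close> and \<open>q\<close>. The
    coefficient of the identity has no \<open>q\<close> component and is inherited by
    \<open>a\<close>.\<close>
  have "\<forall>D. \<exists>a b. c D = ev a + qvar * ev b" using cL by (auto simp: qlattice_def)
  from choice[OF this] obtain a where "\<forall>D. \<exists>b. c D = ev (a D) + qvar * ev b" by blast
  from choice[OF this] obtain b where ab: "\<And>D. c D = ev (a D) + qvar * ev (b D)" by blast
  have uniq: "x = y" if "ev x = ev y + qvar * ev z" for x y z
    using ev_independent(1)[of "y - x" z] that by (simp add: eval_int_diff)
  have "a (idNC n) = (\<Prod>j\<le>n. qbin n j)" using uniq[of _ "a (idNC n)"] ab[of "idNC n"] c_id by metis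
  moreover have "null_contractions delta n a" unfolding null_contractions_def
  proof (intro allI impI)
    fix j G assume j: "Suc j < 2 * n" "Suc j \<noteq> n"
    let ?X = "{D \<in> NC {..<2 * n}. merge j (Suc j) D = G}"
    let ?f = "\<lambda>a D. if {j, Suc j} \<in> D then - delta * a D else a D"
    have "0 = K.contraction A j (Suc j) c G" using null[OF j] by simp
    also have "\<dots> = (\<Sum>D\<in>?X. ev (?f a D) + qvar * ev (?f b D))"
      unfolding K.contraction_def A_def
      by (rule sum.cong) (simp_all add: ab eval_int_mult eval_int_uminus algebra_simps)
    also have "\<dots> = ev (\<Sum>D\<in>?X. ?f a D) + qvar * ev (\<Sum>D\<in>?X. ?f b D)"
      by (simp only: eval_int_sum sum.distrib sum_distrib_left)
    finally show "(\<Sum>D\<in>?X. ?f a D) = 0" by (rule ev_independent(1)[OF sym])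
  qed
  ultimately show ?thesis using that by blast
qed

context delta_image
begin

text \<open>The integral solution is mapped to \<open>R\<close> and divided by its coefficient at
  the identity, a product of units; the factor for \<open>k = n\<close> equals 1.\<close>

lemma null_contractions_of_units:
  assumes u: "\<And>k. k < n \<Longrightarrow> h (qbin n k) dvd 1"
  shows "\<exists>c. null_contractions d n c \<and> c (idNC n) = 1"
proof -
  obtain a where a: "a (idNC n) = (\<Prod>j\<le>n. qbin n j)" "null_contractions delta n a"
    by (rule integral_null_contractions)
  have "h (\<Prod>j\<in>X. qbin n j) dvd 1" if "finite X" "X \<subseteq> {..n}" for X
    using that
  proof (induction X rule: finite_induct)
    case (insert x X)
    have "h (qbin n x) dvd 1" using u[of x] insert by (cases "x = n") (auto simp: qbin_self h_one)
    then obtain y where "h (qbin n x) * y = 1" by (metis dvdE)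
    moreover obtain z where "h (\<Prod>j\<in>X. qbin n j) * z = 1" using insert by (metis dvdE insert_subset)
    ultimately have "h (\<Prod>j\<in>insert x X. qbin n j) * (y * z) = 1"
      using insert by (simp add: h_mult) (metis mult.assoc mult.commute mult_1_left)
    then show ?case by (metis dvdI)
  qed (simp add: h_one)
  then obtain v where v: "h (\<Prod>j\<le>n. qbin n j) * v = 1" by (metis dvdE finite_atMost subset_refl)
  define c where "c D = h (a D) * v" for D
  have "null_contractions d n c" unfolding null_contractions_def
  proof (intro allI impI)
    fix j G assume j: "Suc j < 2 * n" "Suc j \<noteq> n"
    let ?X = "{D \<in> NC {..<2 * n}. merge j (Suc j) D = G}"
    have "(\<Sum>D\<in>?X. if {j, Suc j} \<in> D then - d * c D else c D)
        = h (\<Sum>D\<in>?X. if {j, Suc j} \<in> D then - delta * a D else a D) * v"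
      unfolding h_sum sum_distrib_right
      by (rule sum.cong) (simp_all add: c_def h_mult h_uminus mult.assoc)
    also have "\<dots> = 0" using a(2) j unfolding null_contractions_def by (simp add: h_0)
    finally show "(\<Sum>D\<in>?X. if {j, Suc j} \<in> D then - d * c D else c D) = 0" .
  qed
  moreover have "c (idNC n) = 1" by (simp add: c_def a v)
  ultimately show ?thesis by blast
qed

end

section \<open>Diagrams as noncrossing matchings\<close>

primrec relabel :: "(nat \<Rightarrow> nat) \<Rightarrow> point \<Rightarrow> point" where
  "relabel \<phi> (Bot l) = Bot (\<phi> l)"
| "relabel \<phi> (Top l) = Top l"

definition through :: "(nat \<Rightarrow> nat) \<Rightarrow> nat set \<Rightarrow> point set set" where
  "through \<phi> L = (\<lambda>l. {Bot (\<phi> l), Top l}) ` L"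

text \<open>The strands merely prolong the arcs of \<open>E\<close> downwards, and the arcs of
  \<open>B\<close> do not reach the middle. Hence all components can be listed, and each of them
  meets the outer boundary.\<close>

lemma stack_through:
  assumes inj: "inj_on \<phi> L"
    and B: "disjoint B" "{} \<notin> B" "\<And>b p. b \<in> B \<Longrightarrow> p \<in> b \<Longrightarrow> \<exists>i. p = Bot i \<and> i \<notin> \<phi> ` L"
    and E: "disjoint E" "{} \<notin> E" "\<And>l. Bot l \<in> \<Union>E \<longleftrightarrow> l \<in> L"
  shows "stack (B \<union> through \<phi> L) E = B \<union> (`) (relabel \<phi>) ` E"
    and "loops (B \<union> through \<phi> L) E = 0"
proof -
  \<comment> \<open>\<open>ext e\<close> will be the component of the arc \<open>e\<close>: its own
    ends together with the lower ends of the strands attached to it.\<close>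
  define low where "low e = {Low (\<phi> l) |l. Bot l \<in> e}" for e
  define ext where "ext e = from_upper ` e \<union> low e" for e
  define G where "G = glued_edges (B \<union> through \<phi> L) E"
  have G: "f \<in> G \<longleftrightarrow> (\<exists>b\<in>B. f = from_lower ` b) \<or> (\<exists>l\<in>L. f = {Low (\<phi> l), Mid l}) \<or> (\<exists>e\<in>E. f = from_upper ` e)" for f
  proof -
    have "(`) from_lower ` (B \<union> through \<phi> L) = (`) from_lower ` B \<union> (\<lambda>l. {Low (\<phi> l), Mid l}) ` L"
      by (simp add: through_def image_Un image_image)
    then have "G = ((`) from_lower ` B \<union> (\<lambda>l. {Low (\<phi> l), Mid l}) ` L) \<union> (`) from_upper ` E"
      unfolding G_def glued_edges_def by simp
    then show ?thesis by (simp only: Un_iff image_iff disj_assoc)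
  qed
  have G_through: "{Low (\<phi> l), Mid l} \<in> G" if "l \<in> L" for l using G that by blast
  have G_up: "from_upper ` e \<in> G" if "e \<in> E" for e using G that by blast
  have up_Mid: "Mid l \<in> from_upper ` e \<longleftrightarrow> Bot l \<in> e" for l e
  proof -
    have "from_upper p = Mid l \<longleftrightarrow> p = Bot l" for p by (cases p) auto
    then show ?thesis by (metis imageE imageI)
  qed
  have up_Low: "Low l \<notin> from_upper ` e" for l e
  proof -
    have "from_upper p \<noteq> Low l" for p by (cases p) auto
    then show ?thesis by (metis imageE)
  qed
  have lowB: "\<exists>i. x = Low i \<and> i \<notin> \<phi> ` L" if "b \<in> B" "x \<in> from_lower ` b" for b x
    using B(3)[OF that(1)] that(2) by (metis from_lower.simps(1) imageE)
  have L: "l \<in> L" if "Bot l \<in> e" "e \<in> E" for l e using E(3) that by blast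
  have low_iff: "Low (\<phi> l) \<in> ext e \<longleftrightarrow> Bot l \<in> e" if "l \<in> L" "e \<in> E" for l e
  proof -
    have "Low (\<phi> l) \<in> ext e \<longleftrightarrow> (\<exists>l'. \<phi> l = \<phi> l' \<and> Bot l' \<in> e)"
      using up_Low by (auto simp: ext_def low_def)
    also have "\<dots> \<longleftrightarrow> Bot l \<in> e" using inj_onD[OF inj _ that(1) L[OF _ that(2)]] by blast
    finally show ?thesis .
  qed
  have Mid_iff: "Mid l \<in> ext e \<longleftrightarrow> Bot l \<in> e" for l e
    using up_Mid by (auto simp: ext_def low_def)
  have Low_ext: "i \<in> \<phi> ` L" if "Low i \<in> ext e" "e \<in> E" for i e
    using that up_Low L by (auto simp: ext_def low_def)
  have B_comp: "from_lower ` b \<in> comps G" if b: "b \<in> B" for b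
  proof (rule isolated_edge_in_comps)
    show "from_lower ` b \<in> G" using G[of "from_lower ` b"] b by blast
    show "from_lower ` b \<noteq> {}" using b B(2) by auto
    fix f assume f: "f \<in> G" "f \<inter> from_lower ` b \<noteq> {}"
    then obtain x where x: "x \<in> f" "x \<in> from_lower ` b" by blast
    obtain i where i: "x = Low i" "i \<notin> \<phi> ` L" using lowB[OF b x(2)] by blast
    have "\<not> (\<exists>l\<in>L. f = {Low (\<phi> l), Mid l})" using x(1) i by auto
    moreover have "\<not> (\<exists>e\<in>E. f = from_upper ` e)" using x(1) up_Low unfolding i(1) by blast
    ultimately have "\<exists>b'\<in>B. f = from_lower ` b'" using f(1)[unfolded G] by blast
    then obtain b' where b': "b' \<in> B" "f = from_lower ` b'" by blast
    obtain p p' where "p \<in> b" "p' \<in> b'" "from_lower p = from_lower p'" using x b' by auto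
    then have "p \<in> b \<inter> b'" using inj_from_lower by (metis IntI injD)
    then have "b = b'" using disjointD[OF B(1) b b'(1)] by blast
    then show "f = from_lower ` b" using b' by simp
  qed
  have E_comp: "ext e \<in> comps G" if e: "e \<in> E" for e
    unfolding comps_def
  proof (intro CollectI conjI allI impI)
    obtain p0 where p0: "p0 \<in> e" using E(2) e by (metis ex_in_conv)
    then show "ext e \<noteq> {}" by (auto simp: ext_def)
    show "ext e \<subseteq> \<Union>G"
    proof
      fix x assume "x \<in> ext e"
      then consider "x \<in> from_upper ` e" | l where "x = Low (\<phi> l)" "Bot l \<in> e" by (auto simp: ext_def low_def)
      then show "x \<in> \<Union>G"
      proof cases
        case 1 then show ?thesis using G_up[OF e] by blast
      next
        case 2
        then have "{Low (\<phi> l), Mid l} \<in> G" using G_through L[OF _ e] by simp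
        then show ?thesis using 2 by blast
      qed
    qed
    show "closed_in G (ext e)" unfolding closed_in_def
    proof (intro ballI impI)
      fix f assume f: "f \<in> G" "f \<inter> ext e \<noteq> {}"
      then obtain x where x: "x \<in> f" "x \<in> ext e" by blast
      from f(1)[unfolded G] consider b where "b \<in> B" "f = from_lower ` b"
        | l where "l \<in> L" "f = {Low (\<phi> l), Mid l}" | e' where "e' \<in> E" "f = from_upper ` e'" by blast
      then show "f \<subseteq> ext e"
      proof cases
        case 1
        then show ?thesis using lowB[OF 1(1)] x Low_ext[OF _ e] by metis
      next
        case 2
        then have "Bot l \<in> e" using x low_iff[OF 2(1) e] Mid_iff by auto
        then show ?thesis using 2 low_iff[OF 2(1) e] Mid_iff by auto
      next
        case 3
        have "x \<noteq> Low i" for i using x(1) 3(2) up_Low by metis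
        then have "x \<in> from_upper ` e" using x(2) by (auto simp: ext_def low_def)
        then obtain p where "p \<in> e" "p \<in> e'" using x(1) 3(2) inj_from_upper by (metis imageE injD)
        then have "e' = e" using disjointD[OF E(1) 3(1) e] by blast
        then show ?thesis using 3 by (auto simp: ext_def)
      qed
    qed
    fix C assume C: "C \<noteq> {}" "C \<subseteq> ext e" "closed_in G C"
    obtain x where x: "x \<in> C" using C(1) by blast
    have "\<exists>y\<in>from_upper ` e. y \<in> C"
    proof (cases "x \<in> from_upper ` e")
      case True then show ?thesis using x by blast
    next
      case False
      then obtain l where l: "x = Low (\<phi> l)" "Bot l \<in> e" using x C(2) by (auto simp: ext_def low_def)
      have "{Low (\<phi> l), Mid l} \<in> G" by (rule G_through[OF L[OF l(2) e]])
      then have "Mid l \<in> C" using closed_inD[OF C(3), of "{Low (\<phi> l), Mid l}" x "Mid l"] x l by simp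
      then show ?thesis using up_Mid l by blast
    qed
    moreover note G_up[OF e]
    ultimately have up: "from_upper ` e \<subseteq> C" using closed_inD[OF C(3)] by blast
    have "low e \<subseteq> C"
    proof
      fix y assume "y \<in> low e"
      then obtain l where l: "y = Low (\<phi> l)" "Bot l \<in> e" by (auto simp: low_def)
      have "{Low (\<phi> l), Mid l} \<in> G" by (rule G_through[OF L[OF l(2) e]])
      moreover have "Mid l \<in> C" using up up_Mid l by blast
      ultimately show "y \<in> C" using closed_inD[OF C(3), of "{Low (\<phi> l), Mid l}" "Mid l" y] l by simp
    qed
    then show "C = ext e" using up C(2) unfolding ext_def by blast
  qed
  have comps: "components (B \<union> through \<phi> L) E = (`) from_lower ` B \<union> ext ` E"
    unfolding components_eq_comps G_def[symmetric]
  proof (rule comps_eqI)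
    show "C \<in> comps G" if "C \<in> (`) from_lower ` B \<union> ext ` E" for C using that B_comp E_comp by blast
    show "\<Union>G \<subseteq> \<Union>((`) from_lower ` B \<union> ext ` E)"
    proof
      fix x assume "x \<in> \<Union>G"
      then obtain f where f: "f \<in> G" "x \<in> f" by blast
      from f(1)[unfolded G] consider b where "b \<in> B" "f = from_lower ` b"
        | l where "l \<in> L" "f = {Low (\<phi> l), Mid l}" | e where "e \<in> E" "f = from_upper ` e" by blast
      then show "x \<in> \<Union>((`) from_lower ` B \<union> ext ` E)"
      proof cases
        case 1 then show ?thesis using f by blast
      next
        case 2
        then obtain e where e: "e \<in> E" "Bot l \<in> e" using E(3) by blast
        then have "x \<in> ext e" using f(2) 2 low_iff[OF 2(1) e(1)] Mid_iff by auto
        then show ?thesis using e by blast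
      next
        case 3 then show ?thesis using f by (auto simp: ext_def)
      qed
    qed
  qed
  have oB: "outer -` from_lower ` b = b" if b: "b \<in> B" for b
  proof
    show "outer -` from_lower ` b \<subseteq> b"
    proof
      fix p assume "p \<in> outer -` from_lower ` b"
      then have "outer p \<in> from_lower ` b" by simp
      then obtain p' where p': "p' \<in> b" "outer p = from_lower p'" by blast
      obtain i where "p' = Bot i" using B(3)[OF b p'(1)] by blast
      then have "p = p'" using p' by (cases p) auto
      then show "p \<in> b" using p' by simp
    qed
    show "b \<subseteq> outer -` from_lower ` b"
    proof
      fix p assume p: "p \<in> b"
      then obtain i where "p = Bot i" using B(3)[OF b p] by blast
      then have "outer p = from_lower p" by simp
      then show "p \<in> outer -` from_lower ` b" using p by simp
    qed
  qed
  have oE: "outer -` ext e = relabel \<phi> ` e" for e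
  proof -
    have "outer p \<in> ext e \<longleftrightarrow> p \<in> relabel \<phi> ` e" for p
    proof (cases p)
      case (Bot i)
      have "outer p \<in> ext e \<longleftrightarrow> (\<exists>l. i = \<phi> l \<and> Bot l \<in> e)" using Bot up_Low by (auto simp: ext_def low_def)
      also have "\<dots> \<longleftrightarrow> (\<exists>r\<in>e. p = relabel \<phi> r)"
      proof
        assume "\<exists>r\<in>e. p = relabel \<phi> r"
        then obtain r where "r \<in> e" "p = relabel \<phi> r" by blast
        then show "\<exists>l. i = \<phi> l \<and> Bot l \<in> e" using Bot by (cases r) auto
      qed (use Bot in force)
      finally show ?thesis by (simp add: image_iff)
    next
      case (Top i)
      have "outer p \<in> ext e \<longleftrightarrow> (\<exists>r\<in>e. Up i = from_upper r)" using Top by (auto simp: ext_def low_def)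
      also have "\<dots> \<longleftrightarrow> (\<exists>r\<in>e. p = relabel \<phi> r)"
      proof (rule bex_cong[OF refl])
        fix r show "Up i = from_upper r \<longleftrightarrow> p = relabel \<phi> r" using Top by (cases r) auto
      qed
      finally show ?thesis by (simp add: image_iff)
    qed
    then show ?thesis by blast
  qed
  have im: "(\<lambda>C. outer -` C) ` components (B \<union> through \<phi> L) E = B \<union> (`) (relabel \<phi>) ` E"
  proof -
    have "(\<lambda>C. outer -` C) ` (`) from_lower ` B = B" unfolding image_image using oB by (simp cong: image_cong)
    moreover have "(\<lambda>C. outer -` C) ` ext ` E = (`) (relabel \<phi>) ` E" unfolding image_image oE ..
    ultimately show ?thesis unfolding comps image_Un by simp
  qed
  have ne: "{} \<notin> B \<union> (`) (relabel \<phi>) ` E" using B(2) E(2) by auto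
  show "stack (B \<union> through \<phi> L) E = B \<union> (`) (relabel \<phi>) ` E"
    unfolding stack_eq im using ne by simp
  have "{C \<in> components (B \<union> through \<phi> L) E. outer -` C = {}} = {}"
    using im ne by (metis (mono_tags, lifting) Collect_empty_eq image_eqI)
  then show "loops (B \<union> through \<phi> L) E = 0" unfolding loops_def by (simp only: card.empty)
qed

lemma relabel_id: "relabel (\<lambda>l. l) p = p" by (cases p) auto

lemma stack_through_id:
  assumes B: "disjoint B" "{} \<notin> B" "\<And>b p. b \<in> B \<Longrightarrow> p \<in> b \<Longrightarrow> \<exists>i. p = Bot i \<and> i \<notin> L"
    and E: "disjoint E" "{} \<notin> E" "\<And>l. Bot l \<in> \<Union>E \<longleftrightarrow> l \<in> L"
  shows "stack (B \<union> through (\<lambda>l. l) L) E = B \<union> E" "loops (B \<union> through (\<lambda>l. l) L) E = 0"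
proof -
  have "stack (B \<union> through (\<lambda>l. l) L) E = B \<union> (`) (relabel (\<lambda>l. l)) ` E"
    by (rule stack_through) (use assms in auto)
  then show "stack (B \<union> through (\<lambda>l. l) L) E = B \<union> E" by (simp add: relabel_id)
  show "loops (B \<union> through (\<lambda>l. l) L) E = 0" by (rule stack_through) (use assms in auto)
qed

section \<open>From diagrams in the strip to matchings of an interval\<close>

lemma position_inj: "inj_on (position m k) (boundary m k)"
  by (rule inj_onI) (auto simp: boundary_def)

lemma position_image: "position m k ` boundary m k = {..<m + k}"
proof
  show "{..<m + k} \<subseteq> position m k ` boundary m k"
  proof
    fix x assume x: "x \<in> {..<m + k}"
    show "x \<in> position m k ` boundary m k"
    proof (cases "x < m")
      case True
      then have "x = position m k (Bot x)" "Bot x \<in> boundary m k" by (auto simp: boundary_def)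
      then show ?thesis by blast
    next
      case False
      then have "x = position m k (Top (k - 1 - (x - m)))" "Top (k - 1 - (x - m)) \<in> boundary m k"
        using x by (auto simp: boundary_def)
      then show ?thesis by blast
    qed
  qed
qed (auto simp: boundary_def)

text \<open>Relates the ordered pattern in the definition of diagrams to the order-free
  \<open>separates\<close>. The eight instances of \<open>X\<close> run through the ways to name the
  ends of two arcs.\<close>

lemma noncross_iff:
  assumes D: "disjoint D" "\<And>e. e \<in> D \<Longrightarrow> card e = 2"
  shows "noncross D \<longleftrightarrow> \<not> (\<exists>a b c d. {a, c} \<in> D \<and> {b, d} \<in> D \<and> a < b \<and> b < c \<and> c < d)"
proof
  assume N: "noncross D"
  show "\<not> (\<exists>a b c d. {a, c} \<in> D \<and> {b, d} \<in> D \<and> a < b \<and> b < c \<and> c < d)"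
  proof
    assume "\<exists>a b c d. {a, c} \<in> D \<and> {b, d} \<in> D \<and> a < b \<and> b < c \<and> c < d"
    then obtain a b c d where *: "{a, c} \<in> D" "{b, d} \<in> D" "a < b" "b < c" "c < d" by blast
    have "{a, c} \<noteq> {b, d}" using * by (auto simp: doubleton_eq_iff)
    from noncrossD[OF N *(1,2) this] show False using * by (simp add: separates_def)
  qed
next
  assume C: "\<not> (\<exists>a b c d. {a, c} \<in> D \<and> {b, d} \<in> D \<and> a < b \<and> b < c \<and> c < d)"
  have X: "\<not> (a < b \<and> b < c \<and> c < d)" if "{a, c} \<in> D" "{b, d} \<in> D" for a b c d using C that by blast
  show "noncross D" unfolding noncross_def
  proof (intro ballI impI)
    fix e f p q r s
    assume *: "e \<in> D" "f \<in> D" "e \<noteq> f" "p \<in> e" "q \<in> e" "r \<in> f" "s \<in> f"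
    show "separates p q r = separates p q s"
    proof (cases "p = q \<or> r = s")
      case True then show ?thesis by (auto simp: separates_def)
    next
      case False
      have e: "e = {p, q}" using D(2)[OF *(1)] *(4,5) False by (auto simp: card_2_iff)
      have f: "f = {r, s}" using D(2)[OF *(2)] *(6,7) False by (auto simp: card_2_iff)
      have "e \<inter> f = {}" using disjointD[OF D(1) *(1,2,3)] .
      then have ne: "p \<noteq> r" "p \<noteq> s" "q \<noteq> r" "q \<noteq> s" using e f by auto
      have eD: "{p, q} \<in> D" "{q, p} \<in> D" "{r, s} \<in> D" "{s, r} \<in> D"
        using *(1,2) e f by (auto simp: insert_commute)
      have lt: "r < p \<longleftrightarrow> \<not> p < r" "s < p \<longleftrightarrow> \<not> p < s" "r < q \<longleftrightarrow> \<not> q < r" "s < q \<longleftrightarrow> \<not> q < s"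
        using ne by auto
      show ?thesis
        using X[OF eD(1,3)] X[OF eD(1,4)] X[OF eD(2,3)] X[OF eD(2,4)]
          X[OF eD(3,1)] X[OF eD(3,2)] X[OF eD(4,1)] X[OF eD(4,2)]
        unfolding separates_def lt
        by (cases "p < r"; cases "p < s"; cases "q < r"; cases "q < s") simp_all
    qed
  qed
qed

definition linear :: "nat \<Rightarrow> nat \<Rightarrow> point set set \<Rightarrow> nat set set" where
  "linear m k D = (`) (position m k) ` D"

lemma matchings_arcs:
  assumes "D \<in> matchings m k"
  shows "disjoint D" "{} \<notin> D" "\<Union>D = boundary m k" "\<And>e. e \<in> D \<Longrightarrow> card e = 2" "finite D"
proof -
  show *: "disjoint D" "{} \<notin> D" "\<Union>D = boundary m k" "\<And>e. e \<in> D \<Longrightarrow> card e = 2"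
    using assms by (auto simp: matchings_def partition_on_def)
  have "finite (boundary m k)" by (simp add: boundary_def)
  then show "finite D" using *(3) by (metis finite_UnionD)
qed

text \<open>\<open>position\<close> maps the boundary bijectively onto an interval, and
  \<open>crossingless\<close> refers to positions only.\<close>

lemma linear_bij: "bij_betw (linear m k) (matchings m k) (NC {..<m + k})"
proof (rule bij_betwI')
  let ?f = "position m k"
  note inj = position_inj[of m k]
  have sub: "e \<subseteq> boundary m k" if "D \<in> matchings m k" "e \<in> D" for D e
    using matchings_arcs(3)[OF that(1)] that(2) by blast
  have inj2: "inj_on ((`) ?f) (Pow (boundary m k))" by (rule inj_on_image_Pow[OF inj])
  have noncross: "noncross ((`) ?f ` D) \<longleftrightarrow> crossingless m k D"
    if D: "disjoint D" "\<Union>D = boundary m k" "\<And>e. e \<in> D \<Longrightarrow> card e = 2" for D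
  proof -
    have dj: "disjoint ((`) ?f ` D)" by (rule disjoint_image) (use D inj in auto)
    have c2: "card e = 2" if e: "e \<in> (`) ?f ` D" for e
    proof -
      obtain e' where e': "e' \<in> D" "e = ?f ` e'" using e by blast
      have "inj_on ?f e'" using inj_on_subset[OF inj] D(2) e'(1) by blast
      then show ?thesis using e' D(3) by (simp add: card_image)
    qed
    have mem: "{?f a, ?f b} \<in> (`) ?f ` D \<longleftrightarrow> {a, b} \<in> D" if "a \<in> boundary m k" "b \<in> boundary m k" for a b
    proof
      assume "{?f a, ?f b} \<in> (`) ?f ` D"
      then obtain e where e: "e \<in> D" "?f ` {a, b} = ?f ` e" by auto
      have "{a, b} = e" using inj_onD[OF inj2 e(2)] that e(1) D(2) by blast
      then show "{a, b} \<in> D" using e by simp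
    next
      assume "{a, b} \<in> D"
      then have "?f ` {a, b} \<in> (`) ?f ` D" by (rule imageI)
      then show "{?f a, ?f b} \<in> (`) ?f ` D" by simp
    qed
    have range: "\<exists>p\<in>boundary m k. x = ?f p" if "x \<in> e" "e \<in> (`) ?f ` D" for x e
      using that D(2) by blast
    have "noncross ((`) ?f ` D) \<longleftrightarrow>
        \<not> (\<exists>a b c d. {a, c} \<in> (`) ?f ` D \<and> {b, d} \<in> (`) ?f ` D \<and> a < b \<and> b < c \<and> c < d)"
      by (rule noncross_iff) (use dj c2 in auto)
    moreover have "(\<exists>a b c d. {a, c} \<in> (`) ?f ` D \<and> {b, d} \<in> (`) ?f ` D \<and> a < b \<and> b < c \<and> c < d) \<longleftrightarrow>
        (\<exists>a b c d. {a, c} \<in> D \<and> {b, d} \<in> D \<and> ?f a < ?f b \<and> ?f b < ?f c \<and> ?f c < ?f d)"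
    proof
      assume "\<exists>a b c d. {a, c} \<in> (`) ?f ` D \<and> {b, d} \<in> (`) ?f ` D \<and> a < b \<and> b < c \<and> c < d"
      then obtain a b c d where *: "{a, c} \<in> (`) ?f ` D" "{b, d} \<in> (`) ?f ` D" "a < b" "b < c" "c < d" by blast
      obtain a' where a: "a' \<in> boundary m k" "a = ?f a'" using range[OF _ *(1), of a] by blast
      obtain c' where c: "c' \<in> boundary m k" "c = ?f c'" using range[OF _ *(1), of c] by blast
      obtain b' where b: "b' \<in> boundary m k" "b = ?f b'" using range[OF _ *(2), of b] by blast
      obtain d' where d: "d' \<in> boundary m k" "d = ?f d'" using range[OF _ *(2), of d] by blast
      have "{a', c'} \<in> D" "{b', d'} \<in> D" using *(1,2) mem a b c d by simp_all
      then show "\<exists>a b c d. {a, c} \<in> D \<and> {b, d} \<in> D \<and> ?f a < ?f b \<and> ?f b < ?f c \<and> ?f c < ?f d"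
        using *(3-5) a b c d by blast
    next
      assume "\<exists>a b c d. {a, c} \<in> D \<and> {b, d} \<in> D \<and> ?f a < ?f b \<and> ?f b < ?f c \<and> ?f c < ?f d"
      then obtain a b c d where *: "{a, c} \<in> D" "{b, d} \<in> D" "?f a < ?f b" "?f b < ?f c" "?f c < ?f d" by blast
      have "?f ` {a, c} \<in> (`) ?f ` D" "?f ` {b, d} \<in> (`) ?f ` D" using *(1,2) by blast+
      then have "{?f a, ?f c} \<in> (`) ?f ` D" "{?f b, ?f d} \<in> (`) ?f ` D" by simp_all
      then show "\<exists>a b c d. {a, c} \<in> (`) ?f ` D \<and> {b, d} \<in> (`) ?f ` D \<and> a < b \<and> b < c \<and> c < d"
        using *(3-5) by blast
    qed
    ultimately show ?thesis unfolding crossingless_def by (simp only:)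
  qed
  show "linear m k D = linear m k D' \<longleftrightarrow> D = D'" if "D \<in> matchings m k" "D' \<in> matchings m k" for D D'
    unfolding linear_def by (rule inj_on_image_eq_iff[OF inj2]) (use sub that in auto)
  show "linear m k D \<in> NC {..<m + k}" if D: "D \<in> matchings m k" for D
    unfolding linear_def
  proof (rule NC_I)
    note m = matchings_arcs[OF D]
    show "disjoint ((`) ?f ` D)" by (rule disjoint_image) (use m inj in auto)
    show "\<Union>((`) ?f ` D) = {..<m + k}" using m(3) position_image by (metis image_Union)
    show "noncross ((`) ?f ` D)" using noncross[of D] m D by (simp add: matchings_def)
    fix e assume "e \<in> (`) ?f ` D"
    then obtain e' where e': "e' \<in> D" "e = ?f ` e'" by blast
    have "inj_on ?f e'" using inj_on_subset[OF inj] sub[OF D] e'(1) by blast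
    then show "card e = 2" using e' m(4) by (simp add: card_image)
  qed
  fix D' assume D': "D' \<in> NC {..<m + k}"
  define g where "g = inv_into (boundary m k) ?f"
  have fg: "?f (g x) = x" "g x \<in> boundary m k" if "x < m + k" for x
    using that position_image[of m k] unfolding g_def by (metis f_inv_into_f lessThan_iff, metis inv_into_into lessThan_iff)
  have gf: "g (?f p) = p" if "p \<in> boundary m k" for p unfolding g_def using inv_into_f_f[OF inj that] .
  have injg: "inj_on g {..<m + k}" by (rule inj_on_inverseI[where g = ?f]) (simp add: fg)
  define D where "D = (`) g ` D'"
  have subD: "e \<subseteq> {..<m + k}" if "e \<in> D'" for e using NC_subset[OF D' that] .
  have D1: "disjoint D" unfolding D_def
    by (rule disjoint_image) (use injg NC_Union[OF D'] NC_disjoint[OF D'] in auto)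
  have D2: "\<Union>D = boundary m k"
  proof -
    have "\<Union>D = g ` {..<m + k}" unfolding D_def using NC_Union[OF D'] by (metis image_Union)
    also have "\<dots> = boundary m k" unfolding position_image[symmetric] image_image using gf by simp
    finally show ?thesis .
  qed
  have D3: "card e = 2" if e: "e \<in> D" for e
  proof -
    obtain e' where e': "e' \<in> D'" "e = g ` e'" using e by (auto simp: D_def)
    have "inj_on g e'" using inj_on_subset[OF injg] subD e'(1) by blast
    then show ?thesis using e' NC_card2[OF D'] by (simp add: card_image)
  qed
  have "?f ` g ` e = e" if "e \<in> D'" for e
  proof -
    have "?f (g x) = x" if "x \<in> e" for x using fg subD \<open>e \<in> D'\<close> that by blast
    then show ?thesis by (simp add: image_image)
  qed
  then have lin: "(`) ?f ` D = D'" unfolding D_def image_image by simp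
  have "{} \<notin> D" using D3 by force
  then have "D \<in> matchings m k"
    using D1 D2 D3 noncross[OF D1 D2 D3] lin NC_noncross[OF D'] by (simp add: matchings_def partition_on_def)
  then show "\<exists>D\<in>matchings m k. D' = linear m k D" using lin by (auto simp: linear_def)
qed

lemma linear_mem_iff:
  assumes D: "D \<in> matchings m k" and ab: "a \<in> boundary m k" "b \<in> boundary m k"
  shows "{position m k a, position m k b} \<in> linear m k D \<longleftrightarrow> {a, b} \<in> D"
proof
  assume "{position m k a, position m k b} \<in> linear m k D"
  then obtain e where e: "e \<in> D" "position m k ` {a, b} = position m k ` e" by (auto simp: linear_def)
  have "e \<subseteq> boundary m k" using e(1) matchings_arcs(3)[OF D] by blast
  then have "{a, b} = e" using inj_on_image_eq_iff[OF position_inj, of "{a, b}" m k e] e(2) ab by simp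
  then show "{a, b} \<in> D" using e by simp
next
  assume "{a, b} \<in> D"
  then have "position m k ` {a, b} \<in> linear m k D" unfolding linear_def by blast
  then show "{position m k a, position m k b} \<in> linear m k D" by simp
qed

lemma finite_matchings: "finite (matchings m k)"
  using bij_betw_finite[OF linear_bij] finite_NC by blast

text \<open>Reflection reverses the order of positions, and the crossing pattern is invariant under
  reversal.\<close>

lemma flips_matchings:
  assumes D: "D \<in> matchings m k" shows "flips D \<in> matchings k m"
proof -
  note m = matchings_arcs[OF D]
  have b: "flip ` boundary m k = boundary k m" by (auto simp: boundary_def image_Un image_image)
  have "disjoint (flips D)" by (rule disjoint_image[OF inj_on_subset[OF inj_flip] m(1)]) simp
  moreover have "\<Union>(flips D) = boundary k m" using b m(3) by (metis image_Union)
  moreover have "{} \<notin> flips D" using m(2) by auto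
  moreover have "card e = 2" if "e \<in> flips D" for e
    using that m(4) card_image[OF inj_on_subset[OF inj_flip]] by auto
  moreover have "crossingless k m (flips D)"
  proof -
    have pos: "position m k (flip p) = m + k - 1 - position k m p" if "p \<in> boundary k m" for p
      using that by (auto simp: boundary_def)
    have lt: "position k m p < m + k" if "p \<in> boundary k m" for p
      using that by (auto simp: boundary_def)
    have fD: "e \<in> flips D \<longleftrightarrow> flip ` e \<in> D" for e
    proof
      assume "flip ` e \<in> D"
      then have "flip ` flip ` e \<in> flips D" by blast
      then show "e \<in> flips D" by simp
    qed auto
    show ?thesis unfolding crossingless_def
    proof
      assume "\<exists>a b c d. {a, c} \<in> flips D \<and> {b, d} \<in> flips D \<and> position k m a < position k m b \<and>
        position k m b < position k m c \<and> position k m c < position k m d"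
      then obtain a b c d where *: "{a, c} \<in> flips D" "{b, d} \<in> flips D" "position k m a < position k m b"
        "position k m b < position k m c" "position k m c < position k m d" by blast
      have in_b: "a \<in> boundary k m" "b \<in> boundary k m" "c \<in> boundary k m" "d \<in> boundary k m"
        using *(1,2) \<open>\<Union>(flips D) = boundary k m\<close> by blast+
      have "{flip d, flip b} \<in> D" "{flip c, flip a} \<in> D"
        using *(1,2) fD[of "{a, c}"] fD[of "{b, d}"] by (simp_all add: insert_commute)
      moreover have "position m k (flip d) < position m k (flip c)" "position m k (flip c) < position m k (flip b)"
        "position m k (flip b) < position m k (flip a)"
        using *(3-5) lt[OF in_b(4)] by (simp_all add: pos in_b)
      ultimately show False using D unfolding matchings_def crossingless_def by blast
    qed
  qed
  ultimately show ?thesis by (simp add: matchings_def partition_on_def)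
qed

section \<open>Contractions of diagrams\<close>

lemma merge_commute: "merge x y D = merge y x D"
  by (simp add: merge_def insert_commute disj_commute conj_commute)

lemma merge_image:
  assumes "inj_on f (insert x (insert y (\<Union>D)))"
  shows "merge (f x) (f y) ((`) f ` D) = (`) f ` merge x y D"
proof -
  define S where "S = insert x (insert y (\<Union>D))"
  have inj: "inj_on f S" using assms by (simp add: S_def)
  have sub: "e \<subseteq> S" if "e \<in> D" for e using that by (auto simp: S_def)
  have xy: "x \<in> S" "y \<in> S" "{x, y} \<subseteq> S" by (auto simp: S_def)
  have inj2: "inj_on ((`) f) (Pow S)" by (rule inj_on_image_Pow[OF inj])
  have pair: "{f x, f y} \<in> (`) f ` D \<longleftrightarrow> {x, y} \<in> D"
    using inj_on_image_mem_iff[OF inj2, of "{x, y}" D] sub xy by auto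
  have mem: "f p \<in> f ` e \<longleftrightarrow> p \<in> e" if "p \<in> S" "e \<in> D" for p e
    using inj_on_image_mem_iff[OF inj that(1) sub[OF that(2)]] .
  show ?thesis
  proof (cases "{x, y} \<in> D")
    case True
    have "(`) f ` (D - {{x, y}}) = (`) f ` D - (`) f ` {{x, y}}"
      by (rule inj_on_image_set_diff[OF inj2]) (use sub xy in auto)
    then show ?thesis using True pair by (simp add: merge_def)
  next
    case False
    have 1: "{e \<in> (`) f ` D. f x \<notin> e \<and> f y \<notin> e} = (`) f ` {e \<in> D. x \<notin> e \<and> y \<notin> e}"
      using mem[OF xy(1)] mem[OF xy(2)] by auto
    have "{e \<in> (`) f ` D. f x \<in> e \<or> f y \<in> e} = (`) f ` {e \<in> D. x \<in> e \<or> y \<in> e}"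
      using mem[OF xy(1)] mem[OF xy(2)] by auto
    then have "\<Union>{e \<in> (`) f ` D. f x \<in> e \<or> f y \<in> e} - {f x, f y} = f ` \<Union>{e \<in> D. x \<in> e \<or> y \<in> e} - f ` {x, y}"
      by (simp add: image_Union)
    also have "\<dots> = f ` (\<Union>{e \<in> D. x \<in> e \<or> y \<in> e} - {x, y})"
      by (rule inj_on_image_set_diff[OF inj, symmetric]) (auto simp: S_def)
    finally show ?thesis using False pair 1 by (simp add: merge_def)
  qed
qed

lemma Union_merge_subset: "\<Union>(merge x y D) \<subseteq> \<Union>D"
  by (auto simp: merge_def)

text \<open>The push-forward of the weight \<open>w\<close> along \<open>F\<close> is zero. With
  \<open>F\<close> a contraction, this expresses the vanishing of a combination of contracted
  diagrams without forming the module they span.\<close>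

definition fibres_vanish :: "'b set \<Rightarrow> ('b \<Rightarrow> 'c) \<Rightarrow> ('b \<Rightarrow> 'a::comm_monoid_add) \<Rightarrow> bool" where
  "fibres_vanish X F w \<longleftrightarrow> (\<forall>G. (\<Sum>D\<in>{D \<in> X. F D = G}. w D) = 0)"

lemma fibres_vanish_iff:
  "fibres_vanish X F w \<longleftrightarrow> (\<forall>D0\<in>X. (\<Sum>D\<in>{D \<in> X. F D = F D0}. w D) = 0)"
proof
  assume R: "\<forall>D0\<in>X. (\<Sum>D\<in>{D \<in> X. F D = F D0}. w D) = 0"
  show "fibres_vanish X F w" unfolding fibres_vanish_def
  proof
    fix G
    show "(\<Sum>D\<in>{D \<in> X. F D = G}. w D) = 0"
    proof (cases "\<exists>D0\<in>X. F D0 = G")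
      case True then show ?thesis using R by blast
    next
      case False
      then have e: "{D \<in> X. F D = G} = {}" by blast
      show ?thesis unfolding e by simp
    qed
  qed
qed (simp add: fibres_vanish_def)

lemma fibres_vanish_transport:
  assumes \<beta>: "bij_betw \<beta> X X'"
    and F: "\<And>D D0. D \<in> X \<Longrightarrow> D0 \<in> X \<Longrightarrow> F' (\<beta> D) = F' (\<beta> D0) \<longleftrightarrow> F D = F D0"
    and w: "\<And>D. D \<in> X \<Longrightarrow> w' (\<beta> D) = w D"
  shows "fibres_vanish X' F' w' \<longleftrightarrow> fibres_vanish X F w"
proof -
  have X': "X' = \<beta> ` X" using \<beta> by (simp add: bij_betw_def)
  have "(\<Sum>D\<in>{D \<in> X'. F' D = F' (\<beta> D0)}. w' D) = (\<Sum>D\<in>{D \<in> X. F D = F D0}. w D)" if D0: "D0 \<in> X" for D0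
  proof -
    have "{D \<in> X'. F' D = F' (\<beta> D0)} = \<beta> ` {D \<in> X. F D = F D0}" using F[OF _ D0] X' by auto
    moreover have "inj_on \<beta> {D \<in> X. F D = F D0}" using \<beta> by (auto simp: bij_betw_def intro: inj_on_subset)
    ultimately have "(\<Sum>D\<in>{D \<in> X'. F' D = F' (\<beta> D0)}. w' D) = (\<Sum>D\<in>{D \<in> X. F D = F D0}. w' (\<beta> D))"
      by (simp add: sum.reindex)
    also have "\<dots> = (\<Sum>D\<in>{D \<in> X. F D = F D0}. w D)" by (rule sum.cong) (auto simp: w)
    finally show ?thesis .
  qed
  then show ?thesis unfolding fibres_vanish_iff X' by simp
qed

definition null_at :: "'a::{comm_ring, comm_monoid_mult} \<Rightarrow> nat \<Rightarrow> point \<Rightarrow> point \<Rightarrow> (point set set \<Rightarrow> 'a) \<Rightarrow> bool" where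
  "null_at d n x y c \<longleftrightarrow>
     fibres_vanish (matchings n n) (merge x y) (\<lambda>D. if {x, y} \<in> D then - d * c D else c D)"

lemma null_at_commute: "null_at d n x y c \<longleftrightarrow> null_at d n y x c"
proof -
  have "merge x y = merge y x" by (rule ext) (rule merge_commute)
  then show ?thesis by (simp add: null_at_def insert_commute)
qed

lemma null_at_linear:
  assumes xy: "x \<in> boundary n n" "y \<in> boundary n n"
  shows "fibres_vanish (NC {..<2 * n}) (merge (position n n x) (position n n y))
      (\<lambda>D. if {position n n x, position n n y} \<in> D then - d * c D else c D)
    \<longleftrightarrow> null_at d n x y (\<lambda>D. c (linear n n D))"
  unfolding null_at_def
proof (rule fibres_vanish_transport)
  show "bij_betw (linear n n) (matchings n n) (NC {..<2 * n})"
    using linear_bij[of n n] by (simp add: mult_2)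
  fix D assume D: "D \<in> matchings n n"
  show "(if {position n n x, position n n y} \<in> linear n n D then - d * c (linear n n D) else c (linear n n D))
      = (if {x, y} \<in> D then - d * c (linear n n D) else c (linear n n D))"
    using linear_mem_iff[OF D xy] by simp
  fix D0 assume D0: "D0 \<in> matchings n n"
  let ?f = "position n n"
  have m: "merge (?f x) (?f y) (linear n n D) = (`) ?f ` merge x y D" "\<Union>(merge x y D) \<subseteq> boundary n n"
    if "D \<in> matchings n n" for D
  proof -
    have U: "\<Union>D = boundary n n" using matchings_arcs(3)[OF that] .
    show "merge (?f x) (?f y) (linear n n D) = (`) ?f ` merge x y D"
      unfolding linear_def by (rule merge_image) (use U xy position_inj in \<open>simp add: insert_absorb\<close>)
    show "\<Union>(merge x y D) \<subseteq> boundary n n" using Union_merge_subset[of x y D] U by simp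
  qed
  have "inj_on ((`) ?f) (Pow (boundary n n))" by (rule inj_on_image_Pow[OF position_inj])
  then have "(`) ?f ` merge x y D = (`) ?f ` merge x y D0 \<longleftrightarrow> merge x y D = merge x y D0"
    by (rule inj_on_image_eq_iff) (use m(2)[OF D] m(2)[OF D0] in blast)+
  then show "merge (?f x) (?f y) (linear n n D) = merge (?f x) (?f y) (linear n n D0) \<longleftrightarrow> merge x y D = merge x y D0"
    unfolding m(1)[OF D] m(1)[OF D0] .
qed

lemma bij_flips: "bij_betw flips (matchings n n) (matchings n n)"
  by (rule bij_betwI[where g = flips]) (use flips_matchings in auto)

lemma null_at_flip:
  "null_at d n (flip x) (flip y) c \<longleftrightarrow> null_at d n x y (\<lambda>D. c (flips D))"
  unfolding null_at_def
proof (rule fibres_vanish_transport[OF bij_flips])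
  fix D D0 :: "point set set"
  have m: "merge (flip x) (flip y) (flips D) = flips (merge x y D)" for D
    by (rule merge_image) (rule inj_on_subset[OF inj_flip], simp)
  show "merge (flip x) (flip y) (flips D) = merge (flip x) (flip y) (flips D0) \<longleftrightarrow> merge x y D = merge x y D0"
    unfolding m by (metis flips_flips)
  have "{flip x, flip y} = flip ` {x, y}" by simp
  then have "{flip x, flip y} \<in> flips D \<longleftrightarrow> {x, y} \<in> D" by (metis flips_flips image_flip_flip imageI)
  then show "(if {flip x, flip y} \<in> flips D then - d * c (flips D) else c (flips D))
      = (if {x, y} \<in> D then - d * c (flips D) else c (flips D))" by simp
qed

text \<open>Neighbouring positions below \<open>n\<close> are neighbouring bottom points. Those from
  \<open>n\<close> on are neighbouring top points in reverse order: \<open>Top i\<close> and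
  \<open>Top (Suc i)\<close> have positions \<open>2 * n - 1 - i\<close> and
  \<open>2 * n - 2 - i\<close>.\<close>

lemma null_contractions_iff:
  "null_contractions d n c \<longleftrightarrow> (\<forall>i. Suc i < n \<longrightarrow>
     null_at d n (Bot i) (Bot (Suc i)) (\<lambda>D. c (linear n n D)) \<and>
     null_at d n (Top i) (Top (Suc i)) (\<lambda>D. c (linear n n D)))" (is "_ \<longleftrightarrow> (\<forall>i. Suc i < n \<longrightarrow> ?B i \<and> ?T i)")
proof -
  define Z where "Z j \<longleftrightarrow> fibres_vanish (NC {..<2 * n}) (merge j (Suc j)) (\<lambda>D. if {j, Suc j} \<in> D then - d * c D else c D)" for j
  have Z: "null_contractions d n c \<longleftrightarrow> (\<forall>j. Suc j < 2 * n \<longrightarrow> Suc j \<noteq> n \<longrightarrow> Z j)"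
    unfolding null_contractions_def Z_def fibres_vanish_def by blast
  have B: "Z i \<longleftrightarrow> ?B i" if "Suc i < n" for i
    using null_at_linear[of "Bot i" n "Bot (Suc i)" d c] that by (simp add: Z_def boundary_def)
  have T: "Z (2 * n - 2 - i) \<longleftrightarrow> ?T i" if i: "Suc i < n" for i
  proof -
    have p: "position n n (Top (Suc i)) = 2 * n - 2 - i" "position n n (Top i) = Suc (2 * n - 2 - i)" using i by auto
    show ?thesis
      using null_at_linear[of "Top (Suc i)" n "Top i" d c] i null_at_commute[of d n "Top i" "Top (Suc i)"]
      unfolding p by (simp add: Z_def boundary_def)
  qed
  show ?thesis
  proof
    assume "null_contractions d n c"
    then have Zj: "Z j" if "Suc j < 2 * n" "Suc j \<noteq> n" for j using Z that by blast
    show "\<forall>i. Suc i < n \<longrightarrow> ?B i \<and> ?T i"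
    proof (intro allI impI conjI)
      fix i assume i: "Suc i < n"
      show "?B i" using B[OF i] Zj[of i] i by simp
      show "?T i" using T[OF i] Zj[of "2 * n - 2 - i"] i by simp
    qed
  next
    assume R: "\<forall>i. Suc i < n \<longrightarrow> ?B i \<and> ?T i"
    show "null_contractions d n c" unfolding Z
    proof (intro allI impI)
      fix j assume j: "Suc j < 2 * n" "Suc j \<noteq> n"
      show "Z j"
      proof (cases "Suc j < n")
        case True then show ?thesis using B R by blast
      next
        case False
        then have "Suc (2 * n - 2 - j) < n" "2 * n - 2 - (2 * n - 2 - j) = j" using j by auto
        then show ?thesis using T[of "2 * n - 2 - j"] R by auto
      qed
    qed
  qed
qed

lemma id_matching_eq_through: "id_matching n = through (\<lambda>l. l) {..<n}"
  by (auto simp: id_matching_def through_def)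

lemma linear_id: "linear n n (id_matching n) = idNC n"
proof -
  have "position n n ` {Bot i, Top i} = {i, 2 * n - 1 - i}" if "i < n" for i using that by auto
  then show ?thesis unfolding id_matching_eq_through through_def linear_def idNC_def image_image
    by (intro image_cong) auto
qed

lemma id_in_matchings: "id_matching n \<in> matchings n n"
proof -
  obtain D where D: "D \<in> matchings n n" "linear n n D = idNC n"
    using bij_betw_imp_surj_on[OF linear_bij[of n n]] idNC_in_NC[of n] by (metis imageE mult_2)
  have "inj_on (position n n) (boundary n n)" by (rule position_inj)
  have inj2: "inj_on ((`) (position n n)) (Pow (boundary n n))" by (rule inj_on_image_Pow[OF position_inj])
  have "D = id_matching n"
  proof -
    have "D \<subseteq> Pow (boundary n n)" using matchings_arcs(3)[OF D(1)] by blast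
    moreover have "id_matching n \<subseteq> Pow (boundary n n)" by (auto simp: id_matching_def boundary_def)
    ultimately show ?thesis
      using inj_on_image_eq_iff[OF inj2, of D "id_matching n"] D(2) linear_id[of n] by (simp add: linear_def)
  qed
  then show ?thesis using D by simp
qed

lemma linear_arc_pullback:
  assumes D: "D \<in> matchings m k" and e: "{i, Suc i} \<in> linear m k D" "Suc i < m"
  shows "{Bot i, Bot (Suc i)} \<in> D"
  using linear_mem_iff[OF D, of "Bot i" "Bot (Suc i)"] e by (simp add: boundary_def)

text \<open>If no arc stays at the bottom, all \<open>m\<close> bottom points are left ends. There
  are \<open>(m + k) / 2\<close> left ends, so \<open>k < m\<close> is impossible; for
  \<open>k = m\<close> only the identity is left. An arc at the bottom then has an arc between
  neighbours under it or is one.\<close>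

lemma matching_bottom_arc:
  assumes D: "D \<in> matchings m k" and ne: "k < m \<or> (k = m \<and> D \<noteq> id_matching m)"
  obtains i where "Suc i < m" "{Bot i, Bot (Suc i)} \<in> D"
proof -
  let ?D = "linear m k D"
  have lD: "?D \<in> NC {..<m + k}" using linear_bij D by (auto simp: bij_betw_def)
  have "\<exists>e\<in>?D. e \<subseteq> {..<m}"
  proof (cases "k < m")
    case True
    show ?thesis
    proof (rule ccontr)
      assume *: "\<not> (\<exists>e\<in>?D. e \<subseteq> {..<m})"
      have "{..<m} \<subseteq> openers ?D"
      proof
        fix i assume i: "i \<in> {..<m}"
        then have "i \<in> {..<m + k}" by simp
        then obtain j where j: "{i, j} \<in> ?D" by (rule NC_partner[OF lD])
        then have "\<not> {i, j} \<subseteq> {..<m}" using * by blast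
        then have "Min {i, j} = i" using i by auto
        then show "i \<in> openers ?D" using j by (metis imageI)
      qed
      moreover have "m + k = 2 * card ({..<m + k} \<inter> openers ?D)"
        using balanced_card[OF lD _ balanced_openers[OF lD]] by simp
      moreover have "{..<m + k} \<inter> openers ?D = openers ?D" using openers_subset[OF lD] by blast
      moreover have "finite (openers ?D)" using NC_finite[OF _ lD] by simp
      ultimately have "m \<le> card (openers ?D)" "m + k = 2 * card (openers ?D)"
        using card_mono[of "openers ?D" "{..<m}"] by auto
      then show False using True by linarith
    qed
  next
    case False
    then have k: "k = m" "D \<noteq> id_matching m" using ne by auto
    have "?D \<noteq> idNC m"
    proof
      assume "?D = idNC m"
      then have "linear m m D = linear m m (id_matching m)" using k linear_id by simp
      moreover have "inj_on (linear m m) (matchings m m)" using linear_bij by (auto simp: bij_betw_def)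
      ultimately show False using D k id_in_matchings by (auto dest: inj_onD)
    qed
    then show ?thesis using eq_idNC_or_arc_below[of ?D m] lD k by (simp add: mult_2)
  qed
  then obtain e where e: "e \<in> ?D" "e \<subseteq> {..<m}" by blast
  obtain i where "Suc i < m" "{i, Suc i} \<in> ?D"
    using adjacent_arc_below[OF lD e(1), of 0 m] e(2) by (auto simp: atLeast0LessThan)
  then show ?thesis using that linear_arc_pullback[OF D] by blast
qed

section \<open>Cups and caps\<close>

lemma matchings_of_linear:
  assumes sub: "X \<subseteq> Pow (boundary m k)" and lin: "linear m k X \<in> NC {..<m + k}"
  shows "X \<in> matchings m k"
proof -
  obtain D where D: "D \<in> matchings m k" "linear m k X = linear m k D"
    using bij_betw_imp_surj_on[OF linear_bij[of m k]] lin by (metis imageE)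
  have inj2: "inj_on ((`) (position m k)) (Pow (boundary m k))" by (rule inj_on_image_Pow[OF position_inj])
  have "D \<subseteq> Pow (boundary m k)" using matchings_arcs(3)[OF D(1)] by blast
  then have "X = D" using inj_on_image_eq_iff[OF inj2 sub] D(2) by (simp add: linear_def)
  then show ?thesis using D by simp
qed

text \<open>The usual multiplicative generator of the Temperley-Lieb algebra; it is the test element
  for contractions at \<open>i\<close> and \<open>Suc i\<close>.\<close>

definition cup_cap :: "nat \<Rightarrow> nat \<Rightarrow> point set set" where
  "cup_cap n i = insert {Top i, Top (Suc i)} ({{Bot i, Bot (Suc i)}} \<union> through (\<lambda>l. l) ({..<n} - {i, Suc i}))"

lemma flips_cup_cap: "flips (cup_cap n i) = cup_cap n i"
proof -
  have "flips (through (\<lambda>l. l) L) = through (\<lambda>l. l) L" for L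
    by (auto simp: through_def image_image insert_commute)
  then show ?thesis by (simp add: cup_cap_def image_Un insert_commute)
qed

text \<open>Two neighbouring arcs of the nested identity are removed and their ends reconnected
  sideways. The ends to be connected are adjacent, so no crossing arises.\<close>

lemma cup_cap_in_matchings:
  assumes i: "Suc i < n" shows "cup_cap n i \<in> matchings n n"
proof (rule matchings_of_linear)
  show "cup_cap n i \<subseteq> Pow (boundary n n)" using i by (auto simp: cup_cap_def through_def boundary_def)
  let ?e = "\<lambda>l. {l, 2 * n - 1 - l}"
  define D where "D = idNC n - {?e i} - {?e (Suc i)}"
  have "idNC n - {?e i} \<in> NC ({..<2 * n} - ?e i)"
    by (rule NC_remove[OF idNC_in_NC]) (use i in \<open>simp add: idNC_def\<close>)
  moreover have "?e (Suc i) \<in> idNC n - {?e i}" using i by (auto simp: idNC_def doubleton_eq_iff)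
  ultimately have D: "D \<in> NC ({..<2 * n} - ?e i - ?e (Suc i))" unfolding D_def by (rule NC_remove)
  let ?A = "{..<2 * n} - ?e i - ?e (Suc i)"
  let ?u = "2 * n - 2 - i"
  have u: "Suc i < ?u" using i by linarith
  have eS: "?e (Suc i) = {Suc i, ?u}" "?e i = {i, Suc ?u}" using i by auto
  have 1: "insert {i, Suc i} D \<in> NC (insert i (insert (Suc i) ?A))"
    by (rule NC_insert_adjacent[OF D]) (auto simp: Suc_lessI)
  have "insert {?u, Suc ?u} (insert {i, Suc i} D) \<in> NC (insert ?u (insert (Suc ?u) (insert i (insert (Suc i) ?A))))"
    by (rule NC_insert_adjacent[OF 1]) (use u in \<open>auto simp: eS\<close>)
  moreover have "insert ?u (insert (Suc ?u) (insert i (insert (Suc i) ?A))) = {..<n + n}"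
    using i unfolding eS by auto
  moreover have "linear n n (cup_cap n i) = insert {?u, Suc ?u} (insert {i, Suc i} D)"
  proof -
    have "D = ?e ` ({..<n} - {i, Suc i})"
    proof
      show "D \<subseteq> ?e ` ({..<n} - {i, Suc i})" by (auto simp: D_def idNC_def)
      show "?e ` ({..<n} - {i, Suc i}) \<subseteq> D"
      proof
        fix e assume "e \<in> ?e ` ({..<n} - {i, Suc i})"
        then obtain l where l: "l < n" "l \<noteq> i" "l \<noteq> Suc i" "e = ?e l" by blast
        then have "?e l \<noteq> ?e i" "?e l \<noteq> ?e (Suc i)" using i by (auto simp: doubleton_eq_iff)
        then show "e \<in> D" using l by (simp add: D_def idNC_def)
      qed
    qed
    moreover have "position n n ` {Bot l, Top l} = ?e l" if "l < n" for l using that by auto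
    then have "linear n n (through (\<lambda>l. l) ({..<n} - {i, Suc i})) = ?e ` ({..<n} - {i, Suc i})"
      unfolding linear_def through_def image_image by (intro image_cong) auto
    moreover have "position n n ` {Top i, Top (Suc i)} = {?u, Suc ?u}" using i by auto
    moreover have "linear n n (cup_cap n i) = insert (position n n ` {Top i, Top (Suc i)})
        (insert (position n n ` {Bot i, Bot (Suc i)}) (linear n n (through (\<lambda>l. l) ({..<n} - {i, Suc i}))))"
      by (simp add: cup_cap_def linear_def)
    ultimately show ?thesis by simp
  qed
  ultimately show "linear n n (cup_cap n i) \<in> NC {..<n + n}" by simp
qed

text \<open>\<open>\<phi>\<close> lists the bottom points other than \<open>i\<close> and
  \<open>Suc i\<close> in increasing order, and strands joined in increasing order do not
  cross.\<close>

lemma cap_in_matchings: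
  assumes i: "Suc i < n"
  defines "\<phi> \<equiv> \<lambda>l. if l < i then l else l + 2"
  shows "{{Bot i, Bot (Suc i)}} \<union> through \<phi> {..<n - 2} \<in> matchings n (n - 2)" (is "?D \<in> _")
proof -
  have inj: "\<phi> l = \<phi> l' \<longleftrightarrow> l = l'" for l l' by (auto simp: \<phi>_def)
  have mono: "\<phi> l < \<phi> l' \<Longrightarrow> l < l'" for l l' by (auto simp: \<phi>_def split: if_splits)
  have out: "\<phi> l \<noteq> i" "\<phi> l \<noteq> Suc i" for l by (auto simp: \<phi>_def)
  have bound: "\<phi> l < n" if "l < n - 2" for l using that i by (auto simp: \<phi>_def)
  have surj: "\<exists>l<n - 2. j = \<phi> l" if "j < n" "j \<noteq> i" "j \<noteq> Suc i" for j
  proof (cases "j < i")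
    case True then show ?thesis using i by (intro exI[of _ j]) (auto simp: \<phi>_def)
  next
    case False then show ?thesis using that by (intro exI[of _ "j - 2"]) (auto simp: \<phi>_def)
  qed
  have "disjoint ?D"
  proof (rule disjointI)
    fix a b assume ab: "a \<in> ?D" "b \<in> ?D" "a \<noteq> b"
    show "a \<inter> b = {}"
      using ab out inj by (auto simp: through_def)
  qed
  moreover have "\<Union>?D = boundary n (n - 2)"
  proof
    show "\<Union>?D \<subseteq> boundary n (n - 2)" using i bound by (auto simp: through_def boundary_def)
    show "boundary n (n - 2) \<subseteq> \<Union>?D"
    proof
      fix p assume p: "p \<in> boundary n (n - 2)"
      show "p \<in> \<Union>?D"
      proof (cases p)
        case (Top l)
        then have "l < n - 2" using p by (auto simp: boundary_def)
        then show ?thesis using Top by (auto simp: through_def)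
      next
        case (Bot j)
        then have j: "j < n" using p by (auto simp: boundary_def)
        show ?thesis
        proof (cases "j = i \<or> j = Suc i")
          case True then show ?thesis using Bot by auto
        next
          case False
          then obtain l where "l < n - 2" "j = \<phi> l" using surj[OF j] by blast
          then show ?thesis using Bot by (auto simp: through_def)
        qed
      qed
    qed
  qed
  moreover have "{} \<notin> ?D" by (auto simp: through_def)
  moreover have "card e = 2" if "e \<in> ?D" for e using that by (auto simp: through_def)
  moreover have "crossingless n (n - 2) ?D" unfolding crossingless_def
  proof
    let ?p = "position n (n - 2)"
    assume "\<exists>a b c d. {a, c} \<in> ?D \<and> {b, d} \<in> ?D \<and> ?p a < ?p b \<and> ?p b < ?p c \<and> ?p c < ?p d"
    then obtain a b c d where *: "{a, c} \<in> ?D" "{b, d} \<in> ?D" "?p a < ?p b" "?p b < ?p c" "?p c < ?p d" by blast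
    have arc: "(\<exists>l<n - 2. x = Bot (\<phi> l) \<and> y = Top l) \<or> (?p x = i \<and> ?p y = Suc i)"
      if xy: "{x, y} \<in> ?D" "?p x < ?p y" for x y
    proof -
      from xy(1) consider "{x, y} = {Bot i, Bot (Suc i)}" | l where "l < n - 2" "{x, y} = {Bot (\<phi> l), Top l}"
        unfolding through_def by blast
      then show ?thesis
      proof cases
        case 1 then show ?thesis using xy(2) by (auto simp: doubleton_eq_iff)
      next
        case 2
        have "?p (Bot (\<phi> l)) < ?p (Top l)" using bound[OF 2(1)] by simp
        then show ?thesis using 2 xy(2) by (auto simp: doubleton_eq_iff)
      qed
    qed
    have ac: "?p a < ?p c" and bd: "?p b < ?p d" using * by linarith+
    have "\<not> (?p a = i \<and> ?p c = Suc i)" "\<not> (?p b = i \<and> ?p d = Suc i)" using * by linarith+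
    then obtain l l' where l: "l < n - 2" "a = Bot (\<phi> l)" "c = Top l" and l': "l' < n - 2" "b = Bot (\<phi> l')" "d = Top l'"
      using arc[OF *(1) ac] arc[OF *(2) bd] by blast
    then have "l < l'" using mono *(3) by simp
    then show False using *(5) l l' by simp
  qed
  ultimately show ?thesis by (simp add: matchings_def partition_on_def)
qed

text \<open>The arc is cut off as a cap, and the rest of the diagram, with its bottom points
  renumbered, is stacked on it. This shows that the diagram belongs to the ideal.\<close>

lemma factor_through_cap:
  assumes D: "D \<in> matchings n n" and i: "Suc i < n" "{Bot i, Bot (Suc i)} \<in> D"
  obtains C E where "C \<in> matchings n (n - 2)" "E \<in> matchings (n - 2) n" "stack C E = D" "loops C E = 0"
proof -
  let ?b = "{Bot i, Bot (Suc i)}"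
  \<comment> \<open>\<open>\<psi>\<close> closes the gap left by \<open>i\<close> and
    \<open>Suc i\<close>, and \<open>\<phi>\<close> opens it again.\<close>
  define \<phi> where "\<phi> = (\<lambda>l. if l < i then l else l + 2)"
  define \<psi> where "\<psi> = (\<lambda>l. if l < i then l else l - (2 :: nat))"
  let ?r = "relabel \<psi>"
  define S where "S = boundary n n - ?b"
  define D' where "D' = D - {?b}"
  define E where "E = (`) ?r ` D'"
  note m = matchings_arcs[OF D]
  have UD': "\<Union>D' = S"
  proof -
    have "e \<inter> ?b = {}" if "e \<in> D'" for e using disjointD[OF m(1) _ i(2)] that by (auto simp: D'_def)
    then show ?thesis using m(3) i(2) by (auto simp: D'_def S_def)
  qed
  have S_Bot: "l \<noteq> i \<and> l \<noteq> Suc i \<and> l < n" if "Bot l \<in> S" for l using that by (auto simp: S_def boundary_def)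
  have S_Top: "l < n" if "Top l \<in> S" for l using that by (auto simp: S_def boundary_def)
  have pos: "position (n - 2) n (?r x) < position (n - 2) n (?r y) \<longleftrightarrow> position n n x < position n n y"
    if "x \<in> S" "y \<in> S" for x y
    using that S_Bot S_Top i(1) by (cases x; cases y) (auto simp: \<psi>_def dest: S_Bot S_Top)
  have restore: "relabel \<phi> (?r x) = x" if "x \<in> S" for x
    using that S_Bot by (cases x) (auto simp: \<psi>_def \<phi>_def dest: S_Bot)
  have inj: "inj_on ?r S" by (rule inj_on_inverseI[where g = "relabel \<phi>"]) (rule restore)
  have img: "?r ` S = boundary (n - 2) n"
  proof
    show "?r ` S \<subseteq> boundary (n - 2) n"
    proof
      fix p assume "p \<in> ?r ` S"
      then obtain x where x: "x \<in> S" "p = ?r x" by blast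
      then show "p \<in> boundary (n - 2) n"
        using S_Bot S_Top i(1) by (cases x) (auto simp: \<psi>_def boundary_def dest: S_Bot S_Top)
    qed
    show "boundary (n - 2) n \<subseteq> ?r ` S"
    proof
      fix p assume p: "p \<in> boundary (n - 2) n"
      have "relabel \<phi> p \<in> S" "?r (relabel \<phi> p) = p"
        using p i(1) by (cases p; auto simp: \<psi>_def \<phi>_def boundary_def S_def)+
      then show "p \<in> ?r ` S" by (metis imageI)
    qed
  qed
  have E_m: "E \<in> matchings (n - 2) n"
  proof -
    have dj: "disjoint E" unfolding E_def
    proof (rule disjoint_image)
      show "inj_on ?r (\<Union>D')" using inj UD' by simp
      show "disjoint D'" unfolding D'_def by (rule pairwise_subset[OF m(1)]) blast
    qed
    have U: "\<Union>E = boundary (n - 2) n" unfolding E_def using UD' img by (metis image_Union)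
    have c2: "card e = 2" if e: "e \<in> E" for e
    proof -
      obtain e' where e': "e' \<in> D'" "e = ?r ` e'" using e by (auto simp: E_def)
      have "e' \<subseteq> S" using e' UD' by blast
      then have "card e = card e'" using e' card_image[OF inj_on_subset[OF inj]] by blast
      then show ?thesis using m(4) e' by (simp add: D'_def)
    qed
    have "{} \<notin> E" using c2 by force
    moreover have "crossingless (n - 2) n E" unfolding crossingless_def
    proof
      let ?p = "position (n - 2) n"
      assume "\<exists>a b c d. {a, c} \<in> E \<and> {b, d} \<in> E \<and> ?p a < ?p b \<and> ?p b < ?p c \<and> ?p c < ?p d"
      then obtain a b c d where *: "{a, c} \<in> E" "{b, d} \<in> E" "?p a < ?p b" "?p b < ?p c" "?p c < ?p d" by blast
      have pre: "\<exists>x' y'. x' \<in> S \<and> y' \<in> S \<and> x = ?r x' \<and> y = ?r y' \<and> {x', y'} \<in> D" if xy: "{x, y} \<in> E" for x y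
      proof -
        obtain e where e: "e \<in> D'" "{x, y} = ?r ` e" using xy by (auto simp: E_def)
        obtain x' where x': "x' \<in> e" "x = ?r x'" using e(2) by blast
        obtain y' where y': "y' \<in> e" "y = ?r y'" using e(2) by blast
        have "card {x, y} = 2" using c2[OF xy] .
        then have "x' \<noteq> y'" using x' y' by auto
        moreover have "card e = 2" using e m(4) by (simp add: D'_def)
        ultimately have "e = {x', y'}" using x' y' by (auto simp: card_2_iff)
        moreover have "e \<subseteq> S" using e UD' by blast
        ultimately show ?thesis using x' y' e by (auto simp: D'_def)
      qed
      obtain a' c' where ac: "a' \<in> S" "c' \<in> S" "a = ?r a'" "c = ?r c'" "{a', c'} \<in> D" using pre[OF *(1)] by blast
      obtain b' d' where bd: "b' \<in> S" "d' \<in> S" "b = ?r b'" "d = ?r d'" "{b', d'} \<in> D" using pre[OF *(2)] by blast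
      have "position n n a' < position n n b'" "position n n b' < position n n c'" "position n n c' < position n n d'"
        using *(3-5) pos ac bd by simp_all
      then show False using D ac bd unfolding matchings_def crossingless_def by blast
    qed
    ultimately show ?thesis using dj U c2 by (simp add: matchings_def partition_on_def)
  qed
  note mE = matchings_arcs[OF E_m]
  have B: "\<exists>i'. p = Bot i' \<and> i' \<notin> \<phi> ` {..<n - 2}" if "b \<in> {?b}" "p \<in> b" for b p
    using that by (auto simp: \<phi>_def split: if_splits)
  have L: "Bot l \<in> \<Union>E \<longleftrightarrow> l \<in> {..<n - 2}" for l using mE(3) by (auto simp: boundary_def)
  have inj\<phi>: "inj_on \<phi> {..<n - 2}" by (rule inj_onI) (auto simp: \<phi>_def split: if_splits)
  have "stack ({?b} \<union> through \<phi> {..<n - 2}) E = {?b} \<union> (`) (relabel \<phi>) ` E"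
    by (rule stack_through[OF inj\<phi> _ _ B mE(1,2) L]) (auto simp: disjoint_def)
  also have "(`) (relabel \<phi>) ` E = D'"
  proof -
    have "relabel \<phi> ` ?r ` e = e" if "e \<in> D'" for e
    proof -
      have "relabel \<phi> (?r x) = x" if "x \<in> e" for x using restore UD' \<open>e \<in> D'\<close> that by blast
      then show ?thesis by (simp add: image_image)
    qed
    then show ?thesis unfolding E_def image_image by simp
  qed
  also have "{?b} \<union> D' = D" using i(2) by (auto simp: D'_def)
  finally have st: "stack ({?b} \<union> through \<phi> {..<n - 2}) E = D" .
  have lp: "loops ({?b} \<union> through \<phi> {..<n - 2}) E = 0"
    by (rule stack_through[OF inj\<phi> _ _ B mE(1,2) L]) (auto simp: disjoint_def)
  show ?thesis using that[OF cap_in_matchings[OF i(1)] E_m] st lp by (simp add: \<phi>_def)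
qed

section \<open>The projector\<close>

abbreviation "lookup \<equiv> Poly_Mapping.lookup"
abbreviation "keys \<equiv> Poly_Mapping.keys"
abbreviation "single \<equiv> Poly_Mapping.single"

lemma single_sum: "single k (sum f X) = (\<Sum>x\<in>X. single k (f x))"
  by (induction X rule: infinite_finite_induct) (simp_all add: single_add)

lemma sum_single_lookup: "finite X \<Longrightarrow> keys f \<subseteq> X \<Longrightarrow> (\<Sum>D\<in>X. single D (lookup f D)) = f"
proof (rule poly_mapping_eqI)
  fix E assume X: "finite X" "keys f \<subseteq> X"
  have "lookup (\<Sum>D\<in>X. single D (lookup f D)) E = (\<Sum>D\<in>X. if D = E then lookup f D else 0)"
    by (simp add: lookup_sum lookup_single when_def)
  also have "\<dots> = lookup f E" using X by (auto simp: sum.delta in_keys_iff)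
  finally show "lookup (\<Sum>D\<in>X. single D (lookup f D)) E = lookup f E" .
qed

lemma lookup_map: "f 0 = 0 \<Longrightarrow> lookup (Poly_Mapping.map f p) k = f (lookup p k)"
  by (simp add: Poly_Mapping.map.rep_eq when_def)

text \<open>Enlarging the index sets adds only zero terms. Index sets that do not depend on the
  morphisms make linearity of the composition visible.\<close>

lemma tl_comp_superset:
  assumes "finite X" "keys g \<subseteq> X" "finite Y" "keys f \<subseteq> Y"
  shows "tl_comp d g f = (\<Sum>E\<in>X. \<Sum>D\<in>Y. single (stack D E) (lookup g E * lookup f D * (- d) ^ loops D E))"
proof -
  have "tl_comp d g f = (\<Sum>E\<in>keys g. \<Sum>D\<in>Y. single (stack D E) (lookup g E * lookup f D * (- d) ^ loops D E))"
    unfolding tl_comp_def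
    by (intro sum.cong refl sum.mono_neutral_left) (use assms in \<open>auto simp: in_keys_iff\<close>)
  also have "\<dots> = (\<Sum>E\<in>X. \<Sum>D\<in>Y. single (stack D E) (lookup g E * lookup f D * (- d) ^ loops D E))"
    by (rule sum.mono_neutral_left) (use assms in \<open>auto simp: in_keys_iff\<close>)
  finally show ?thesis .
qed

lemma tl_comp_add_right: "tl_comp d g (f + f') = tl_comp d g f + tl_comp d g f'"
proof -
  let ?Y = "keys f \<union> keys f'"
  have "tl_comp d g (f + f') = (\<Sum>E\<in>keys g. \<Sum>D\<in>?Y. single (stack D E) (lookup g E * lookup (f + f') D * (- d) ^ loops D E))"
    by (rule tl_comp_superset) (use keys_add[of f f'] in auto)
  also have "\<dots> = (\<Sum>E\<in>keys g. \<Sum>D\<in>?Y. single (stack D E) (lookup g E * lookup f D * (- d) ^ loops D E))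
      + (\<Sum>E\<in>keys g. \<Sum>D\<in>?Y. single (stack D E) (lookup g E * lookup f' D * (- d) ^ loops D E))"
    by (simp add: lookup_add distrib_left distrib_right single_add sum.distrib)
  also have "(\<Sum>E\<in>keys g. \<Sum>D\<in>?Y. single (stack D E) (lookup g E * lookup f D * (- d) ^ loops D E)) = tl_comp d g f"
    by (rule tl_comp_superset[symmetric]) auto
  also have "(\<Sum>E\<in>keys g. \<Sum>D\<in>?Y. single (stack D E) (lookup g E * lookup f' D * (- d) ^ loops D E)) = tl_comp d g f'"
    by (rule tl_comp_superset[symmetric]) auto
  finally show ?thesis .
qed

lemma tl_comp_id_right:
  assumes J: "J \<in> tl_hom n k" shows "tl_comp d J (tl_id n) = J"
proof -
  have kJ: "keys J \<subseteq> matchings n k" using J by (simp add: tl_hom_def)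
  have id: "stack (id_matching n) E = E" "loops (id_matching n) E = 0" if "E \<in> matchings n k" for E
  proof -
    note m = matchings_arcs[OF that]
    have L: "Bot l \<in> \<Union>E \<longleftrightarrow> l \<in> {..<n}" for l using m(3) by (auto simp: boundary_def)
    have "stack ({} \<union> through (\<lambda>l. l) {..<n}) E = {} \<union> E" "loops ({} \<union> through (\<lambda>l. l) {..<n}) E = 0"
      by (rule stack_through_id; use m L in \<open>simp add: disjoint_def\<close>)+
    then show "stack (id_matching n) E = E" "loops (id_matching n) E = 0"
      by (simp_all add: id_matching_eq_through)
  qed
  have "tl_comp d J (tl_id n) = (\<Sum>E\<in>matchings n k. \<Sum>D\<in>{id_matching n}.
      single (stack D E) (lookup J E * lookup (tl_id n) D * (- d) ^ loops D E))"
    by (rule tl_comp_superset) (use kJ finite_matchings in \<open>auto simp: tl_id_def split: if_splits\<close>)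
  also have "\<dots> = (\<Sum>E\<in>matchings n k. single E (lookup J E))"
    by (rule sum.cong) (simp_all add: id tl_id_def)
  also have "\<dots> = J" by (rule sum_single_lookup[OF finite_matchings kJ])
  finally show ?thesis .
qed

text \<open>A diagram with the cup \<open>{Top i, Top (i + 1)}\<close> sees a diagram on top of it only through the
  contraction of the latter at \<open>Bot i\<close> and \<open>Bot (i + 1)\<close>.\<close>

lemma stack_cup_contract:
  fixes c d r :: "'a::{comm_ring, comm_monoid_mult}"
  assumes i: "Suc i < n" and F: "disjoint F" "finite F" "{Top i, Top (Suc i)} \<in> F"
    and E: "E \<in> matchings n n"
  defines "F0 \<equiv> F - {{Top i, Top (Suc i)}}" and "E0 \<equiv> merge (Bot i) (Bot (Suc i)) E"
  shows "single (\<Phi> (stack F E)) (c * (r * (- d) ^ loops F E))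
    = single (\<Phi> (stack F0 E0)) ((if {Bot i, Bot (Suc i)} \<in> E then - d * c else c) * (r * (- d) ^ loops F0 E0))"
proof -
  note m = matchings_arcs[OF E]
  have b: "Bot i \<in> \<Union>E" "Bot (Suc i) \<in> \<Union>E" using i by (auto simp: m(3) boundary_def)
  have *: "stack F E = stack F0 E0" "loops F E = loops F0 E0 + (if {Bot i, Bot (Suc i)} \<in> E then 1 else 0)"
    unfolding F0_def E0_def by (rule stack_contract[OF F(1,3) _ m(1) m(4) b m(5) F(2)]; simp)+
  have "c * (r * (- d) ^ Suc l) = (- d * c) * (r * (- d) ^ l)" for l
    by (simp only: power_Suc mult_ac)
  then show ?thesis unfolding * by (cases "{Bot i, Bot (Suc i)} \<in> E") simp_all
qed

text \<open>Grouping the diagrams by their contraction turns the inner sums into coefficients that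
  vanish. \<open>\<Phi>\<close> will be the identity or the reflection, so that one proof serves
  products on both sides.\<close>

lemma null_at_comp_cup:
  assumes null: "null_at d n (Bot i) (Bot (Suc i)) c" and i: "Suc i < n"
    and F: "disjoint F" "finite F" "{Top i, Top (Suc i)} \<in> F"
  shows "(\<Sum>E\<in>matchings n n. single (\<Phi> (stack F E)) (c E * (r * (- d) ^ loops F E))) = 0"
proof -
  let ?M = "matchings n n"
  let ?m = "merge (Bot i) (Bot (Suc i))"
  let ?F = "F - {{Top i, Top (Suc i)}}"
  let ?w = "\<lambda>E. if {Bot i, Bot (Suc i)} \<in> E then - d * c E else c E"
  have "(\<Sum>E\<in>?M. single (\<Phi> (stack F E)) (c E * (r * (- d) ^ loops F E)))
      = (\<Sum>E\<in>?M. single (\<Phi> (stack ?F (?m E))) (?w E * (r * (- d) ^ loops ?F (?m E))))"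
    by (rule sum.cong[OF refl]) (rule stack_cup_contract[OF i F])
  also have "\<dots> = (\<Sum>G\<in>?m ` ?M. \<Sum>E\<in>{E \<in> ?M. ?m E = G}. single (\<Phi> (stack ?F (?m E))) (?w E * (r * (- d) ^ loops ?F (?m E))))"
    by (rule sum.image_gen[OF finite_matchings])
  also have "\<dots> = (\<Sum>G\<in>?m ` ?M. single (\<Phi> (stack ?F G)) ((\<Sum>E\<in>{E \<in> ?M. ?m E = G}. ?w E) * (r * (- d) ^ loops ?F G)))"
    unfolding single_sum sum_distrib_right by (intro sum.cong refl) auto
  also have "\<dots> = 0"
  proof (rule sum.neutral, rule ballI)
    fix G
    have "(\<Sum>E\<in>{E \<in> ?M. ?m E = G}. ?w E) = 0" using null by (simp add: null_at_def fibres_vanish_def)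
    then show "single (\<Phi> (stack ?F G)) ((\<Sum>E\<in>{E \<in> ?M. ?m E = G}. ?w E) * (r * (- d) ^ loops ?F G)) = 0" by simp
  qed
  finally show ?thesis .
qed

text \<open>Stacking on \<open>cup_cap\<close> adds the arc \<open>{Bot i, Bot (Suc i)}\<close> to
  the contracted diagram. Different contractions therefore stay different, and their coefficients
  can be read off.\<close>

lemma null_at_of_comp_cup_cap:
  assumes i: "Suc i < n" and \<Phi>: "inj \<Phi>"
    and zero: "(\<Sum>E\<in>matchings n n. single (\<Phi> (stack (cup_cap n i) E)) (c E * (1 * (- d) ^ loops (cup_cap n i) E))) = 0"
  shows "null_at d n (Bot i) (Bot (Suc i)) c"
  unfolding null_at_def fibres_vanish_iff
proof
  let ?M = "matchings n n"
  let ?m = "merge (Bot i) (Bot (Suc i))"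
  let ?b = "{Bot i, Bot (Suc i)}"
  let ?w = "\<lambda>E. if ?b \<in> E then - d * c E else c E"
  let ?L = "{..<n} - {i, Suc i}"
  let ?F = "cup_cap n i"
  note U = matchings_arcs[OF cup_cap_in_matchings[OF i]]
  have t: "{Top i, Top (Suc i)} \<in> ?F" by (simp add: cup_cap_def)
  have F0: "?F - {{Top i, Top (Suc i)}} = {?b} \<union> through (\<lambda>l. l) ?L"
    unfolding cup_cap_def through_def by (auto simp: doubleton_eq_iff)
  have st: "stack ({?b} \<union> through (\<lambda>l. l) ?L) (?m E) = insert ?b (?m E)"
    "loops ({?b} \<union> through (\<lambda>l. l) ?L) (?m E) = 0" "?b \<notin> ?m E" if E: "E \<in> ?M" for E
  proof -
    note m = matchings_arcs[OF E]
    have b: "Bot i \<in> \<Union>E" "Bot (Suc i) \<in> \<Union>E" using i by (auto simp: m(3) boundary_def)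
    note mm = merge_matching[OF m(1,4) b, simplified]
    have "{} \<notin> ?m E" using mm(2) by force
    moreover have "Bot l \<in> \<Union>(?m E) \<longleftrightarrow> l \<in> ?L" for l using mm(3) m(3) by (auto simp: boundary_def)
    ultimately have "stack ({?b} \<union> through (\<lambda>l. l) ?L) (?m E) = {?b} \<union> ?m E \<and> loops ({?b} \<union> through (\<lambda>l. l) ?L) (?m E) = 0"
      by (intro conjI stack_through_id mm(1)) (auto simp: disjoint_def)
    then show "stack ({?b} \<union> through (\<lambda>l. l) ?L) (?m E) = insert ?b (?m E)"
      "loops ({?b} \<union> through (\<lambda>l. l) ?L) (?m E) = 0" by simp_all
    show "?b \<notin> ?m E" using mm(3) by blast
  qed
  fix E0 assume E0: "E0 \<in> ?M"
  have "0 = (\<Sum>E\<in>?M. single (\<Phi> (stack ?F E)) (c E * (1 * (- d) ^ loops ?F E)))" using zero by simp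
  also have "\<dots> = (\<Sum>E\<in>?M. single (\<Phi> (insert ?b (?m E))) (?w E))"
  proof (rule sum.cong[OF refl])
    fix E assume E: "E \<in> ?M"
    show "single (\<Phi> (stack ?F E)) (c E * (1 * (- d) ^ loops ?F E)) = single (\<Phi> (insert ?b (?m E))) (?w E)"
      unfolding stack_cup_contract[OF i U(1,5) t E] F0 st(1)[OF E] st(2)[OF E] by simp
  qed
  finally have "0 = lookup (\<Sum>E\<in>?M. single (\<Phi> (insert ?b (?m E))) (?w E)) (\<Phi> (insert ?b (?m E0)))" by simp
  also have "\<dots> = (\<Sum>E\<in>?M. if ?m E = ?m E0 then ?w E else 0)"
    unfolding lookup_sum
  proof (rule sum.cong[OF refl])
    fix E assume E: "E \<in> ?M"
    have "\<Phi> (insert ?b (?m E)) = \<Phi> (insert ?b (?m E0)) \<longleftrightarrow> ?m E = ?m E0"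
      using inj_eq[OF \<Phi>] st(3)[OF E] st(3)[OF E0] by (metis insert_ident)
    then show "lookup (single (\<Phi> (insert ?b (?m E))) (?w E)) (\<Phi> (insert ?b (?m E0))) = (if ?m E = ?m E0 then ?w E else 0)"
      by (simp add: lookup_single when_def)
  qed
  also have "\<dots> = (\<Sum>E\<in>{E \<in> ?M. ?m E = ?m E0}. ?w E)"
    by (rule sum.inter_filter[symmetric, OF finite_matchings])
  finally show "(\<Sum>E\<in>{E \<in> ?M. ?m E = ?m E0}. ?w E) = 0" by simp
qed

section \<open>Diagrams occurring in the ideal\<close>

text \<open>The arc at the top contracts whatever is stacked above, the arc at the bottom whatever
  is stacked below.\<close>

definition reducible :: "nat \<Rightarrow> point set set \<Rightarrow> bool" where
  "reducible n F \<longleftrightarrow> disjoint F \<and> finite F \<and>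
     (\<exists>i. Suc i < n \<and> {Bot i, Bot (Suc i)} \<in> F) \<and> (\<exists>i. Suc i < n \<and> {Top i, Top (Suc i)} \<in> F)"

text \<open>Such an arc has no end in the middle, so it is a component by itself.\<close>

lemma stack_bottom_arc:
  assumes D: "disjoint D" and e: "{Bot i, Bot j} \<in> D"
  shows "{Bot i, Bot j} \<in> stack D E"
proof -
  have up: "Low l \<notin> from_upper ` f" for l f
  proof -
    have "from_upper p \<noteq> Low l" for p by (cases p) auto
    then show ?thesis by (metis imageE)
  qed
  have "from_lower ` {Bot i, Bot j} \<in> comps (glued_edges D E)"
  proof (rule isolated_edge_in_comps)
    show "from_lower ` {Bot i, Bot j} \<in> glued_edges D E" using e unfolding glued_edges_def by blast
    fix f assume f: "f \<in> glued_edges D E" "f \<inter> from_lower ` {Bot i, Bot j} \<noteq> {}"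
    have "Low i \<in> f \<or> Low j \<in> f" using f(2) by auto
    then have "\<not> (\<exists>g\<in>E. f = from_upper ` g)" using up by blast
    then obtain g where g: "g \<in> D" "f = from_lower ` g" using f(1) unfolding glued_edges_def by blast
    obtain y where y: "y \<in> f" "y \<in> from_lower ` {Bot i, Bot j}" using f(2) by blast
    obtain p where p: "p \<in> g" "y = from_lower p" using y(1) unfolding g(2) by (rule imageE)
    obtain q where q: "q \<in> {Bot i, Bot j}" "y = from_lower q" using y(2) by (rule imageE)
    have "p = q" using p(2) q(2) injD[OF inj_from_lower] by simp
    then have "p \<in> g \<inter> {Bot i, Bot j}" using p(1) q(1) by simp
    then have "g = {Bot i, Bot j}" using disjointD[OF D g(1) e] by blast
    then show "f = from_lower ` {Bot i, Bot j}" using g by simp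
  qed simp
  then have C: "{Low i, Low j} \<in> components D E" by (simp add: components_eq_comps)
  have "outer p = Low l \<longleftrightarrow> p = Bot l" for p l by (cases p) auto
  then have o: "outer -` {Low i, Low j} = {Bot i, Bot j}" by auto
  have "outer -` {Low i, Low j} \<in> (\<lambda>C. outer -` C) ` components D E" using C by (rule imageI)
  then show ?thesis unfolding o stack_eq by simp
qed

lemma disjoint_stack: "disjoint (stack D E)"
proof (rule disjointI)
  fix a b assume "a \<in> stack D E" "b \<in> stack D E" "a \<noteq> b"
  then have "a \<in> (\<lambda>C. outer -` C) ` components D E" "b \<in> (\<lambda>C. outer -` C) ` components D E" "a \<noteq> b"
    by (simp_all add: stack_eq)
  then obtain C C' where C: "C \<in> components D E" "C' \<in> components D E" "a = outer -` C" "b = outer -` C'" "C \<noteq> C'"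
    by blast
  then have "C \<inter> C' = {}" using comps_disjoint unfolding components_eq_comps by blast
  then show "a \<inter> b = {}" using C by auto
qed

text \<open>The lower diagram has fewer points above than below, hence an arc between bottom
  neighbours, and this survives stacking. The arc at the top follows by reflection.\<close>

lemma stack_reducible:
  assumes D: "D \<in> matchings n k" and E: "E \<in> matchings k n" and k: "k < n"
  shows "reducible n (stack D E)"
proof -
  note mD = matchings_arcs[OF D]
  have fE: "flips E \<in> matchings n k" "flips D \<in> matchings k n" using flips_matchings D E by blast+
  note mE = matchings_arcs[OF fE(1)]
  obtain i where i: "Suc i < n" "{Bot i, Bot (Suc i)} \<in> D" using matching_bottom_arc[OF D] k by blast
  obtain j where j: "Suc j < n" "{Bot j, Bot (Suc j)} \<in> flips E" using matching_bottom_arc[OF fE(1)] k by blast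
  have "{Bot j, Bot (Suc j)} \<in> stack (flips E) (flips D)" by (rule stack_bottom_arc[OF mE(1) j(2)])
  then have "flip ` {Bot j, Bot (Suc j)} \<in> flips (flips (stack D E))" unfolding stack_flips by blast
  then have "{Top j, Top (Suc j)} \<in> stack D E" by simp
  moreover have "finite (stack D E)"
    unfolding stack_eq using finite_components[OF mD(5) matchings_arcs(5)[OF E]] by simp
  ultimately show ?thesis
    unfolding reducible_def using disjoint_stack i j(1) stack_bottom_arc[OF mD(1) i(2)] by blast
qed

lemma keys_tl_comp: "keys (tl_comp d g f) \<subseteq> {stack D E |D E. D \<in> keys f \<and> E \<in> keys g}"
proof
  fix F assume F: "F \<in> keys (tl_comp d g f)"
  show "F \<in> {stack D E |D E. D \<in> keys f \<and> E \<in> keys g}"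
  proof (rule ccontr)
    assume *: "\<not> ?thesis"
    have "lookup (tl_comp d g f) F = 0"
      unfolding tl_comp_def lookup_sum
      by (intro sum.neutral ballI) (use * in \<open>auto simp: lookup_single when_def\<close>)
    then show False using F by (simp add: in_keys_iff)
  qed
qed

lemma tl_ideal_reducible: "x \<in> tl_ideal d n \<Longrightarrow> F \<in> keys x \<Longrightarrow> reducible n F"
proof (induction rule: tl_ideal.induct)
  case (add x k f g c)
  show ?case
  proof (cases "F \<in> keys x")
    case False
    then have "lookup (Poly_Mapping.map ((*) c) (tl_comp d g f)) F \<noteq> 0"
      using add.prems by (auto simp: in_keys_iff lookup_add)
    then have "F \<in> keys (tl_comp d g f)" by (auto simp: lookup_map in_keys_iff)
    then obtain D E where "F = stack D E" "D \<in> keys f" "E \<in> keys g" using keys_tl_comp by blast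
    then show ?thesis using stack_reducible[of D n k E] add.hyps(2-4) by (auto simp: tl_hom_def)
  qed (use add in blast)
qed simp

lemma tl_ideal_add: "y \<in> tl_ideal d n \<Longrightarrow> x \<in> tl_ideal d n \<Longrightarrow> x + y \<in> tl_ideal d n"
proof (induction rule: tl_ideal.induct)
  case (add y k f g c)
  have "(x + y) + Poly_Mapping.map ((*) c) (tl_comp d g f) \<in> tl_ideal d n"
    by (rule tl_ideal.add[OF add.IH[OF add.prems] add.hyps(2-4)])
  then show ?case by (simp add: add.assoc)
qed simp

lemma tl_ideal_sum: "(\<And>i. i \<in> X \<Longrightarrow> f i \<in> tl_ideal d n) \<Longrightarrow> sum f X \<in> tl_ideal d n"
  by (induction X rule: infinite_finite_induct) (auto simp: tl_ideal.zero intro: tl_ideal_add)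

lemma single_in_tl_ideal:
  assumes F: "F \<in> matchings n n" and i: "Suc i < n" "{Bot i, Bot (Suc i)} \<in> F"
  shows "single F r \<in> tl_ideal d n"
proof -
  obtain C E where CE: "C \<in> matchings n (n - 2)" "E \<in> matchings (n - 2) n" "stack C E = F" "loops C E = 0"
    using factor_through_cap[OF F i] .
  have "tl_comp d (single E 1) (single C 1) = (\<Sum>E'\<in>{E}. \<Sum>D\<in>{C}.
      single (stack D E') (lookup (single E 1) E' * lookup (single C 1) D * (- d) ^ loops D E'))"
    by (rule tl_comp_superset) (auto split: if_splits)
  then have c: "tl_comp d (single E 1) (single C 1) = single F 1" using CE by simp
  have "0 + Poly_Mapping.map ((*) r) (tl_comp d (single E 1) (single C 1)) \<in> tl_ideal d n"
    by (rule tl_ideal.add[OF tl_ideal.zero, of "n - 2"]) (use CE i(1) in \<open>auto simp: tl_hom_def split: if_splits\<close>)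
  moreover have "Poly_Mapping.map ((*) r) (single F 1) = single F r"
    by (rule poly_mapping_eqI) (simp add: lookup_map lookup_single when_def)
  ultimately show ?thesis unfolding c by simp
qed

lemma comp_reducible_right:
  assumes J: "J \<in> tl_hom n n"
    and null: "\<And>i. Suc i < n \<Longrightarrow> null_at d n (Bot i) (Bot (Suc i)) (lookup J)"
    and x: "\<And>F. F \<in> keys x \<Longrightarrow> reducible n F"
  shows "tl_comp d J x = 0"
proof -
  have "tl_comp d J x = (\<Sum>E\<in>matchings n n. \<Sum>F\<in>keys x. single (stack F E) (lookup J E * lookup x F * (- d) ^ loops F E))"
    by (rule tl_comp_superset) (use J finite_matchings in \<open>auto simp: tl_hom_def\<close>)
  also have "\<dots> = (\<Sum>F\<in>keys x. \<Sum>E\<in>matchings n n. single (stack F E) (lookup J E * (lookup x F * (- d) ^ loops F E)))"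
    by (subst sum.swap) (simp add: mult.assoc)
  also have "\<dots> = 0"
  proof (rule sum.neutral, rule ballI)
    fix F assume "F \<in> keys x"
    then obtain i where "disjoint F" "finite F" "Suc i < n" "{Top i, Top (Suc i)} \<in> F"
      using x unfolding reducible_def by blast
    then show "(\<Sum>E\<in>matchings n n. single (stack F E) (lookup J E * (lookup x F * (- d) ^ loops F E))) = 0"
      using null_at_comp_cup[OF null, of i F "\<lambda>F. F"] by blast
  qed
  finally show ?thesis .
qed

text \<open>Multiplication by \<open>F\<close> from above becomes the reflection of multiplication
  by the reflected \<open>F\<close> from below, where the contraction lemmas apply.\<close>

lemma sum_stack_flip:
  "(\<Sum>E\<in>matchings n n. single (stack E F) (c E * (r * (- d) ^ loops E F)))
   = (\<Sum>E\<in>matchings n n. single (flips (stack (flips F) E)) (c (flips E) * (r * (- d) ^ loops (flips F) E)))"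
proof -
  have "(\<Sum>E\<in>matchings n n. single (stack E F) (c E * (r * (- d) ^ loops E F)))
     = (\<Sum>E\<in>matchings n n. single (stack (flips E) F) (c (flips E) * (r * (- d) ^ loops (flips E) F)))"
    by (rule sum.reindex_bij_betw[OF bij_flips, symmetric])
  also have "\<dots> = (\<Sum>E\<in>matchings n n. single (flips (stack (flips F) E)) (c (flips E) * (r * (- d) ^ loops (flips F) E)))"
  proof (rule sum.cong[OF refl])
    fix E
    show "single (stack (flips E) F) (c (flips E) * (r * (- d) ^ loops (flips E) F))
      = single (flips (stack (flips F) E)) (c (flips E) * (r * (- d) ^ loops (flips F) E))"
      using stack_flips[of E "flips F"] loops_flips[of E "flips F"] by simp
  qed
  finally show ?thesis .
qed

lemma comp_reducible_left:
  assumes J: "J \<in> tl_hom n n"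
    and null: "\<And>i. Suc i < n \<Longrightarrow> null_at d n (Top i) (Top (Suc i)) (lookup J)"
    and x: "\<And>F. F \<in> keys x \<Longrightarrow> reducible n F"
  shows "tl_comp d x J = 0"
proof -
  have "tl_comp d x J = (\<Sum>F\<in>keys x. \<Sum>E\<in>matchings n n. single (stack E F) (lookup x F * lookup J E * (- d) ^ loops E F))"
    by (rule tl_comp_superset) (use J finite_matchings in \<open>auto simp: tl_hom_def\<close>)
  also have "\<dots> = (\<Sum>F\<in>keys x. \<Sum>E\<in>matchings n n. single (stack E F) (lookup J E * (lookup x F * (- d) ^ loops E F)))"
    by (simp add: mult_ac)
  also have "\<dots> = 0"
  proof (rule sum.neutral, rule ballI)
    fix F assume "F \<in> keys x"
    then obtain i where F: "disjoint F" "finite F" "Suc i < n" "{Bot i, Bot (Suc i)} \<in> F"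
      using x unfolding reducible_def by blast
    have "flip ` {Bot i, Bot (Suc i)} \<in> flips F" using F(4) by blast
    then have top: "{Top i, Top (Suc i)} \<in> flips F" by simp
    have dj: "disjoint (flips F)" by (rule disjoint_image[OF inj_on_subset[OF inj_flip] F(1)]) simp
    have "null_at d n (Bot i) (Bot (Suc i)) (\<lambda>E. lookup J (flips E))"
      using null_at_flip[of d n "Bot i" "Bot (Suc i)" "lookup J"] null[OF F(3)] by simp
    from null_at_comp_cup[OF this F(3) dj _ top, of flips]
    show "(\<Sum>E\<in>matchings n n. single (stack E F) (lookup J E * (lookup x F * (- d) ^ loops E F))) = 0"
      unfolding sum_stack_flip using F(2) by simp
  qed
  finally show ?thesis .
qed

lemma reducible_ne_id: "reducible n F \<Longrightarrow> F \<noteq> id_matching n"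
  by (auto simp: reducible_def id_matching_def doubleton_eq_iff)

text \<open>Every diagram except the identity lies in the ideal, and the identity occurs in no
  element of it; so \<open>1 - J\<close> lies in the ideal exactly if the identity has coefficient 1
  in \<open>J\<close>. Annihilation of the ideal is tested on the elements
  \<open>cup_cap n i\<close>.\<close>

lemma jones_wenzl_iff_null:
  "(\<exists>J. jones_wenzl_projector d n J) \<longleftrightarrow> (\<exists>c. c (id_matching n) = 1 \<and>
     (\<forall>i. Suc i < n \<longrightarrow> null_at d n (Bot i) (Bot (Suc i)) c \<and> null_at d n (Top i) (Top (Suc i)) c))"
proof
  assume "\<exists>J. jones_wenzl_projector d n J"
  then obtain J where J: "J \<in> tl_hom n n"
    and I: "\<And>x. x \<in> tl_ideal d n \<Longrightarrow> tl_comp d J x = 0 \<and> tl_comp d x J = 0"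
    and id: "tl_id n - J \<in> tl_ideal d n" unfolding jones_wenzl_projector_def by blast
  have "id_matching n \<notin> keys (tl_id n - J)" using tl_ideal_reducible[OF id] reducible_ne_id by blast
  then have "lookup J (id_matching n) = 1"
    by (simp add: in_keys_iff lookup_minus tl_id_def)
  moreover have "null_at d n (Bot i) (Bot (Suc i)) (lookup J) \<and> null_at d n (Top i) (Top (Suc i)) (lookup J)"
    if i: "Suc i < n" for i
  proof
    let ?U = "cup_cap n i"
    have mem: "single ?U 1 \<in> tl_ideal d n"
      by (rule single_in_tl_ideal[OF cup_cap_in_matchings[OF i] i]) (simp add: cup_cap_def)
    have kJ: "keys J \<subseteq> matchings n n" using J by (simp add: tl_hom_def)
    have "tl_comp d J (single ?U 1) = (\<Sum>E\<in>matchings n n. \<Sum>F\<in>{?U}. single (stack F E) (lookup J E * lookup (single ?U 1) F * (- d) ^ loops F E))"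
      by (rule tl_comp_superset) (use kJ finite_matchings in \<open>auto split: if_splits\<close>)
    then have "(\<Sum>E\<in>matchings n n. single (stack ?U E) (lookup J E * (1 * (- d) ^ loops ?U E))) = 0"
      using I[OF mem] by simp
    then show "null_at d n (Bot i) (Bot (Suc i)) (lookup J)"
      by (intro null_at_of_comp_cup_cap[OF i, where \<Phi> = "\<lambda>F. F"]) simp_all
    have "tl_comp d (single ?U 1) J = (\<Sum>F\<in>{?U}. \<Sum>E\<in>matchings n n. single (stack E F) (lookup (single ?U 1) F * lookup J E * (- d) ^ loops E F))"
      by (rule tl_comp_superset) (use kJ finite_matchings in \<open>auto split: if_splits\<close>)
    then have "(\<Sum>E\<in>matchings n n. single (stack E ?U) (lookup J E * (1 * (- d) ^ loops E ?U))) = 0"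
      using I[OF mem] by simp
    then have z: "(\<Sum>E\<in>matchings n n. single (flips (stack ?U E)) (lookup J (flips E) * (1 * (- d) ^ loops ?U E))) = 0"
      unfolding sum_stack_flip flips_cup_cap .
    have "inj flips" by (metis flips_flips injI)
    then have "null_at d n (Bot i) (Bot (Suc i)) (\<lambda>E. lookup J (flips E))"
      by (rule null_at_of_comp_cup_cap[OF i]) (rule z)
    then show "null_at d n (Top i) (Top (Suc i)) (lookup J)"
      using null_at_flip[of d n "Bot i" "Bot (Suc i)" "lookup J"] by simp
  qed
  ultimately show "\<exists>c. c (id_matching n) = 1 \<and>
     (\<forall>i. Suc i < n \<longrightarrow> null_at d n (Bot i) (Bot (Suc i)) c \<and> null_at d n (Top i) (Top (Suc i)) c)" by blast
next
  assume "\<exists>c. c (id_matching n) = 1 \<and>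
     (\<forall>i. Suc i < n \<longrightarrow> null_at d n (Bot i) (Bot (Suc i)) c \<and> null_at d n (Top i) (Top (Suc i)) c)"
  then obtain c where c: "c (id_matching n) = 1"
    and null: "\<And>i. Suc i < n \<Longrightarrow> null_at d n (Bot i) (Bot (Suc i)) c"
      "\<And>i. Suc i < n \<Longrightarrow> null_at d n (Top i) (Top (Suc i)) c" by blast
  let ?M = "matchings n n"
  define J where "J = (\<Sum>D\<in>?M. single D (c D))"
  have lookup_J: "lookup J E = (if E \<in> ?M then c E else 0)" for E
  proof -
    have "lookup J E = (\<Sum>D\<in>?M. if D = E then c D else 0)"
      by (simp add: J_def lookup_sum lookup_single when_def)
    then show ?thesis using finite_matchings[of n n] by (simp add: sum.delta)
  qed
  have J: "J \<in> tl_hom n n" unfolding tl_hom_def by (auto simp: in_keys_iff lookup_J split: if_splits)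
  have null_J: "null_at d n x y (lookup J)" if "null_at d n x y c" for x y
  proof -
    have "(\<Sum>D\<in>{D \<in> ?M. merge x y D = G}. if {x, y} \<in> D then - d * lookup J D else lookup J D)
      = (\<Sum>D\<in>{D \<in> ?M. merge x y D = G}. if {x, y} \<in> D then - d * c D else c D)" for G
      by (rule sum.cong) (simp_all add: lookup_J)
    then show ?thesis using that by (simp add: null_at_def fibres_vanish_def)
  qed
  have I: "tl_comp d J x = 0 \<and> tl_comp d x J = 0" if "x \<in> tl_ideal d n" for x
    using comp_reducible_right[OF J null_J[OF null(1)]] comp_reducible_left[OF J null_J[OF null(2)]]
      tl_ideal_reducible[OF that] by blast
  have "tl_id n - J = (\<Sum>D\<in>?M - {id_matching n}. single D (- c D))"
  proof -
    have "J = single (id_matching n) (c (id_matching n)) + (\<Sum>D\<in>?M - {id_matching n}. single D (c D))"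
      unfolding J_def by (rule sum.remove[OF finite_matchings id_in_matchings])
    then show ?thesis by (simp add: c tl_id_def single_uminus sum_negf)
  qed
  also have "\<dots> \<in> tl_ideal d n"
  proof (rule tl_ideal_sum)
    fix D assume D: "D \<in> ?M - {id_matching n}"
    then have D1: "D \<in> matchings n n" by simp
    obtain i where "Suc i < n" "{Bot i, Bot (Suc i)} \<in> D" using matching_bottom_arc[OF D1] D by blast
    then show "single D (- c D) \<in> tl_ideal d n" by (rule single_in_tl_ideal[OF D1])
  qed
  finally have id: "tl_id n - J \<in> tl_ideal d n" .
  \<comment> \<open>\<open>J = J (1 - J) + J J\<close>, and \<open>J\<close> annihilates
    \<open>1 - J\<close>.\<close>
  have "J = tl_comp d J ((tl_id n - J) + J)" using tl_comp_id_right[OF J] by simp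
  also have "\<dots> = tl_comp d J J" unfolding tl_comp_add_right using I[OF id] by simp
  finally have "tl_comp d J J = J" by simp
  then show "\<exists>J. jones_wenzl_projector d n J"
    unfolding jones_wenzl_projector_def using J I id by blast
qed

lemma null_at_cong:
  assumes "\<And>D. D \<in> matchings n n \<Longrightarrow> c D = c' D" "null_at d n x y c"
  shows "null_at d n x y c'"
proof -
  have "(\<Sum>D\<in>{D \<in> matchings n n. merge x y D = G}. if {x, y} \<in> D then - d * c' D else c' D)
    = (\<Sum>D\<in>{D \<in> matchings n n. merge x y D = G}. if {x, y} \<in> D then - d * c D else c D)" for G
    by (rule sum.cong) (simp_all add: assms(1))
  then show ?thesis using assms(2) by (simp add: null_at_def fibres_vanish_def)
qed

lemma jones_wenzl_iff_null_contractions: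
  "(\<exists>J. jones_wenzl_projector d n J) \<longleftrightarrow> (\<exists>c. null_contractions d n c \<and> c (idNC n) = 1)"
proof -
  have "(\<exists>c. c (id_matching n) = 1 \<and>
     (\<forall>i. Suc i < n \<longrightarrow> null_at d n (Bot i) (Bot (Suc i)) c \<and> null_at d n (Top i) (Top (Suc i)) c))
    \<longleftrightarrow> (\<exists>c. null_contractions d n c \<and> c (idNC n) = 1)" (is "?L \<longleftrightarrow> ?R")
  proof
    assume ?R
    then obtain c where "null_contractions d n c" "c (idNC n) = 1" by blast
    then show ?L unfolding null_contractions_iff linear_id[symmetric] by (intro exI[of _ "\<lambda>D. c (linear n n D)"]) simp
  next
    assume ?L
    then obtain c where c: "c (id_matching n) = 1" and
      null: "\<And>i. Suc i < n \<Longrightarrow> null_at d n (Bot i) (Bot (Suc i)) c"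
      "\<And>i. Suc i < n \<Longrightarrow> null_at d n (Top i) (Top (Suc i)) c" by blast
    define c' where "c' D = c (inv_into (matchings n n) (linear n n) D)" for D
    have inj: "inj_on (linear n n) (matchings n n)" using linear_bij by (auto simp: bij_betw_def)
    have c': "c D = c' (linear n n D)" if "D \<in> matchings n n" for D
      using inv_into_f_f[OF inj that] by (simp add: c'_def)
    have "null_contractions d n c'" unfolding null_contractions_iff
      using null_at_cong[OF c' null(1)] null_at_cong[OF c' null(2)] by blast
    moreover have "c' (idNC n) = 1" using c'[OF id_in_matchings] c by (simp add: linear_id)
    ultimately show ?R by blast
  qed
  then show ?thesis unfolding jones_wenzl_iff_null .
qed

theorem theoremA2:
  fixes h :: "int poly \<Rightarrow> 'a::{comm_ring, comm_monoid_mult}" and n :: nat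
  assumes h_add: "\<And>p q. h (p + q) = h p + h q"
    and h_mult: "\<And>p q. h (p * q) = h p * h q"
    and h_one: "h 1 = 1"
    and n_pos: "n > 0"
  shows "(\<exists>J. jones_wenzl_projector (h [:0, 1:]) n J) \<longleftrightarrow> (\<forall>k<n. h (qbinom n k) dvd 1)"
proof -
  interpret delta_image h by unfold_locales (fact h_add h_mult h_one)+
  have "(\<exists>c. null_contractions (h delta) n c \<and> c (idNC n) = 1) \<longleftrightarrow> (\<forall>k<n. h (qbin n k) dvd 1)"
    using unit_of_null_contractions null_contractions_of_units by (meson less_imp_le)
  then show ?thesis
    unfolding jones_wenzl_iff_null_contractions delta_def[symmetric] by (simp add: qbinom_eq_qbin)
qed

end
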